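(* For every $c\in\mathbb{C}$ and $x\in\mathbb{C}$, the functor $\mathcal{F}^c_x:\mathcal{C}_F\to\mathcal{D}_B$ is fully faithful.
   Context: Notation. Fix $\tau\in\mathbb{C}$ with $\mathrm{Im}(\tau)>0$, $\gamma\in\mathbb{R}\setminus\mathbb{Q}$ and an integer $n\ge 2$. Let $(v_i)_{i=1}^n$ be the canonical basis of $\mathbb{C}^n$ and $E_{ij}$ the matrix units, $E_{ij}v_k=\delta_{jk}v_i$. Let $\mathfrak{h}$ be the space of diagonal traceless $n\times n$ matrices, with $\mathfrak{h}^*$ identified with $\{\lambda=\sum_i\lambda_iE_{ii}^*\mid\sum_i\lambda_i=0\}$; the weight of $v_i$ is $\omega_i=E_{ii}^*-\frac1n\sum_kE_{kk}^*$. Put $\theta_{\kappa,\kappa'}(t;\tau)=\sum_{m\in\mathbb{Z}}e^{i\pi(m+\kappa)((m+\kappa)\tau+2(t+\kappa'))}$ and $\theta(t)=\theta_{\frac12,\frac12}(t;\tau)$. Let $\xi=e^{2i\pi/n}$ and let $A,B$ be the matrices with $Av_k=\xi^{k-1}v_k$, $Bv_k=v_{k-1}$ for $k\ge2$, $Bv_1=v_n$. Lower indices on operators indicate the tensor factors on which they act. Convention: for diagonalizable $\mathfrak{h}$-modules, $a(\lambda\pm\gamma h_l)$ acts as $a(\lambda\pm\gamma\mu)$ on vectors whose $l$-th tensor component has weight $\mu$. Belavin's R-matrix. $R^B(z)\in\mathrm{End}(\mathbb{C}^n)\otimes\mathrm{End}(\mathbb{C}^n)$ is uniquely determined by: (1)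 $R^B(z)R^B_{21}(-z)=1$; (2) $R^B$ is meromorphic with simple poles at $z\in\gamma+\mathbb{Z}+\tau\mathbb{Z}$ (and no other poles); (3) $R^B(0)=P$, the permutation $x\otimes y\mapsto y\otimes x$; (4) $R^B(z+1)=A_1R^B(z)A_1^{-1}=A_2^{-1}R^B(z)A_2$ and $R^B(z+\tau)=e^{-2i\pi\frac{n-1}{n}\gamma}B_1R^B(z)B_1^{-1}=e^{-2i\pi\frac{n-1}{n}\gamma}B_2^{-1}R^B(z)B_2$. Category $\mathcal{D}_B$. Let $M_{\mathfrak{h}^*}$ be the field of meromorphic functions on $\mathfrak{h}^*$ that are $(n\omega_i)$-periodic for all $i$, $D_{\mathfrak{h}^*}$ the $\mathbb{C}$-algebra generated by $M_{\mathfrak{h}^*}$ and the shifts $T_\mu:f(\lambda)\mapsto f(\lambda+\mu)$, $\mu\in\mathfrak{h}^*$; $V_{\mathfrak{h}^*}=M_{\mathfrak{h}^*}\otimes V$ and $D(V)=D_{\mathfrak{h}^*}\otimes\mathrm{End}(V)$. Objects of $\mathcal{D}_B$: pairs $(V,L(z))$ with $V$ a finite-dimensional vector space and $L(z)\in\mathrm{End}(\mathbb{C}^n)\otimes D(V)$ an invertible operator with coefficients meromorphic in $z$, satisfying $R^B_{12}(z-w)L_{13}(z)L_{23}(w)=L_{23}(w)L_{13}(z)R^B_{12}(z-w)$ in $\mathrm{End}(\mathbb{C}^n)\otimes\mathrm{End}(\mathbb{C}^n)\otimes D(V)$. Morphisms $(V,L)\to(V',L')$: $(n\omega_i)$-periodic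 meromorphic functions $\varphi:\mathfrak{h}^*\to\mathrm{Hom}(V,V')$ with $(1\otimes\varphi)L(z)=L'(z)(1\otimes\varphi)$ as operators $\mathbb{C}^n\otimes V_{\mathfrak{h}^*}\to\mathbb{C}^n\otimes V'_{\mathfrak{h}^*}$. Felder's R-matrix. Let $\alpha(z,l)=\frac{\theta(l+\gamma)\theta(z)}{\theta(l)\theta(z-\gamma)}$, $\beta(z,l)=\frac{\theta(z-l)\theta(\gamma)}{\theta(l)\theta(z-\gamma)}$ and $R^F(z,\lambda)=\sum_iE_{ii}\otimes E_{ii}+\sum_{i\ne j}\alpha(z,\lambda_i-\lambda_j)E_{ii}\otimes E_{jj}+\sum_{i\ne j}\beta(z,\lambda_i-\lambda_j)E_{ji}\otimes E_{ij}$. Category $\mathcal{C}_F$. Objects: pairs $(V,L(z,\lambda))$ with $V$ a finite-dimensional diagonalizable $\mathfrak{h}$-module and $L:\mathbb{C}\times\mathfrak{h}^*\to\mathrm{End}(\mathbb{C}^n)\otimes\mathrm{End}(V)$ invertible meromorphic, $(n\omega_i)$-periodic in $\lambda$ for all $i$, with $[h_1+h_2,L(z,\lambda)]=0$ for $h\in\mathfrak{h}$ and $R^F_{12}(z-w,\lambda-\gamma h_3)L_{13}(z,\lambda)L_{23}(w,\lambda-\gamma h_1)=L_{23}(w,\lambda)L_{13}(z,\lambda-\gamma h_2)R^F_{12}(z-w,\lambda)$. Morphisms $(V,L)\to(V',L')$: $(n\omega_i)$-periodic meromorphic weight-zero maps $\varphi(\lambda):V\to V'$ with $L'(z,\lambda)(1\otimes\varphi(\lambda-\gamma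 h_1))=(1\otimes\varphi(\lambda))L(z,\lambda)$. The matrix $S$. Let $\Phi:\mathbb{C}\to\mathbb{C}^n$ be the nonzero holomorphic function (unique up to a scalar) with $\Phi(u+1)=A\Phi(u)$ and $\Phi(u+\tau)=e^{-i\pi\tau/n-2i\pi u/n}B\Phi(u)$; explicitly one may take the $l$-th component to be $\theta_{(l-1)/n,0}(u;n\tau)$, $l=1,\dots,n$. Let $S(z,\lambda)$ be the $n\times n$ matrix whose $j$-th column is $\Phi(z-n\lambda_j)$; it is invertible for generic $(z,\lambda)$. The functor $\mathcal{F}^c_x$. Let $e^{-\gamma D_1}$ be the shift operator sending $f(\lambda)v_i\otimes y$ to $f(\lambda-\gamma\omega_i)v_i\otimes y$. The functor $\mathcal{F}^c_x:\mathcal{C}_F\to\mathcal{D}_B$ sends $(V,L(z,\lambda))$ to $(V,\ S_1(z-x,\lambda-\gamma h_2)L(z,\lambda)e^{-\gamma D_1}S_1(z-x-c,\lambda)^{-1})$, and sends a morphism $\varphi(\lambda)$ to itself.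
   Formalization: Full faithfulness is proved for pairs of objects with no distinct weights μ, ν such that γ(μ_i−ν_i) ∈ ℤ+τℤ for all i; without this fullness fails (V of weight 0, V' of weight (E_ii*−E_jj* )/γ, both L=1). That the functor lands in D_B is taken from the context. *)

theory Defs
  imports "HOL-Analysis.Analysis"
begin

class complex_vector = real_vector +
  fixes scaleC :: "complex \<Rightarrow> 'a \<Rightarrow> 'a" (infixr "*\<^sub>C" 75)
  assumes scaleC_add_right: "a *\<^sub>C (x + y) = a *\<^sub>C x + a *\<^sub>C y"
    and scaleC_add_left: "(a + b) *\<^sub>C x = a *\<^sub>C x + b *\<^sub>C x"
    and scaleC_scaleC: "a *\<^sub>C (b *\<^sub>C x) = (a * b) *\<^sub>C x"
    and scaleC_one: "1 *\<^sub>C x = x"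
    and scaleC_of_real: "of_real r *\<^sub>C x = r *\<^sub>R x"

global_interpretation complex_vector:
  vector_space "scaleC :: complex \<Rightarrow> 'a \<Rightarrow> 'a::complex_vector"
  by unfold_locales
    (simp_all add: scaleC_add_right scaleC_add_left scaleC_scaleC scaleC_one)

instantiation complex :: complex_vector
begin
definition scaleC_complex_def: "a *\<^sub>C x = a * (x::complex)"
instance
  by standard (simp_all add: scaleC_complex_def algebra_simps scaleR_conv_of_real)
end

instantiation prod :: (complex_vector, complex_vector) complex_vector
begin
definition scaleC_prod_def: "a *\<^sub>C p = (a *\<^sub>C fst p, a *\<^sub>C snd p)"
instance
  by standard (simp_all add: scaleC_prod_def scaleC_add_right scaleC_add_left scaleC_scaleC
      scaleC_one scaleC_of_real prod_eq_iff)
end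

instantiation vec :: (complex_vector, finite) complex_vector
begin
definition scaleC_vec_def: "a *\<^sub>C x = (\<chi> i. a *\<^sub>C (x $ i))"
instance
  by standard (simp_all add: scaleC_vec_def scaleC_add_right scaleC_add_left scaleC_scaleC
      scaleC_one scaleC_of_real vec_eq_iff)
end

abbreviation clinear :: "('a::complex_vector \<Rightarrow> 'b::complex_vector) \<Rightarrow> bool"
  where "clinear \<equiv> Vector_Spaces.linear scaleC scaleC"

definition finite_dim :: "'v::complex_vector itself \<Rightarrow> bool"
  where "finite_dim _ \<longleftrightarrow> (\<exists>B::'v set. finite B \<and> complex_vector.span B = UNIV)"

text \<open>A meromorphic function on a complex vector space \<open>E\<close> (a complex subspace of some ambient
  type) is represented by a total function that is locally a quotient \<open>p / q\<close> of holomorphic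
  functions. Its values on the polar set are meaningless, and so are its values outside \<open>E\<close>.
  Two representatives give the same meromorphic function iff they agree on a dense open subset
  of \<open>E\<close>; every identity between meromorphic functions is therefore stated with
  \<open>generically\<close>.\<close>

definition generically :: "'a::topological_space set \<Rightarrow> ('a \<Rightarrow> bool) \<Rightarrow> bool"
  where "generically E P \<longleftrightarrow>
    (\<exists>U. openin (top_of_set E) U \<and> E \<subseteq> closure U \<and> (\<forall>x\<in>U. P x))"

definition holo_on ::
    "'a::{complex_vector,real_normed_vector} set \<Rightarrow> 'a set \<Rightarrow> ('a \<Rightarrow> complex) \<Rightarrow> bool"
  where "holo_on E U f \<longleftrightarrow>
    (\<forall>x\<in>U. \<exists>D. (f has_derivative D) (at x within E) \<and> (\<forall>c. \<forall>v\<in>E. D (c *\<^sub>C v) = c * D v))"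

definition mero_on ::
    "'a::{complex_vector,real_normed_vector} set \<Rightarrow> ('a \<Rightarrow> complex) \<Rightarrow> bool"
  where "mero_on E f \<longleftrightarrow>
    (\<forall>x\<in>E. \<exists>U p q. openin (top_of_set E) U \<and> x \<in> U \<and> holo_on E U p \<and> holo_on E U q \<and>
       U \<subseteq> closure {y\<in>U. q y \<noteq> 0} \<and> (\<forall>y\<in>U. q y \<noteq> 0 \<longrightarrow> f y = p y / q y))"

text \<open>Meromorphic functions with values in a finite-dimensional space, and in a space of linear
  maps between finite-dimensional spaces, through their coordinates.\<close>

definition mero_vec ::
    "'a::{complex_vector,real_normed_vector} set \<Rightarrow> ('a \<Rightarrow> 'v::complex_vector) \<Rightarrow> bool"
  where "mero_vec E f \<longleftrightarrow> (\<forall>l::'v \<Rightarrow> complex. clinear l \<longrightarrow> mero_on E (\<lambda>x. l (f x)))"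

definition mero_lin ::
    "'a::{complex_vector,real_normed_vector} set \<Rightarrow>
     ('a \<Rightarrow> 'v::complex_vector \<Rightarrow> 'w::complex_vector) \<Rightarrow> bool"
  where "mero_lin E \<phi> \<longleftrightarrow> (\<forall>x\<in>E. clinear (\<phi> x)) \<and> (\<forall>v. mero_vec E (\<lambda>x. \<phi> x v))"

type_synonym 'n cvec = "(complex, 'n) vec"
type_synonym 'n cmat = "((complex, 'n) vec, 'n) vec"
type_synonym 'n tmat = "('n \<times> 'n) cmat"

text \<open>The index set \<open>{1, \<dots>, n}\<close> is a finite linearly ordered type \<open>'n\<close>; \<open>idx\<close> is the
  zero-based position, so the usual index is \<open>idx k + 1\<close>.\<close>

definition idx :: "'n::{finite,linorder} \<Rightarrow> nat"
  where "idx k = card {j. j < k}"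

text \<open>Both \<open>\<hh>\<close> (a diagonal traceless matrix is given by its diagonal) and \<open>\<hh>*\<close> are the hyperplane
  of vectors with coordinate sum 0; the pairing is the standard bilinear one.\<close>

definition traceless :: "('n::finite cvec) set"
  where "traceless = {u. (\<Sum>i\<in>UNIV. u $ i) = 0}"

abbreviation cartan :: "('n::finite cvec) set" where "cartan \<equiv> traceless"
abbreviation hstar :: "('n::finite cvec) set" where "hstar \<equiv> traceless"

definition pairing :: "'n::finite cvec \<Rightarrow> 'n cvec \<Rightarrow> complex"
  where "pairing \<mu> h = (\<Sum>i\<in>UNIV. \<mu> $ i * h $ i)"

definition omega :: "'n::finite \<Rightarrow> 'n cvec"
  where "omega i = (\<chi> k. (if k = i then 1 else 0) - 1 / of_nat CARD('n))"

definition lam_periodic :: "('n::finite cvec \<Rightarrow> 'b) \<Rightarrow> bool"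
  where "lam_periodic f \<longleftrightarrow>
    (\<forall>i. generically hstar (\<lambda>lam. f (lam + of_nat CARD('n) *\<^sub>C omega i) = f lam))"

definition h_module :: "('n::finite cvec \<Rightarrow> 'v::complex_vector \<Rightarrow> 'v) \<Rightarrow> bool"
  where "h_module act \<longleftrightarrow>
    (\<forall>h\<in>cartan. clinear (act h)) \<and>
    (\<forall>h\<in>cartan. \<forall>h'\<in>cartan. \<forall>v. act (h + h') v = act h v + act h' v) \<and>
    (\<forall>h\<in>cartan. \<forall>c v. act (c *\<^sub>C h) v = c *\<^sub>C act h v) \<and>
    (\<forall>h\<in>cartan. \<forall>h'\<in>cartan. \<forall>v. act h (act h' v) = act h' (act h v))"

definition weight_space :: "('n::finite cvec \<Rightarrow> 'v::complex_vector \<Rightarrow> 'v) \<Rightarrow> 'n cvec \<Rightarrow> 'v set"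
  where "weight_space act \<mu> = {v. \<forall>h\<in>cartan. act h v = pairing \<mu> h *\<^sub>C v}"

definition weights :: "('n::finite cvec \<Rightarrow> 'v::complex_vector \<Rightarrow> 'v) \<Rightarrow> ('n cvec) set"
  where "weights act = {\<mu>\<in>hstar. \<exists>v\<in>weight_space act \<mu>. v \<noteq> 0}"

definition diagonalizable :: "('n::finite cvec \<Rightarrow> 'v::complex_vector \<Rightarrow> 'v) \<Rightarrow> bool"
  where "diagonalizable act \<longleftrightarrow>
    h_module act \<and> complex_vector.span (\<Union>\<mu>\<in>weights act. weight_space act \<mu>) = UNIV"

text \<open>\<open>weight_comp act v \<mu>\<close> is the component of \<open>v\<close> in the weight space of \<open>\<mu>\<close>.\<close>

definition weight_comp ::
    "('n::finite cvec \<Rightarrow> 'v::complex_vector \<Rightarrow> 'v) \<Rightarrow> 'v \<Rightarrow> 'n cvec \<Rightarrow> 'v"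
  where "weight_comp act v = (THE d.
     (\<forall>\<mu>. d \<mu> \<in> weight_space act \<mu>) \<and> (\<forall>\<mu>. \<mu> \<notin> weights act \<longrightarrow> d \<mu> = 0) \<and>
     v = (\<Sum>\<mu>\<in>weights act. d \<mu>))"

text \<open>\<open>dyn_shift \<gamma> act a \<lambda> v\<close> is \<open>a(\<lambda> - \<gamma> h) v\<close> for a scalar function \<open>a\<close>.\<close>

definition dyn_shift ::
    "real \<Rightarrow> ('n::finite cvec \<Rightarrow> 'v::complex_vector \<Rightarrow> 'v) \<Rightarrow> ('n cvec \<Rightarrow> complex) \<Rightarrow>
     'n cvec \<Rightarrow> 'v \<Rightarrow> 'v"
  where "dyn_shift \<gamma> act a lam v =
    (\<Sum>\<mu>\<in>weights act. a (lam - \<gamma> *\<^sub>R \<mu>) *\<^sub>C weight_comp act v \<mu>)"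

text \<open>\<open>\<complex>\<^sup>n \<otimes> V\<close> is \<open>'n \<Rightarrow> 'v\<close> with \<open>x\<close> standing for \<open>\<Sum>i. v\<^sub>i \<otimes> x i\<close>; an element of
  \<open>End(\<complex>\<^sup>n) \<otimes> End(V)\<close> is the matrix of its blocks. Likewise \<open>\<complex>\<^sup>n \<otimes> \<complex>\<^sup>n \<otimes> V\<close> is
  \<open>'n \<Rightarrow> 'n \<Rightarrow> 'v\<close>, and \<open>End(\<complex>\<^sup>n) \<otimes> End(\<complex>\<^sup>n)\<close> consists of the matrices indexed by \<open>'n \<times> 'n\<close>.\<close>

type_synonym ('n, 'v) blocks = "'n \<Rightarrow> 'n \<Rightarrow> 'v \<Rightarrow> 'v"

definition blocks_apply ::
    "('n::finite, 'v::complex_vector) blocks \<Rightarrow> ('n \<Rightarrow> 'v) \<Rightarrow> 'n \<Rightarrow> 'v"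
  where "blocks_apply M x = (\<lambda>i. \<Sum>j\<in>UNIV. M i j (x j))"

definition matrix_unit :: "'n::finite \<Rightarrow> 'n \<Rightarrow> 'n cmat"
  where "matrix_unit i j = (\<chi> a b. if a = i \<and> b = j then 1 else 0)"

definition tensor :: "'n cmat \<Rightarrow> 'n cmat \<Rightarrow> 'n::finite tmat"
  where "tensor M N = (\<chi> p q. M $ fst p $ fst q * N $ snd p $ snd q)"

definition flip :: "'n::finite tmat"
  where "flip = (\<chi> p q. if fst p = snd q \<and> snd p = fst q then 1 else 0)"

text \<open>The extra index argument of \<open>op13\<close> and \<open>op23\<close> is the index in the remaining factor \<open>\<complex>\<^sup>n\<close>,
  on whose weight the blocks may depend.\<close>

definition op12 :: "'n::finite tmat \<Rightarrow> ('n \<Rightarrow> 'n \<Rightarrow> 'v::complex_vector) \<Rightarrow> 'n \<Rightarrow> 'n \<Rightarrow> 'v"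
  where "op12 M x = (\<lambda>a b. \<Sum>k\<in>UNIV. \<Sum>l\<in>UNIV. M $ (a, b) $ (k, l) *\<^sub>C x k l)"

definition op12_dyn ::
    "real \<Rightarrow> ('n cvec \<Rightarrow> 'v::complex_vector \<Rightarrow> 'v) \<Rightarrow> ('n cvec \<Rightarrow> 'n::finite tmat) \<Rightarrow>
     'n cvec \<Rightarrow> ('n \<Rightarrow> 'n \<Rightarrow> 'v) \<Rightarrow> 'n \<Rightarrow> 'n \<Rightarrow> 'v"
  where "op12_dyn \<gamma> act M lam x = (\<lambda>a b. \<Sum>k\<in>UNIV. \<Sum>l\<in>UNIV.
    dyn_shift \<gamma> act (\<lambda>lam'. M lam' $ (a, b) $ (k, l)) lam (x k l))"

definition op13 ::
    "('n::finite \<Rightarrow> ('n, 'v::complex_vector) blocks) \<Rightarrow> ('n \<Rightarrow> 'n \<Rightarrow> 'v) \<Rightarrow> 'n \<Rightarrow> 'n \<Rightarrow> 'v"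
  where "op13 M x = (\<lambda>a b. \<Sum>k\<in>UNIV. M b a k (x k b))"

definition op23 ::
    "('n::finite \<Rightarrow> ('n, 'v::complex_vector) blocks) \<Rightarrow> ('n \<Rightarrow> 'n \<Rightarrow> 'v) \<Rightarrow> 'n \<Rightarrow> 'n \<Rightarrow> 'v"
  where "op23 M x = (\<lambda>a b. \<Sum>l\<in>UNIV. M a b l (x a l))"

definition mero_blocks ::
    "(complex \<Rightarrow> 'n cvec \<Rightarrow> ('n::finite, 'v::complex_vector) blocks) \<Rightarrow> bool"
  where "mero_blocks L \<longleftrightarrow>
    (\<forall>i j. mero_lin (UNIV \<times> hstar) (\<lambda>(z, lam). L z lam i j)) \<and>
    (\<forall>k. generically (UNIV \<times> hstar)
       (\<lambda>(z, lam). L z (lam + of_nat CARD('n) *\<^sub>C omega k) = L z lam))"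

definition theta_char :: "complex \<Rightarrow> complex \<Rightarrow> complex \<Rightarrow> complex \<Rightarrow> complex"
  where "theta_char \<kappa> \<kappa>' t \<tau> =
    (\<Sum>\<^sub>\<infinity>m\<in>(UNIV::int set).
       exp (\<i> * pi * (of_int m + \<kappa>) * ((of_int m + \<kappa>) * \<tau> + 2 * (t + \<kappa>'))))"

definition theta :: "complex \<Rightarrow> complex \<Rightarrow> complex"
  where "theta \<tau> t = theta_char (1/2) (1/2) t \<tau>"

definition alpha :: "complex \<Rightarrow> real \<Rightarrow> complex \<Rightarrow> complex \<Rightarrow> complex"
  where "alpha \<tau> \<gamma> z l = theta \<tau> (l + \<gamma>) * theta \<tau> z / (theta \<tau> l * theta \<tau> (z - \<gamma>))"

definition beta :: "complex \<Rightarrow> real \<Rightarrow> complex \<Rightarrow> complex \<Rightarrow> complex"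
  where "beta \<tau> \<gamma> z l = theta \<tau> (z - l) * theta \<tau> \<gamma> / (theta \<tau> l * theta \<tau> (z - \<gamma>))"

definition R_Felder :: "complex \<Rightarrow> real \<Rightarrow> complex \<Rightarrow> 'n cvec \<Rightarrow> 'n::finite tmat"
  where "R_Felder \<tau> \<gamma> z lam =
    (\<Sum>i\<in>UNIV. tensor (matrix_unit i i) (matrix_unit i i))
    + (\<Sum>i\<in>UNIV. \<Sum>j\<in>UNIV - {i}.
         alpha \<tau> \<gamma> z (lam $ i - lam $ j) *\<^sub>C tensor (matrix_unit i i) (matrix_unit j j))
    + (\<Sum>i\<in>UNIV. \<Sum>j\<in>UNIV - {i}.
         beta \<tau> \<gamma> z (lam $ i - lam $ j) *\<^sub>C tensor (matrix_unit j i) (matrix_unit i j))"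

definition lattice :: "complex \<Rightarrow> complex set"
  where "lattice \<tau> = {of_int a + of_int b * \<tau> |a b. True}"

definition matA :: "'n::{finite,linorder} cmat"
  where "matA = (\<chi> a k. if a = k then exp (2 * \<i> * pi / of_nat CARD('n)) ^ idx k else 0)"

definition matB :: "'n::{finite,linorder} cmat"
  where "matB = (\<chi> a k. if (idx a + 1) mod CARD('n) = idx k then 1 else 0)"

definition is_R_Belavin ::
    "complex \<Rightarrow> real \<Rightarrow> (complex \<Rightarrow> 'n::{finite,linorder} tmat) \<Rightarrow> bool"
  where "is_R_Belavin \<tau> \<gamma> R \<longleftrightarrow>
    (let poles = {of_real \<gamma> + p |p. p \<in> lattice \<tau>};
         q = exp (- 2 * \<i> * pi * (of_nat (CARD('n) - 1) / of_nat CARD('n)) * of_real \<gamma>);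
         A1 = tensor matA (mat 1); A2 = tensor (mat 1) matA;
         B1 = tensor matB (mat 1); B2 = tensor (mat 1) matB
     in (\<forall>z. z \<notin> poles \<and> - z \<notin> poles \<longrightarrow> R z ** (flip ** R (- z) ** flip) = mat 1) \<and>
        (\<forall>p q. (\<lambda>z. R z $ p $ q) holomorphic_on (- poles)) \<and>
        (\<forall>z0\<in>poles. \<exists>C. C \<noteq> 0 \<and> ((\<lambda>z. (z - z0) *\<^sub>C R z) \<longlongrightarrow> C) (at z0)) \<and>
        R 0 = flip \<and>
        (\<forall>z. z \<notin> poles \<longrightarrow>
           R (z + 1) = A1 ** R z ** matrix_inv A1 \<and>
           R (z + 1) = matrix_inv A2 ** R z ** A2 \<and>
           R (z + \<tau>) = q *\<^sub>C (B1 ** R z ** matrix_inv B1) \<and>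
           R (z + \<tau>) = q *\<^sub>C (matrix_inv B2 ** R z ** B2)))"

text \<open>The vector space underlying an object is the type \<open>'v\<close>, so different objects of one category
  may live over different types.\<close>

record ('n::finite, 'v) CF_object =
  action :: "'n cvec \<Rightarrow> 'v \<Rightarrow> 'v"
  L_op :: "complex \<Rightarrow> 'n cvec \<Rightarrow> ('n, 'v) blocks"

definition CF_objects ::
    "complex \<Rightarrow> real \<Rightarrow> ('n::{finite,linorder}, 'v::complex_vector) CF_object set"
  where "CF_objects \<tau> \<gamma> = {X. let act = action X; L = L_op X in
    finite_dim TYPE('v) \<and> diagonalizable act \<and> mero_blocks L \<and>
    generically (UNIV \<times> hstar) (\<lambda>(z, lam). bij (blocks_apply (L z lam))) \<and>
    generically (UNIV \<times> hstar) (\<lambda>(z, lam). \<forall>h\<in>cartan. \<forall>x i.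
       blocks_apply (L z lam) (\<lambda>j. h $ j *\<^sub>C x j + act h (x j)) i =
       h $ i *\<^sub>C blocks_apply (L z lam) x i + act h (blocks_apply (L z lam) x i)) \<and>
    generically (UNIV \<times> UNIV \<times> hstar) (\<lambda>(z, w, lam). \<forall>x.
       op12_dyn \<gamma> act (R_Felder \<tau> \<gamma> (z - w)) lam
         (op13 (\<lambda>_. L z lam) (op23 (\<lambda>a. L w (lam - \<gamma> *\<^sub>R omega a)) x)) =
       op23 (\<lambda>_. L w lam) (op13 (\<lambda>b. L z (lam - \<gamma> *\<^sub>R omega b))
         (op12 (R_Felder \<tau> \<gamma> (z - w) lam) x)))}"

text \<open>Morphisms are meromorphic functions, hence classes of representatives that agree
  generically.\<close>

definition mero_class :: "('n::finite cvec \<Rightarrow> 'b) \<Rightarrow> ('n cvec \<Rightarrow> 'b) set"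
  where "mero_class \<phi> = {\<psi>. generically hstar (\<lambda>lam. \<psi> lam = \<phi> lam)}"

definition CF_hom ::
    "real \<Rightarrow> ('n::{finite,linorder}, 'v::complex_vector) CF_object \<Rightarrow>
     ('n, 'w::complex_vector) CF_object \<Rightarrow> ('n cvec \<Rightarrow> 'v \<Rightarrow> 'w) set set"
  where "CF_hom \<gamma> X Y = mero_class ` {\<phi>.
    mero_lin hstar \<phi> \<and> lam_periodic \<phi> \<and>
    generically hstar (\<lambda>lam. \<forall>h\<in>cartan. \<forall>v. \<phi> lam (action X h v) = action Y h (\<phi> lam v)) \<and>
    generically (UNIV \<times> hstar) (\<lambda>(z, lam). \<forall>x i.
       blocks_apply (L_op Y z lam) (\<lambda>j. \<phi> (lam - \<gamma> *\<^sub>R omega j) (x j)) i =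
       \<phi> lam (blocks_apply (L_op X z lam) x i))}"

text \<open>An operator on \<open>\<complex>\<^sup>n \<otimes> V\<^bsub>\<hh>*\<^esub>\<close> depending on \<open>z\<close>. The functions in \<open>\<complex>\<^sup>n \<otimes> V\<^bsub>\<hh>*\<^esub>\<close> are those in
  \<open>lam_sections\<close>. An element of \<open>End(\<complex>\<^sup>n) \<otimes> D(V)\<close> depending meromorphically on \<open>z\<close> is a finite
  sum of shifts with coefficients meromorphic in \<open>(z, \<lambda>)\<close>.\<close>

type_synonym ('n, 'v) DB_operator =
  "complex \<Rightarrow> ('n cvec \<Rightarrow> 'n \<Rightarrow> 'v) \<Rightarrow> 'n cvec \<Rightarrow> 'n \<Rightarrow> 'v"

definition lam_sections :: "('n cvec \<Rightarrow> 'n::finite \<Rightarrow> 'v::complex_vector) set"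
  where "lam_sections = {f. (\<forall>i. mero_vec hstar (\<lambda>lam. f lam i)) \<and> lam_periodic f}"

definition difference_operators :: "('n::finite, 'v::complex_vector) DB_operator set"
  where "difference_operators = {L. \<exists>M a. finite M \<and> M \<subseteq> hstar \<and> (\<forall>\<mu>\<in>M. mero_blocks (a \<mu>)) \<and>
    (\<forall>z f. \<forall>lam\<in>hstar. L z f lam = (\<lambda>i. \<Sum>\<mu>\<in>M. blocks_apply (a \<mu> z lam) (f (lam + \<mu>)) i))}"

definition DB_op13 ::
    "('n, 'v) DB_operator \<Rightarrow> complex \<Rightarrow>
     ('n::finite cvec \<Rightarrow> 'n \<Rightarrow> 'n \<Rightarrow> 'v) \<Rightarrow> 'n cvec \<Rightarrow> 'n \<Rightarrow> 'n \<Rightarrow> 'v"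
  where "DB_op13 L z F = (\<lambda>lam a b. L z (\<lambda>lam' k. F lam' k b) lam a)"

definition DB_op23 ::
    "('n, 'v) DB_operator \<Rightarrow> complex \<Rightarrow>
     ('n::finite cvec \<Rightarrow> 'n \<Rightarrow> 'n \<Rightarrow> 'v) \<Rightarrow> 'n cvec \<Rightarrow> 'n \<Rightarrow> 'n \<Rightarrow> 'v"
  where "DB_op23 L z F = (\<lambda>lam a b. L z (\<lambda>lam' l. F lam' a l) lam b)"

definition DB_objects ::
    "complex \<Rightarrow> real \<Rightarrow> ('n::{finite,linorder}, 'v::complex_vector) DB_operator set"
  where "DB_objects \<tau> \<gamma> = {L.
    finite_dim TYPE('v) \<and> L \<in> difference_operators \<and>
    (\<exists>L'\<in>difference_operators. \<forall>f\<in>lam_sections. generically (UNIV \<times> hstar)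
       (\<lambda>(z, lam). L z (L' z f) lam = f lam \<and> L' z (L z f) lam = f lam)) \<and>
    (\<exists>R. is_R_Belavin \<tau> \<gamma> R \<and>
      (\<forall>F. (\<forall>a b. mero_vec hstar (\<lambda>lam. F lam a b)) \<and> lam_periodic F \<longrightarrow>
        generically (UNIV \<times> UNIV \<times> hstar) (\<lambda>(z, w, lam).
          op12 (R (z - w)) (DB_op13 L z (DB_op23 L w F) lam) =
          DB_op23 L w (DB_op13 L z (\<lambda>lam'. op12 (R (z - w)) (F lam'))) lam)))}"

text \<open>The defining condition of a morphism involves only the underlying pairs \<open>(V, L)\<close>, so the
  hom-sets are defined for all such pairs; the category is the full subcategory on
  \<open>DB_objects\<close>.\<close>

definition DB_hom ::
    "('n::{finite,linorder}, 'v::complex_vector) DB_operator \<Rightarrow>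
     ('n, 'w::complex_vector) DB_operator \<Rightarrow> ('n cvec \<Rightarrow> 'v \<Rightarrow> 'w) set set"
  where "DB_hom L L' = mero_class ` {\<phi>.
    mero_lin hstar \<phi> \<and> lam_periodic \<phi> \<and>
    (\<forall>f\<in>lam_sections. generically (UNIV \<times> hstar) (\<lambda>(z, lam). \<forall>i.
       \<phi> lam (L z f lam i) = L' z (\<lambda>lam' j. \<phi> lam' (f lam' j)) lam i))}"

definition Phi :: "complex \<Rightarrow> complex \<Rightarrow> 'n::{finite,linorder} cvec"
  where "Phi \<tau> u =
    (\<chi> l. theta_char (of_nat (idx l) / of_nat CARD('n)) 0 u (of_nat CARD('n) * \<tau>))"

definition S_mat :: "complex \<Rightarrow> complex \<Rightarrow> 'n cvec \<Rightarrow> 'n::{finite,linorder} cmat"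
  where "S_mat \<tau> z lam = (\<chi> l j. Phi \<tau> (z - of_nat CARD('n) * lam $ j) $ l)"

definition S1_inv ::
    "complex \<Rightarrow> complex \<Rightarrow> ('n cvec \<Rightarrow> 'n \<Rightarrow> 'v::complex_vector) \<Rightarrow>
     'n cvec \<Rightarrow> 'n::{finite,linorder} \<Rightarrow> 'v"
  where "S1_inv \<tau> z f = (\<lambda>lam i. \<Sum>j\<in>UNIV. matrix_inv (S_mat \<tau> z lam) $ i $ j *\<^sub>C f lam j)"

definition shift_D1 ::
    "real \<Rightarrow> ('n cvec \<Rightarrow> 'n \<Rightarrow> 'v) \<Rightarrow> 'n cvec \<Rightarrow> 'n::finite \<Rightarrow> 'v"
  where "shift_D1 \<gamma> f = (\<lambda>lam i. f (lam - \<gamma> *\<^sub>R omega i) i)"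

definition S1_dyn ::
    "complex \<Rightarrow> real \<Rightarrow> ('n cvec \<Rightarrow> 'v::complex_vector \<Rightarrow> 'v) \<Rightarrow> complex \<Rightarrow>
     ('n cvec \<Rightarrow> 'n \<Rightarrow> 'v) \<Rightarrow> 'n cvec \<Rightarrow> 'n::{finite,linorder} \<Rightarrow> 'v"
  where "S1_dyn \<tau> \<gamma> act z f = (\<lambda>lam i. \<Sum>j\<in>UNIV.
    dyn_shift \<gamma> act (\<lambda>lam'. S_mat \<tau> z lam' $ i $ j) lam (f lam j))"

definition functor_obj ::
    "complex \<Rightarrow> real \<Rightarrow> complex \<Rightarrow> complex \<Rightarrow>
     ('n::{finite,linorder}, 'v::complex_vector) CF_object \<Rightarrow> ('n, 'v) DB_operator"
  where "functor_obj \<tau> \<gamma> c x X = (\<lambda>z f.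
    S1_dyn \<tau> \<gamma> (action X) (z - x)
      (\<lambda>lam. blocks_apply (L_op X z lam) (shift_D1 \<gamma> (S1_inv \<tau> (z - x - c) f) lam)))"

definition functor_mor ::
    "('n::finite cvec \<Rightarrow> 'v \<Rightarrow> 'w) set \<Rightarrow> ('n cvec \<Rightarrow> 'v \<Rightarrow> 'w) set"
  where "functor_mor \<phi> = \<phi>"

text \<open>Since \<open>\<Phi>(u + n) = \<Phi>(u)\<close>, the matrix \<open>S(z, \<lambda> - \<gamma>\<mu>)\<close> does not change when \<open>\<gamma>\<mu>\<close> changes by
  an integer vector, so it cannot distinguish two weights whose difference is multiplied by \<open>\<gamma>\<close>
  into the lattice \<open>\<int> + \<tau>\<int>\<close>, and fullness fails for such weights. Distinct weights with rational difference (such as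
  weights in the weight lattice) are never of this kind, because \<open>\<gamma>\<close> is irrational.\<close>

definition nonresonant ::
    "complex \<Rightarrow> real \<Rightarrow> ('n::finite, 'v::complex_vector) CF_object \<Rightarrow>
     ('n, 'w::complex_vector) CF_object \<Rightarrow> bool"
  where "nonresonant \<tau> \<gamma> X Y \<longleftrightarrow>
    (\<forall>\<mu>\<in>weights (action X). \<forall>\<nu>\<in>weights (action Y).
       (\<forall>i. of_real \<gamma> * (\<mu> $ i - \<nu> $ i) \<in> lattice \<tau>) \<longrightarrow> \<mu> = \<nu>)"

lemma nonresonant_if_rational:
  assumes "Im \<tau> > 0" and "\<gamma> \<notin> \<rat>"
    and "\<And>\<mu> \<nu> i. \<mu> \<in> weights (action X) \<Longrightarrow> \<nu> \<in> weights (action Y) \<Longrightarrow>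
           \<exists>r::rat. \<mu> $ i - \<nu> $ i = of_rat r"
  shows "nonresonant \<tau> \<gamma> X Y"
  unfolding nonresonant_def
proof (intro ballI impI)
  fix \<mu> \<nu>
  assume mn: "\<mu> \<in> weights (action X)" "\<nu> \<in> weights (action Y)"
    and lat: "\<forall>i. of_real \<gamma> * (\<mu> $ i - \<nu> $ i) \<in> lattice \<tau>"
  have "\<mu> $ i = \<nu> $ i" for i
  proof -
    obtain r :: rat where r: "\<mu> $ i - \<nu> $ i = of_rat r" using assms(3)[OF mn] by blast
    obtain a b :: int where ab: "of_real \<gamma> * (of_rat r :: complex) = of_int a + of_int b * \<tau>"
      using spec[OF lat, of i] r by (auto simp: lattice_def)
    have rr: "(of_rat r :: complex) = of_real (of_rat r)"
      by (cases r) (simp add: of_rat_rat)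
    have "Im (of_int a + of_int b * \<tau>) = 0"
      unfolding ab[symmetric] rr of_real_mult[symmetric] by simp
    hence "b = 0" using assms(1) by simp
    hence "of_real (\<gamma> * of_rat r) = (of_real (of_int a) :: complex)" using ab rr by simp
    hence eq: "\<gamma> * of_rat r = of_int a" by (simp only: of_real_eq_iff)
    have "r = 0"
    proof (rule ccontr)
      assume "r \<noteq> 0"
      hence "\<gamma> = of_int a / of_rat r" using eq by (simp add: field_simps)
      thus False using assms(2) by (metis Rats_divide Rats_of_int Rats_of_rat)
    qed
    thus ?thesis using r by simp
  qed
  thus "\<mu> = \<nu>" by (simp add: vec_eq_iff)
qed

end

theory Submission
  imports Defs "HOL-Complex_Analysis.Conformal_Mappings"
begin

text \<open>The functor is the identity on morphisms, so the point is that a periodic meromorphic \<open>\<phi>\<close>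
  intertwining the images is of weight zero and intertwines the operators \<open>L\<close>. Testing the hypothesis
  on constants and exponentials in \<open>\<lambda>\<close>, which separate the points \<open>\<lambda> - \<gamma>\<omega>\<^sub>k\<close> because \<open>\<gamma>\<close> is
  irrational, strips off the shift and \<open>S(z - x - c, \<lambda>)\<^sup>-\<^sup>1\<close> and leaves
  \<open>\<phi>(\<lambda>) S(z - x, \<lambda> - \<gamma>h) L(z, \<lambda>) = S(z - x, \<lambda> - \<gamma>h) L'(z, \<lambda>) \<phi>(\<lambda> - \<gamma>h\<^sub>1)\<close> on all vectors.
  Suppose \<open>\<phi>\<close> has a component from weight \<open>\<mu>\<close> to weight \<open>\<nu> \<noteq> \<mu>\<close>. Choose it and a coordinate \<open>k\<close> so that
  \<open>(\<nu> - \<mu>)\<^sub>k\<close> is nonzero with maximal nonnegative real part. As \<open>L\<close> and \<open>L'\<close> preserve the total weight,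
  the columns \<open>j \<noteq> k\<close> of \<open>S(z - x, \<lambda> - \<gamma>\<mu>)\<close> lie in the span of the columns \<open>m \<noteq> k\<close> of
  \<open>S(z - x, \<lambda> - \<gamma>\<nu>)\<close>. For generic \<open>(z, \<lambda>)\<close> this forces \<open>\<Phi>(u + n\<gamma>(\<mu> - \<nu>)\<^sub>j)\<close> to be proportional to \<open>\<Phi>(u)\<close>
  for all \<open>u\<close>, hence \<open>\<gamma>(\<mu> - \<nu>)\<^sub>j \<in> \<int> + \<tau>\<int>\<close> for all \<open>j\<close>, contradicting nonresonance. So \<open>\<phi>\<close> has weight
  zero, commutes with \<open>S(z - x, \<lambda> - \<gamma>h)\<close>, and this generically invertible factor cancels.\<close>

text \<open>As long as \<phi> may change weights, it need not commute with S(z - x, \<lambda> -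
  \<gamma>h), so this factor cannot be cancelled at once; comparing its values at two weights is
  what yields weight zero. The maximality is taken over the finitely many weight shifts of \<phi>:
  increasing a coordinate with nonnegative real part by 1 gives a nonzero coordinate with larger
  real part, so no component of \<phi> has that shift. Since it is the shift required to pass from a
  basis vector with index j \<noteq> k to one with index k, column k drops out and n columns become
  dependent. In their determinant, z and \<lambda> provide n free arguments of \<Phi>, but two
  columns share one of them. The values of \<Phi> span the space, so the other columns may be
  replaced by arbitrary vectors, and the two that share an argument must be proportional. The sum of
  the coordinates being 0 then settles coordinate k. Turning proportionality into a lattice
  condition uses that \<Phi> never vanishes; this follows by dividing the product of its components
  by an explicit theta function.\<close>

section \<open>Entire functions with constant multipliers\<close>

lemma lattice_coordinates:
  assumes "Im \<tau> > 0"
  obtains s t :: real where "u = of_real s + of_real t * \<tau>"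
proof
  show "u = of_real (Re u - Im u / Im \<tau> * Re \<tau>) + of_real (Im u / Im \<tau>) * \<tau>"
    using assms by (simp add: complex_eq_iff)
qed

lemma int_translate_multiplier:
  fixes g :: "complex \<Rightarrow> complex"
  assumes "\<And>u. g (u + w) = g u"
  shows "g (u + of_int k * w) = g u"
proof (induction k rule: int_induct[where k = 0])
  case base
  then show ?case by simp
next
  case (step1 i)
  have "g (u + of_int (i + 1) * w) = g (u + of_int i * w + w)" by (simp add: algebra_simps)
  then show ?case using step1 assms by simp
next
  case (step2 i)
  have "g (u + of_int i * w) = g (u + of_int (i - 1) * w + w)" by (simp add: algebra_simps)
  then show ?case using step2 assms by simp
qed

text \<open>Choosing \<open>\<kappa>\<close> real-linearly makes \<open>\<bar>g(u) exp(\<kappa>u)\<bar>\<close> doubly periodic.\<close>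

lemma entire_constant_multipliers:
  fixes g :: "complex \<Rightarrow> complex"
  assumes tau: "Im \<tau> > 0" and hol: "g holomorphic_on UNIV"
    and c1: "c1 \<noteq> 0" "\<And>u. g (u + 1) = c1 * g u"
    and c2: "c2 \<noteq> 0" "\<And>u. g (u + \<tau>) = c2 * g u"
  obtains C \<kappa> where "\<And>u. g u = C * exp (\<kappa> * u)"
proof -
  \<comment> \<open>The real part cancels the modulus of \<open>c1\<close>; the imaginary part is
    then solved from \<open>Re (\<kappa> * \<tau>) = - ln (norm c2)\<close>.\<close>
  define \<kappa> where "\<kappa> = Complex (- ln (norm c1)) ((ln (norm c2) - ln (norm c1) * Re \<tau>) / Im \<tau>)"
  have k1: "norm (c1 * exp \<kappa>) = 1"
    using c1 by (simp add: norm_mult \<kappa>_def exp_minus)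
  have "Re (\<kappa> * \<tau>) = - ln (norm c2)"
    using tau by (simp add: \<kappa>_def field_simps)
  then have k2: "norm (c2 * exp (\<kappa> * \<tau>)) = 1"
    using c2 by (simp add: norm_mult exp_minus)
  define h where "h = (\<lambda>u. g u * exp (\<kappa> * u))"
  have "norm (h (u + 1)) = norm (h u)" for u
  proof -
    have "h (u + 1) = (c1 * exp \<kappa>) * h u"
      unfolding h_def c1 by (simp add: exp_add distrib_left)
    then show ?thesis using k1 by (simp only: norm_mult mult_1)
  qed
  then have p1: "norm (h (u + of_int k * 1)) = norm (h u)" for u k
    using int_translate_multiplier[of "\<lambda>u. of_real (norm (h u))" 1] by simp
  have "norm (h (u + \<tau>)) = norm (h u)" for u
  proof -
    have "h (u + \<tau>) = (c2 * exp (\<kappa> * \<tau>)) * h u"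
      unfolding h_def c2 by (simp add: exp_add distrib_left)
    then show ?thesis using k2 by (simp only: norm_mult mult_1)
  qed
  then have p2: "norm (h (u + of_int k * \<tau>)) = norm (h u)" for u k
    using int_translate_multiplier[of "\<lambda>u. of_real (norm (h u))" \<tau>] by simp
  have hhol: "h holomorphic_on UNIV"
    unfolding h_def by (intro holomorphic_intros hol)
  \<comment> \<open>The closed period parallelogram: a bound for \<open>h\<close> on this compact
    set is a bound everywhere, so Liouville's theorem applies.\<close>
  define K where "K = (\<lambda>(s, t). of_real s + of_real t * \<tau>) ` ({0..1::real} \<times> {0..1::real})"
  have "compact K"
    unfolding K_def
    by (intro compact_continuous_image) (auto intro!: continuous_intros compact_Times simp: split_def)
  moreover have "continuous_on K h"
    using hhol holomorphic_on_imp_continuous_on continuous_on_subset by blast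
  ultimately have "bounded (h ` K)"
    using compact_continuous_image compact_imp_bounded by blast
  then obtain B where B: "\<And>u. u \<in> K \<Longrightarrow> norm (h u) \<le> B"
    unfolding bounded_iff by blast
  have "norm (h u) \<le> B" for u
  proof -
    obtain s t :: real where u: "u = of_real s + of_real t * \<tau>"
      using lattice_coordinates[OF tau] .
    define v where "v = of_real (frac s) + of_real (frac t) * \<tau>"
    have "u = v + of_int \<lfloor>s\<rfloor> * 1 + of_int \<lfloor>t\<rfloor> * \<tau>"
    proof -
      have "s = frac s + of_int \<lfloor>s\<rfloor>" "t = frac t + of_int \<lfloor>t\<rfloor>" by (simp_all add: frac_def)
      then have "complex_of_real s = of_real (frac s) + of_int \<lfloor>s\<rfloor>"
        "complex_of_real t = of_real (frac t) + of_int \<lfloor>t\<rfloor>"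
        by (metis of_real_add of_real_of_int_eq)+
      then show ?thesis unfolding u v_def by (simp add: algebra_simps)
    qed
    then have "norm (h u) = norm (h v)" using p1 p2 by metis
    moreover have "v \<in> K"
      unfolding K_def v_def 
      by (intro image_eqI[of _ _ "(frac s, frac t)"])
         (simp_all add: less_imp_le[OF frac_lt_1])
    ultimately show ?thesis using B by metis
  qed
  then have "bounded (range h)" unfolding bounded_iff by blast
  then have "h constant_on UNIV" using Liouville_theorem hhol by blast
  then obtain C where C: "\<And>u. h u = C" unfolding constant_on_def by blast
  have "g u = C * exp ((- \<kappa>) * u)" for u
    using C[of u] by (simp add: h_def exp_minus field_simps)
  then show thesis using that by blast
qed

text \<open>An exponential has no zeros, so a single zero already forces the constant in front of it
  to be 0.\<close>

lemma entire_constant_multipliers_eq_0: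
  fixes g :: "complex \<Rightarrow> complex"
  assumes "Im \<tau> > 0" "g holomorphic_on UNIV"
    and "c1 \<noteq> 0" "\<And>u. g (u + 1) = c1 * g u"
    and "c2 \<noteq> 0" "\<And>u. g (u + \<tau>) = c2 * g u"
    and "g u0 = 0"
  shows "g u = 0"
proof -
  obtain C \<kappa> where C: "\<And>u. g u = C * exp (\<kappa> * u)"
    using entire_constant_multipliers[OF assms(1-6)] by blast
  from C[of u0] assms(7) have "C = 0" by simp
  then show ?thesis using C by simp
qed

section \<open>A theta function with known zeros\<close>

text \<open>The infinite q-Pochhammer symbol.\<close>

definition qpoch :: "complex \<Rightarrow> complex \<Rightarrow> complex" where
  "qpoch q w = (\<Prod>m. 1 - q ^ m * w)"

lemma convergent_qpoch:
  fixes q w :: complex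
  assumes "norm q < 1"
  shows "convergent_prod (\<lambda>m. 1 - q ^ m * w)"
proof (rule abs_convergent_prod_imp_convergent_prod)
  have "summable (\<lambda>m. norm q ^ m * norm w)"
    using assms by (intro summable_mult2 summable_geometric) auto
  then show "abs_convergent_prod (\<lambda>m. 1 - q ^ m * w)"
    by (simp add: abs_convergent_prod_conv_summable norm_mult norm_power)
qed

lemma qpoch_split:
  assumes "norm q < 1"
  shows "qpoch q w = (1 - w) * qpoch q (q * w)"
proof -
  have "(\<lambda>m. 1 - q ^ m * w) has_prod ((\<Prod>k<1. 1 - q ^ k * w) * (\<Prod>k. 1 - q ^ (k + 1) * w))"
    by (rule has_prod_ignore_initial_segment'[OF convergent_qpoch[OF assms]])
  from has_prod_unique[OF this] show ?thesis
    by (simp add: qpoch_def algebra_simps)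
qed

lemma qpoch_nonzero:
  assumes "norm q < 1" "\<And>m. q ^ m * w \<noteq> 1"
  shows "qpoch q w \<noteq> 0"
  unfolding qpoch_def
  by (intro prodinf_nonzero convergent_qpoch) (use assms in auto)

text \<open>On a ball of radius \<open>R\<close> the factors differ from 1 by at most
  \<open>norm q ^ m * R\<close>, which is summable, so the polynomial partial products converge
  uniformly there.\<close>

lemma holomorphic_qpoch:
  assumes q: "norm q < 1"
  shows "qpoch q holomorphic_on UNIV"
proof -
  have "qpoch q holomorphic_on ball 0 R" if "R > 0" for R
  proof -
    have lim: "uniform_limit (cball 0 R) (\<lambda>N w. \<Prod>m<N. 1 - q ^ m * w) (qpoch q) sequentially"
    proof -
      have "uniformly_convergent_on (cball 0 R) (\<lambda>N w. \<Sum>m<N. norm ((1 - q ^ m * w) - 1))"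
      proof (rule Weierstrass_m_test'_ev)
        show "\<forall>\<^sub>F m in sequentially. \<forall>w\<in>cball 0 R. norm (norm ((1 - q ^ m * w) - 1)) \<le> norm q ^ m * R"
          by (intro always_eventually) (auto simp: norm_mult norm_power intro!: mult_left_mono)
        show "summable (\<lambda>m. norm q ^ m * R)"
          using q by (intro summable_mult2 summable_geometric) auto
      qed
      then have "uniformly_convergent_on (cball 0 R) (\<lambda>N w. \<Prod>m<N. 1 - q ^ m * w)"
        by (intro uniformly_convergent_on_prod') (auto intro!: continuous_intros)
      then have "uniform_limit (cball 0 R) (\<lambda>N w. \<Prod>m<N. 1 - q ^ m * w)
                   (\<lambda>w. lim (\<lambda>N. \<Prod>m<N. 1 - q ^ m * w)) sequentially"
        using uniformly_convergent_uniform_limit_iff by blast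
      moreover have "lim (\<lambda>N. \<Prod>m<N. 1 - q ^ m * w) = qpoch q w" for w
      proof -
        have "(\<lambda>N. \<Prod>m\<le>N. 1 - q ^ m * w) \<longlonglongrightarrow> qpoch q w"
          unfolding qpoch_def by (intro convergent_prod_LIMSEQ convergent_qpoch q)
        then have "(\<lambda>N. \<Prod>m<N. 1 - q ^ m * w) \<longlonglongrightarrow> qpoch q w"
          using LIMSEQ_lessThan_iff_atMost by blast
        then show ?thesis by (rule limI)
      qed
      ultimately show ?thesis by simp
    qed
    show ?thesis
      by (rule holomorphic_uniform_limit[OF _ lim])
         (auto intro!: always_eventually holomorphic_intros continuous_intros)
  qed
  then have "qpoch q analytic_on ball 0 R" if "R > 0" for R
    using that by (simp add: analytic_on_open)
  then have "qpoch q analytic_on {w}" for w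
    by (rule analytic_on_subset[of _ "ball 0 (norm w + 1)"]) (simp_all add: add_nonneg_pos)
  then have "qpoch q analytic_on UNIV" using analytic_on_analytic_at by blast
  then show ?thesis by (rule analytic_imp_holomorphic)
qed

text \<open>Jacobi's theta function as a product, up to an exponential and a constant factor. Unlike
  the theta series, it shows its zeros and their multiplicities directly.\<close>

definition qtheta :: "complex \<Rightarrow> complex \<Rightarrow> complex" where
  "qtheta \<tau> u = qpoch (exp (2 * \<i> * pi * \<tau>)) (exp (2 * \<i> * pi * u)) *
     qpoch (exp (2 * \<i> * pi * \<tau>)) (exp (2 * \<i> * pi * \<tau>) * exp (- 2 * \<i> * pi * u))"

lemma norm_nome_less_1:
  assumes "Im \<tau> > 0"
  shows "norm (exp (2 * \<i> * pi * \<tau>)) < 1"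
  using assms by simp

lemma holomorphic_qtheta:
  assumes "Im \<tau> > 0"
  shows "qtheta \<tau> holomorphic_on UNIV"
proof -
  note q = holomorphic_qpoch[OF norm_nome_less_1[OF assms]]
  have *: "(\<lambda>u. qpoch (exp (2 * \<i> * pi * \<tau>)) (f u)) holomorphic_on UNIV"
    if "f holomorphic_on UNIV" for f
    using holomorphic_on_compose_gen[OF that q] by (simp add: o_def)
  show ?thesis
    unfolding qtheta_def[abs_def] by (intro holomorphic_intros *)
qed

lemma exp_two_pi_add_1: "exp (2 * \<i> * pi * (u + 1)) = exp (2 * \<i> * pi * u)"
proof -
  have "2 * \<i> * pi * (u + 1) = 2 * \<i> * pi * u + 2 * of_real pi * \<i>" by (simp add: algebra_simps)
  then show ?thesis by (simp only: exp_add exp_two_pi_i mult_1_right)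
qed

lemma qtheta_add_1: "qtheta \<tau> (u + 1) = qtheta \<tau> u"
proof -
  have "exp (- 2 * \<i> * pi * (u + 1)) = exp (- 2 * \<i> * pi * u)"
    using exp_two_pi_add_1[of u] by (simp add: exp_minus)
  then show ?thesis by (simp only: qtheta_def exp_two_pi_add_1)
qed

text \<open>With \<open>w = exp (2 * \<i> * pi * u)\<close> the translation replaces
  \<open>w\<close> by \<open>q * w\<close>: the first product loses the factor \<open>1 - w\<close>,
  the second gains \<open>1 - 1 / w\<close>, and their quotient is \<open>- 1 / w\<close>.\<close>

lemma qtheta_add_tau:
  assumes "Im \<tau> > 0"
  shows "qtheta \<tau> (u + \<tau>) = - exp (- 2 * \<i> * pi * u) * qtheta \<tau> u"
proof -
  define q w where "q = exp (2 * \<i> * pi * \<tau>)" and "w = exp (2 * \<i> * pi * u)"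
  have q: "norm q < 1" using norm_nome_less_1[OF assms] by (simp add: q_def)
  have nz: "w \<noteq> 0" "q \<noteq> 0" by (simp_all add: w_def q_def)
  have w': "exp (- 2 * \<i> * pi * u) = 1 / w" by (simp add: w_def exp_minus field_simps)
  have e: "exp (2 * \<i> * pi * (u + \<tau>)) = q * w" "exp (- 2 * \<i> * pi * (u + \<tau>)) = 1 / (q * w)"
    by (simp_all add: w_def q_def exp_add[symmetric] exp_minus[symmetric] inverse_eq_divide[symmetric]
        algebra_simps)
  have "qtheta \<tau> (u + \<tau>) = qpoch q (q * w) * qpoch q (1 / w)"
    unfolding qtheta_def q_def[symmetric] e using nz by simp
  also have "\<dots> = qpoch q (q * w) * ((1 - 1 / w) * qpoch q (q / w))"
    by (subst qpoch_split[OF q, of "1 / w"]) simp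
  also have "\<dots> = - (1 / w) * ((1 - w) * qpoch q (q * w) * qpoch q (q / w))"
    using nz by (simp add: field_simps)
  also have "\<dots> = - (1 / w) * qtheta \<tau> u"
    unfolding qtheta_def q_def[symmetric] w' w_def[symmetric] qpoch_split[OF q, of w] by simp
  finally show ?thesis using w' by simp
qed

text \<open>A convergent product vanishes only if one of its factors does, and each vanishing factor
  puts \<open>u\<close> or \<open>- u\<close> into the integers up to a multiple of \<tau>.\<close>

lemma qtheta_zero_imp_lattice:
  assumes "Im \<tau> > 0" "qtheta \<tau> u = 0"
  shows "u \<in> lattice \<tau>"
proof -
  define q w where "q = exp (2 * \<i> * pi * \<tau>)" and "w = exp (2 * \<i> * pi * u)"
  have q: "norm q < 1" using norm_nome_less_1[OF assms(1)] by (simp add: q_def)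
  have *: "v + of_nat m * \<tau> \<in> \<int>" if "q ^ m * exp (2 * \<i> * pi * v) = 1" for m v
  proof -
    have "exp (2 * \<i> * pi * (v + of_nat m * \<tau>)) = 1"
      using that by (simp add: q_def exp_of_nat_mult[symmetric] exp_add[symmetric] algebra_simps)
    then obtain k :: int where "2 * \<i> * pi * (v + of_nat m * \<tau>) = 2 * \<i> * pi * of_int k"
      unfolding exp_eq_1 by (auto simp: complex_eq_iff)
    then have "v + of_nat m * \<tau> = of_int k" by simp
    then show ?thesis by simp
  qed
  from assms(2) qpoch_nonzero[OF q] obtain m where
    "q ^ m * exp (2 * \<i> * pi * u) = 1 \<or> q ^ m * (q * exp (- 2 * \<i> * pi * u)) = 1"
    unfolding qtheta_def q_def[symmetric] by (metis mult_eq_0_iff)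
  then have "q ^ m * exp (2 * \<i> * pi * u) = 1 \<or> q ^ Suc m * exp (2 * \<i> * pi * (- u)) = 1"
    by (simp add: algebra_simps)
  then consider "u + of_nat m * \<tau> \<in> \<int>" | "- u + of_nat (Suc m) * \<tau> \<in> \<int>"
    using * by blast
  then show ?thesis
  proof cases
    case 1
    then obtain k where "u + of_nat m * \<tau> = of_int k" by (elim Ints_cases)
    then have "u = of_int k + of_int (- int m) * \<tau>" by (simp add: algebra_simps)
    then show ?thesis unfolding lattice_def by blast
  next
    case 2
    then obtain k where "- u + of_nat (Suc m) * \<tau> = of_int k" by (elim Ints_cases)
    then have "u = of_int (- k) + of_int (int (Suc m)) * \<tau>" by (simp add: algebra_simps)
    then show ?thesis unfolding lattice_def by blast
  qed
qed

text \<open>Reaches every lattice point by steps of length 1 and \<tau>, the only translations whose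
  effect on theta functions is computed directly.\<close>

lemma lattice_induct [consumes 1, case_names 0 add_1 diff_1 add_tau diff_tau]:
  assumes "p \<in> lattice \<tau>"
    and "P 0" "\<And>p. P p \<Longrightarrow> P (p + 1)" "\<And>p. P p \<Longrightarrow> P (p - 1)"
    and "\<And>p. P p \<Longrightarrow> P (p + \<tau>)" "\<And>p. P p \<Longrightarrow> P (p - \<tau>)"
  shows "P p"
proof -
  obtain a b where p: "p = of_int a + of_int b * \<tau>" using assms(1) by (auto simp: lattice_def)
  have a: "P (of_int a)"
    by (induction a rule: int_induct[where k = 0]) (use assms in auto)
  have "P (of_int a + of_int b * \<tau>)"
  proof (induction b rule: int_induct[where k = 0])
    case base
    show ?case using a by simp
  next
    case (step1 i)
    have "of_int a + of_int (i + 1) * \<tau> = of_int a + of_int i * \<tau> + \<tau>" by (simp add: algebra_simps)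
    then show ?case using step1(2) assms(5) by metis
  next
    case (step2 i)
    have "of_int a + of_int (i - 1) * \<tau> = of_int a + of_int i * \<tau> - \<tau>" by (simp add: algebra_simps)
    then show ?case using step2(2) assms(6) by metis
  qed
  then show ?thesis by (simp add: p)
qed

text \<open>Being a simple zero is invariant under both generating translations, so only the point 0
  has to be inspected. There \<open>1 - exp (2 * \<i> * pi * u)\<close> splits off with nonzero
  derivative, and the remaining product is not 0.\<close>

lemma qtheta_simple_zero:
  assumes tau: "Im \<tau> > 0" and "p \<in> lattice \<tau>"
  shows "qtheta \<tau> p = 0 \<and> (\<exists>D. D \<noteq> 0 \<and> (qtheta \<tau> has_field_derivative D) (at p))"
proof -
  define Q where "Q p \<longleftrightarrow> qtheta \<tau> p = 0 \<and> deriv (qtheta \<tau>) p \<noteq> 0" for p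
  have der: "(qtheta \<tau> has_field_derivative deriv (qtheta \<tau>) p) (at p)" for p
    using holomorphic_derivI[OF holomorphic_qtheta[OF tau]] by blast
  have q1: "Q (p + 1) \<longleftrightarrow> Q p" for p
  proof -
    have "((\<lambda>u. qtheta \<tau> (u + 1)) has_field_derivative deriv (qtheta \<tau>) (p + 1)) (at p)"
      using DERIV_shift der by blast
    then have "deriv (qtheta \<tau>) (p + 1) = deriv (qtheta \<tau>) p"
      unfolding qtheta_add_1 using der DERIV_unique by blast
    then show ?thesis by (simp add: Q_def qtheta_add_1)
  qed
  have q2: "Q (p + \<tau>) \<longleftrightarrow> Q p" for p
  proof (cases "qtheta \<tau> p = 0")
    case True
    have "((\<lambda>u. qtheta \<tau> (u + \<tau>)) has_field_derivative deriv (qtheta \<tau>) (p + \<tau>)) (at p)"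
      using DERIV_shift der by blast
    moreover have "((\<lambda>u. - exp (- 2 * \<i> * pi * u) * qtheta \<tau> u) has_field_derivative
        - exp (- 2 * \<i> * pi * p) * deriv (qtheta \<tau>) p) (at p)"
      by (rule derivative_eq_intros der | simp add: True)+
    ultimately have "deriv (qtheta \<tau>) (p + \<tau>) = - exp (- 2 * \<i> * pi * p) * deriv (qtheta \<tau>) p"
      unfolding qtheta_add_tau[OF tau] using DERIV_unique by blast
    then show ?thesis by (simp add: Q_def qtheta_add_tau[OF tau])
  qed (simp add: Q_def qtheta_add_tau[OF tau])
  have "Q 0"
  proof -
    define q where "q = exp (2 * \<i> * pi * \<tau>)"
    have q: "norm q < 1" using norm_nome_less_1[OF tau] by (simp add: q_def)
    define r where "r u = qpoch q (q * exp (2 * \<i> * pi * u)) * qpoch q (q * exp (- 2 * \<i> * pi * u))" for u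
    have s: "qtheta \<tau> u = (1 - exp (2 * \<i> * pi * u)) * r u" for u
      unfolding qtheta_def q_def[symmetric] r_def by (subst qpoch_split[OF q]) simp
    have "q ^ m * q \<noteq> 1" for m
    proof
      assume "q ^ m * q = 1"
      then have "norm q ^ Suc m = 1" by (metis norm_one norm_power power_Suc2)
      moreover have "norm q ^ Suc m < 1" by (rule power_Suc_less_one) (use q in \<open>auto simp: q_def\<close>)
      ultimately show False by simp
    qed
    then have "r 0 \<noteq> 0" unfolding r_def using qpoch_nonzero[OF q] by simp
    moreover have "(r has_field_derivative deriv r 0) (at 0)"
    proof -
      have *: "(\<lambda>u. qpoch q (f u)) holomorphic_on UNIV" if "f holomorphic_on UNIV" for f
        using holomorphic_on_compose_gen[OF that holomorphic_qpoch[OF q]] by (simp add: o_def)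
      have "r holomorphic_on UNIV" unfolding r_def[abs_def] by (intro holomorphic_intros *)
      then show ?thesis using holomorphic_derivI by blast
    qed
    then have "((\<lambda>u. (1 - exp (2 * \<i> * pi * u)) * r u) has_field_derivative - (2 * \<i> * pi) * r 0) (at 0)"
      by (auto intro!: derivative_eq_intros)
    then have "deriv (qtheta \<tau>) 0 = - (2 * \<i> * pi) * r 0"
      unfolding s[symmetric] using der DERIV_unique by blast
    ultimately show ?thesis by (simp add: Q_def s)
  qed
  with assms(2) have "Q p"
  proof (induction rule: lattice_induct)
    case (diff_1 p)
    then show ?case using q1[of "p - 1"] by simp
  next
    case (diff_tau p)
    then show ?case using q2[of "p - \<tau>"] by simp
  qed (use q1 q2 in auto)
  then show ?thesis unfolding Q_def using der by blast
qed

text \<open>At the zeros of \<open>s\<close> the quotient has the junk value \<open>0\<close>, which is also its limit.\<close>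

lemma holomorphic_divide_simple_zeros:
  fixes f g s :: "complex \<Rightarrow> complex"
  assumes "f holomorphic_on UNIV" "g holomorphic_on UNIV" "s holomorphic_on UNIV"
    and z: "\<And>p. s p = 0 \<Longrightarrow> f p = 0 \<and> g p = 0 \<and> (\<exists>D. D \<noteq> 0 \<and> (s has_field_derivative D) (at p))"
  shows "(\<lambda>u. f u * g u / s u) holomorphic_on UNIV"
proof -
  define h where "h = (\<lambda>u. f u * g u / s u)"
  have cont: "isCont s p" "isCont g p" for p
    using assms(2,3) holomorphic_on_imp_continuous_on continuous_on_eq_continuous_at[of UNIV] by auto
  have "h analytic_on {p}" for p
  proof (cases "s p = 0")
    case False
    have "open {u. s u \<noteq> 0}"
      using holomorphic_on_imp_continuous_on[OF assms(3)] by (intro open_Collect_neq) auto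
    moreover have "h holomorphic_on {u. s u \<noteq> 0}"
      unfolding h_def by (intro holomorphic_intros) (use assms(1-3) holomorphic_on_subset in blast)+
    ultimately show ?thesis using False analytic_at by blast
  next
    case True
    then obtain D where D: "D \<noteq> 0" "(s has_field_derivative D) (at p)" "f p = 0" "g p = 0"
      using z by blast
    have ls: "((\<lambda>u. s u / (u - p)) \<longlongrightarrow> D) (at p)"
      using D(2) True unfolding has_field_derivative_iff by simp
    then have "eventually (\<lambda>u. s u / (u - p) \<noteq> 0) (at p)"
      using D(1) tendsto_imp_eventually_ne by blast
    then obtain e where e: "e > 0" "\<And>u. u \<noteq> p \<Longrightarrow> dist u p < e \<Longrightarrow> s u \<noteq> 0"
      unfolding eventually_at by fastforce
    have "(f has_field_derivative deriv f p) (at p)"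
      using holomorphic_derivI[OF assms(1)] by blast
    then have "((\<lambda>u. f u / (u - p)) \<longlongrightarrow> deriv f p) (at p)"
      using D(3) unfolding has_field_derivative_iff by simp
    moreover have "(g \<longlongrightarrow> 0) (at p)" using cont(2)[of p] D(4) unfolding isCont_def by simp
    \<comment> \<open>The simple zero of \<open>s\<close> uses up only the zero of \<open>f\<close>;
      the zero of \<open>g\<close> is left over and makes the limit 0.\<close>
    ultimately have "((\<lambda>u. f u / (u - p) * g u / (s u / (u - p))) \<longlongrightarrow> deriv f p * 0 / D) (at p)"
      using D(1) ls by (intro tendsto_intros)
    moreover have "eventually (\<lambda>u. f u / (u - p) * g u / (s u / (u - p)) = h u) (at p)"
      unfolding eventually_at h_def by (rule exI[of _ 1]) auto
    ultimately have "(h \<longlongrightarrow> deriv f p * 0 / D) (at p)"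
      using Lim_transform_eventually by blast
    then have "(h \<longlongrightarrow> h p) (at p)"
      using True by (simp add: h_def)
    then have "(h \<longlongrightarrow> h w) (at w within ball p e)" if "w \<in> {p}" for w
      using that Lim_at_imp_Lim_at_within by auto
    moreover have "h holomorphic_on ball p e - {p}"
      unfolding h_def
    proof (intro holomorphic_intros)
      show "s u \<noteq> 0" if "u \<in> ball p e - {p}" for u
        using that e(2) by (simp add: dist_commute)
    qed (use assms(1-3) holomorphic_on_subset in blast)+
    ultimately have "h holomorphic_on ball p e"
      by (rule no_isolated_singularity'[of "{p}"]) simp_all
    then show ?thesis using e(1) analytic_at centre_in_ball open_ball by metis
  qed
  then have "h analytic_on UNIV" using analytic_on_analytic_at by blast
  then show ?thesis unfolding h_def by (rule analytic_imp_holomorphic)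
qed

section \<open>The components of the vector \<open>\<Phi>\<close>\<close>

text \<open>Majorant for the theta series. The integers are split into two copies of the naturals,
  the negative ones being listed as \<open>- int n - 1\<close>.\<close>

lemma summable_on_exp_minus_abs_int: "(\<lambda>m::int. exp (- \<bar>real_of_int m\<bar>)) summable_on UNIV"
proof -
  have s: "(\<lambda>n::nat. exp (- real n)) summable_on UNIV"
  proof (rule norm_summable_imp_summable_on)
    have "summable (\<lambda>n. exp (- 1 :: real) ^ n)" by (intro summable_geometric) simp
    then show "summable (\<lambda>n. norm (exp (- real n)))"
      by (simp add: exp_of_nat_mult[symmetric])
  qed
  have "(\<lambda>m::int. exp (- \<bar>real_of_int m\<bar>)) summable_on range int"
    using s by (subst summable_on_reindex) (auto simp: o_def)
  moreover have "(\<lambda>m::int. exp (- \<bar>real_of_int m\<bar>)) summable_on ((\<lambda>n. - int n - 1) ` UNIV)"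
  proof (subst summable_on_reindex)
    show "inj (\<lambda>n. - int n - 1)" by (auto simp: inj_on_def)
    have "(\<lambda>n::nat. exp (- 1) * exp (- real n)) summable_on UNIV"
      using s by (intro summable_on_cmult_right)
    then show "((\<lambda>m::int. exp (- \<bar>real_of_int m\<bar>)) \<circ> (\<lambda>n. - int n - 1)) summable_on UNIV"
      by (simp add: o_def exp_add[symmetric] algebra_simps)
  qed
  moreover have "range int \<inter> range (\<lambda>n. - int n - 1) = {}" by auto
  moreover have "range int \<union> range (\<lambda>n. - int n - 1) = UNIV"
  proof -
    have "m \<in> range int \<union> range (\<lambda>n. - int n - 1)" for m
    proof (cases "m \<ge> 0")
      case True
      then have "m = int (nat m)" by simp
      then show ?thesis by blast
    next
      case False
      then have "m = - int (nat (- m - 1)) - 1" by simp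
      then show ?thesis by blast
    qed
    then show ?thesis by blast
  qed
  ultimately show ?thesis using summable_on_Un_disjoint by metis
qed

text \<open>The summand \<open>u + 0\<close> records that the second characteristic is 0, which
  keeps the term in the shape of \<open>theta_char_def\<close>. A real \<kappa> lets the modulus be
  read off from the exponent.\<close>

definition theta_term :: "real \<Rightarrow> complex \<Rightarrow> int \<Rightarrow> complex \<Rightarrow> complex" where
  "theta_term \<kappa> \<tau> m u = exp (\<i> * pi * (of_int m + \<kappa>) * ((of_int m + \<kappa>) * \<tau> + 2 * (u + 0)))"

lemma theta_char_eq: "theta_char (of_real \<kappa>) 0 u \<tau> = (\<Sum>\<^sub>\<infinity>m. theta_term \<kappa> \<tau> m u)"
  by (simp add: theta_char_def theta_term_def)

text \<open>With \<open>y = m + \<kappa>\<close> the modulus is a Gaussian in \<open>y\<close> times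
  an exponential that is linear in \<open>y\<close>, and completing the square bounds it. The extra
  1 in \<open>b\<close> leaves a factor \<open>exp (- \<bar>y\<bar>)\<close>, and
  \<open>\<bar>\<kappa>\<bar>\<close> in \<open>K\<close> pays for replacing \<open>y\<close> by
  \<open>m\<close>.\<close>

lemma theta_term_bound:
  assumes "Im \<tau> > 0"
  obtains K where "K \<ge> 0" "\<And>m u. norm u \<le> R \<Longrightarrow> norm (theta_term \<kappa> \<tau> m u) \<le> K * exp (- \<bar>real_of_int m\<bar>)"
proof -
  define a where "a = pi * Im \<tau>"
  define b where "b = 2 * pi * R + 1"
  have a: "a > 0" using assms by (simp add: a_def)
  define K where "K = exp (b ^ 2 / (4 * a) + \<bar>\<kappa>\<bar>)"
  have "norm (theta_term \<kappa> \<tau> m u) \<le> K * exp (- \<bar>real_of_int m\<bar>)" if u: "norm u \<le> R" for m u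
  proof -
    define y where "y = real_of_int m + \<kappa>"
    have "norm (theta_term \<kappa> \<tau> m u) = exp (- a * y ^ 2 - 2 * pi * y * Im u)"
    proof -
      have e: "of_int m + complex_of_real \<kappa> = of_real y" by (simp add: y_def)
      show ?thesis
        unfolding theta_term_def e by (simp add: a_def power2_eq_square algebra_simps)
    qed
    also have "- a * y ^ 2 - 2 * pi * y * Im u \<le> b ^ 2 / (4 * a) + \<bar>\<kappa>\<bar> - \<bar>real_of_int m\<bar>"
    proof -
      have "- (y * Im u) \<le> \<bar>y\<bar> * R"
      proof -
        have "- (y * Im u) \<le> \<bar>y * Im u\<bar>" by simp
        also have "\<dots> \<le> \<bar>y\<bar> * R"
          unfolding abs_mult using abs_Im_le_cmod[of u] u by (intro mult_left_mono) auto
        finally show ?thesis .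
      qed
      then have "2 * pi * (- (y * Im u)) \<le> 2 * pi * (\<bar>y\<bar> * R)" by (intro mult_left_mono) auto
      then have "- 2 * pi * y * Im u \<le> (b - 1) * \<bar>y\<bar>" by (simp add: b_def algebra_simps)
      moreover have "- a * y ^ 2 + b * \<bar>y\<bar> \<le> b ^ 2 / (4 * a)"
      proof -
        have "0 \<le> (2 * a * \<bar>y\<bar> - b) ^ 2" by simp
        then have "4 * a * (- a * y ^ 2 + b * \<bar>y\<bar>) \<le> b ^ 2"
          by (simp add: power2_eq_square algebra_simps)
        then show ?thesis using a by (simp add: field_simps)
      qed
      moreover have "\<bar>real_of_int m\<bar> \<le> \<bar>y\<bar> + \<bar>\<kappa>\<bar>" by (simp add: y_def)
      ultimately show ?thesis by (simp add: algebra_simps)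
    qed
    finally show ?thesis by (simp add: K_def exp_add[symmetric] exp_diff exp_minus field_simps)
  qed
  then show thesis using that[of K] by (simp add: K_def)
qed

lemma theta_term_abs_summable:
  assumes "Im \<tau> > 0"
  shows "(\<lambda>m. norm (theta_term \<kappa> \<tau> m u)) summable_on UNIV"
proof -
  obtain K where K: "K \<ge> 0" "\<And>m v. norm v \<le> norm u \<Longrightarrow> norm (theta_term \<kappa> \<tau> m v) \<le> K * exp (- \<bar>real_of_int m\<bar>)"
    using theta_term_bound[OF assms] by blast
  have "(\<lambda>m::int. K * exp (- \<bar>real_of_int m\<bar>)) summable_on UNIV"
    by (intro summable_on_cmult_right summable_on_exp_minus_abs_int)
  then show ?thesis
    by (rule summable_on_comparison_test) (use K in auto)
qed

lemma holomorphic_theta_char: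
  assumes "Im \<tau> > 0"
  shows "(\<lambda>u. theta_char (of_real \<kappa>) 0 u \<tau>) holomorphic_on UNIV"
proof -
  have "(\<lambda>u. theta_char (of_real \<kappa>) 0 u \<tau>) holomorphic_on ball 0 R" if "R > 0" for R
  proof -
    obtain K where K: "\<And>m u. norm u \<le> R \<Longrightarrow> norm (theta_term \<kappa> \<tau> m u) \<le> K * exp (- \<bar>real_of_int m\<bar>)"
      using theta_term_bound[OF assms] by blast
    have lim: "uniform_limit (cball 0 R) (\<lambda>X u. \<Sum>m\<in>X. theta_term \<kappa> \<tau> m u)
        (\<lambda>u. theta_char (of_real \<kappa>) 0 u \<tau>) (finite_subsets_at_top UNIV)"
      unfolding theta_char_eq
    proof (rule Weierstrass_m_test_general)
      show "(\<lambda>m::int. K * exp (- \<bar>real_of_int m\<bar>)) summable_on UNIV"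
        by (intro summable_on_cmult_right summable_on_exp_minus_abs_int)
    qed (use K in auto)
    have "theta_term \<kappa> \<tau> m holomorphic_on S" for m S
      unfolding theta_term_def[abs_def] by (intro holomorphic_intros)
    moreover from this have "continuous_on S (theta_term \<kappa> \<tau> m)" for m S
      using holomorphic_on_imp_continuous_on by blast
    ultimately have "eventually (\<lambda>X. continuous_on (cball 0 R) (\<lambda>u. \<Sum>m\<in>X. theta_term \<kappa> \<tau> m u) \<and>
        (\<lambda>u. \<Sum>m\<in>X. theta_term \<kappa> \<tau> m u) holomorphic_on ball 0 R) (finite_subsets_at_top UNIV)"
      by (intro always_eventually allI conjI continuous_on_sum holomorphic_on_sum)
    from holomorphic_uniform_limit[OF this lim] show ?thesis by simp
  qed
  then have "(\<lambda>u. theta_char (of_real \<kappa>) 0 u \<tau>) analytic_on ball 0 R" if "R > 0" for R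
    using that by (simp add: analytic_on_open)
  then have "(\<lambda>u. theta_char (of_real \<kappa>) 0 u \<tau>) analytic_on {w}" for w
    by (rule analytic_on_subset[of _ "ball 0 (norm w + 1)"]) (simp_all add: add_nonneg_pos)
  then have "(\<lambda>u. theta_char (of_real \<kappa>) 0 u \<tau>) analytic_on UNIV"
    using analytic_on_analytic_at by blast
  then show ?thesis by (rule analytic_imp_holomorphic)
qed

text \<open>A geometric sum whose ratio is 1 exactly when \<open>N\<close> divides \<open>m\<close>.
  It extracts Fourier coefficients here and separates the components of \<Phi> later.\<close>

lemma sum_roots_of_unity:
  fixes N :: nat and m :: int
  assumes "N > 0"
  shows "(\<Sum>k<N. exp (2 * \<i> * pi * of_int m * of_nat k / of_nat N)) = (if int N dvd m then of_nat N else 0)"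
proof -
  define x where "x = exp (2 * \<i> * pi * of_int m / of_nat N)"
  have x: "exp (2 * \<i> * pi * of_int m * of_nat k / of_nat N) = x ^ k" for k
    by (simp add: x_def exp_of_nat_mult[symmetric] field_simps)
  have one: "x = 1 \<longleftrightarrow> int N dvd m"
  proof
    assume "x = 1"
    then obtain k :: int where "2 * pi * m / N = of_int (2 * k) * pi"
      unfolding x_def exp_eq_1 by auto
    then have "real_of_int m = real_of_int (int N * k)"
      using assms by (simp add: field_simps)
    then show "int N dvd m" by (simp only: of_int_eq_iff dvd_triv_left)
  next
    assume "int N dvd m"
    then obtain k where "m = int N * k" by blast
    then have "2 * \<i> * pi * of_int m / of_nat N = 2 * \<i> * pi * of_int k"
      using assms by simp
    then show "x = 1" unfolding x_def exp_eq_1 by auto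
  qed
  have "x ^ N = exp (2 * \<i> * pi * of_int m)"
    using assms by (simp add: x_def exp_of_nat_mult[symmetric])
  also have "\<dots> = 1" unfolding exp_eq_1 by auto
  finally have "x ^ N = 1" .
  then show ?thesis
    unfolding x using one by (auto simp: geometric_sum)
qed

text \<open>Averaging over the \<open>N\<close>-th roots of unity leaves the coefficients with index divisible by \<open>N\<close>;
  let \<open>N\<close> tend to infinity.\<close>

lemma fourier_coefficient_0_eq_0:
  fixes a :: "int \<Rightarrow> complex"
  assumes abs: "(\<lambda>m. norm (a m)) summable_on UNIV"
    and zero: "\<And>u::real. (\<Sum>\<^sub>\<infinity>m. a m * exp (2 * \<i> * pi * of_int m * of_real u)) = 0"
  shows "a 0 = 0"
proof -
  have "norm (a 0) \<le> e" if e: "e > 0" for e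
  proof -
    have "((\<lambda>m. norm (a m)) has_sum (\<Sum>\<^sub>\<infinity>m. norm (a m))) UNIV"
      using abs by simp
    then obtain F where F: "finite F" "dist (\<Sum>m\<in>F. norm (a m)) (\<Sum>\<^sub>\<infinity>m. norm (a m)) \<le> e"
      using has_sum_finite_approximation[OF _ e] by blast
    \<comment> \<open>\<open>N\<close> exceeds \<open>\<bar>m\<bar>\<close> for every
      \<open>m\<close> in \<open>F\<close>, so no nonzero element of \<open>F\<close> is a multiple
      of \<open>N\<close>.\<close>
    define N where "N = Suc (\<Sum>m\<in>F. nat \<bar>m\<bar>)"
    have N: "\<not> int N dvd m" if "m \<in> F" "m \<noteq> 0" for m
    proof
      assume "int N dvd m"
      then have "int N \<le> \<bar>m\<bar>" using that(2) zdvd_imp_le[of "int N" "\<bar>m\<bar>"] by simp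
      moreover have "nat \<bar>m\<bar> \<le> (\<Sum>m\<in>F. nat \<bar>m\<bar>)"
        using F(1) that(1) by (intro member_le_sum) auto
      ultimately show False unfolding N_def by linarith
    qed
    define b where "b m = (if int N dvd m then a m else 0)" for m
    have babs: "(\<lambda>m. norm (b m)) summable_on UNIV"
      by (rule Infinite_Sum.abs_summable_on_comparison_test[OF abs]) (simp add: b_def)
    have "(b has_sum 0) UNIV"
    proof -
      have s: "((\<lambda>m. a m * exp (2 * \<i> * pi * of_int m * of_real u)) has_sum 0) UNIV" for u :: real
      proof -
        have "(\<lambda>m. norm (a m * exp (2 * \<i> * pi * of_int m * of_real u))) summable_on UNIV"
          using abs by (simp add: norm_mult)
        then show ?thesis using zero[of u] abs_summable_summable has_sum_infsum by metis
      qed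
      have sums: "((\<lambda>m. \<Sum>k\<in>K. f k m) has_sum (\<Sum>k\<in>K. 0)) UNIV"
        if "finite K" "\<And>k. k \<in> K \<Longrightarrow> (f k has_sum 0) UNIV" for K :: "nat set" and f :: "nat \<Rightarrow> int \<Rightarrow> complex"
        using that by (induction K rule: finite_induct) (auto intro!: has_sum_add[where a = 0 and b = 0, simplified])
      have "((\<lambda>m. \<Sum>k<N. a m * exp (2 * \<i> * pi * of_int m * of_real (real k / real N))) has_sum (\<Sum>k<N. 0)) UNIV"
        by (intro sums s) auto
      moreover have "(\<Sum>k<N. a m * exp (2 * \<i> * pi * of_int m * of_real (real k / real N))) = of_nat N * b m" for m
        using sum_roots_of_unity[of N m]
        by (simp add: sum_distrib_left[symmetric] b_def N_def del: of_nat_Suc sum.lessThan_Suc)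
      ultimately have "((\<lambda>m. of_nat N * b m) has_sum 0) UNIV" by simp
      then have "((\<lambda>m. 1 / of_nat N * (of_nat N * b m)) has_sum 1 / of_nat N * 0) UNIV"
        by (rule has_sum_cmult_right)
      then show ?thesis by (simp add: N_def del: of_nat_Suc)
    qed
    then have "(b has_sum (0 - (\<Sum>m\<in>insert 0 F. b m))) (UNIV - insert 0 F)"
      using F(1) by (intro has_sum_Diff has_sum_finite) auto
    moreover have "(\<Sum>m\<in>insert 0 F. b m) = a 0"
    proof -
      have "(\<Sum>m\<in>insert 0 F. b m) = (\<Sum>m\<in>{0}. b m)"
        using F(1) N by (intro sum.mono_neutral_right) (auto simp: b_def)
      then show ?thesis by (simp add: b_def)
    qed
    ultimately have "(b has_sum (- a 0)) (UNIV - insert 0 F)" by simp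
    moreover have "((\<lambda>m. norm (a m)) has_sum ((\<Sum>\<^sub>\<infinity>m. norm (a m)) - (\<Sum>m\<in>insert 0 F. norm (a m)))) (UNIV - insert 0 F)"
      using F(1) abs by (intro has_sum_Diff has_sum_finite has_sum_infsum) auto
    \<comment> \<open>As the whole sum of \<open>b\<close> is 0, the tail outside
      \<open>insert 0 F\<close> equals \<open>- a 0\<close>; it is dominated by the tail of
      \<open>norm (a m)\<close>, which is at most \<open>e\<close> by the choice of
      \<open>F\<close>.\<close>
    ultimately have "norm (- a 0) \<le> (\<Sum>\<^sub>\<infinity>m. norm (a m)) - (\<Sum>m\<in>insert 0 F. norm (a m))"
      by (rule norm_infsum_le) (simp add: b_def)
    also have "\<dots> \<le> (\<Sum>\<^sub>\<infinity>m. norm (a m)) - (\<Sum>m\<in>F. norm (a m))"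
      using F(1) by (intro diff_left_mono sum_mono2) auto
    also have "\<dots> \<le> e" using F(2) by (simp add: dist_real_def)
    finally show ?thesis by simp
  qed
  then have "norm (a 0) \<le> 0" by (rule field_le_epsilon[of _ 0, simplified])
  then show ?thesis by simp
qed

text \<open>Up to an exponential factor the theta series is a Fourier series on the real line, and
  its coefficient of index 0 is an exponential, hence not 0.\<close>

lemma theta_char_not_identically_0:
  assumes "Im \<tau> > 0"
  obtains u where "theta_char (of_real \<kappa>) 0 u \<tau> \<noteq> 0"
proof (rule ccontr)
  assume "\<not> thesis"
  then have z: "theta_char (of_real \<kappa>) 0 u \<tau> = 0" for u using that by blast
  define a where "a m = theta_term \<kappa> \<tau> m 0" for m
  have t: "theta_term \<kappa> \<tau> m u = exp (2 * \<i> * pi * \<kappa> * u) * (a m * exp (2 * \<i> * pi * of_int m * u))" for m u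
    unfolding a_def theta_term_def exp_add[symmetric] by (simp add: algebra_simps)
  have "a 0 = 0"
  proof (rule fourier_coefficient_0_eq_0)
    show "(\<lambda>m. norm (a m)) summable_on UNIV" unfolding a_def by (rule theta_term_abs_summable[OF assms])
    show "(\<Sum>\<^sub>\<infinity>m. a m * exp (2 * \<i> * pi * of_int m * of_real u)) = 0" for u :: real
      using z[of "of_real u"] unfolding theta_char_eq t infsum_cmult_right' by simp
  qed
  then show False by (simp add: a_def theta_term_def)
qed

text \<open>Entire functions form an integral domain: where a nonzero factor does not vanish, the
  product of the others does, and this set is open and nonempty.\<close>

lemma entire_prod_eq_0:
  fixes f :: "'a \<Rightarrow> complex \<Rightarrow> complex"
  assumes "finite A" "\<And>r. r \<in> A \<Longrightarrow> f r holomorphic_on UNIV" "\<And>u. (\<Prod>r\<in>A. f r u) = 0"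
  shows "\<exists>r\<in>A. \<forall>u. f r u = 0"
  using assms
proof (induction A rule: finite_induct)
  case (insert a A)
  show ?case
  proof (cases "\<forall>u. f a u = 0")
    case False
    have "(\<Prod>r\<in>A. f r u) = 0" for u
    proof (rule analytic_continuation_open[of "{u. f a u \<noteq> 0}" UNIV "\<lambda>u. \<Prod>r\<in>A. f r u" "\<lambda>_. 0"])
      show "open {u. f a u \<noteq> 0}"
        using insert.prems(1)[of a] holomorphic_on_imp_continuous_on
        by (intro open_Collect_neq) auto
      show "{u. f a u \<noteq> 0} \<noteq> {}" using False by blast
      show "(\<lambda>u. \<Prod>r\<in>A. f r u) holomorphic_on UNIV"
        using insert.prems(1) by (intro holomorphic_on_prod) auto
      show "(\<Prod>r\<in>A. f r v) = 0" if "v \<in> {u. f a u \<noteq> 0}" for v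
        using that insert.prems(2)[of v] insert.hyps by simp
    qed auto
    then show ?thesis using insert.IH insert.prems(1) by blast
  qed blast
qed simp

text \<open>\<open>theta_comp n \<tau> r\<close> is the component of \<open>\<Phi>\<close> with index \<open>r + 1\<close> modulo \<open>n\<close>.\<close>

definition theta_comp :: "nat \<Rightarrow> complex \<Rightarrow> int \<Rightarrow> complex \<Rightarrow> complex" where
  "theta_comp n \<tau> r u = theta_char (of_real (of_int r / of_nat n)) 0 u (of_nat n * \<tau>)"

section \<open>Quasi-periodicity, zeros and independence of the components\<close>

context
  fixes n :: nat and \<tau> :: complex
  assumes n: "n > 0" and tau: "Im \<tau> > 0"
begin

text \<open>The series runs over the residue class of \<open>r\<close> modulo \<open>n\<close>; in
  this form the transformation rules in \<open>r\<close> and in \<open>u\<close> can be read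
  off.\<close>

lemma theta_comp_series:
  "theta_comp n \<tau> r u =
    (\<Sum>\<^sub>\<infinity>m. exp (\<i> * pi * of_int (int n * m + r) * (of_int (int n * m + r) * \<tau> + 2 * u) / of_nat n))"
proof -
  have "theta_term (of_int r / of_nat n) (of_nat n * \<tau>) m u =
      exp (\<i> * pi * of_int (int n * m + r) * (of_int (int n * m + r) * \<tau> + 2 * u) / of_nat n)" for m
    using n unfolding theta_term_def by (intro arg_cong[of _ _ exp]) (simp add: field_simps)
  then show ?thesis unfolding theta_comp_def theta_char_eq by simp
qed

lemma holomorphic_theta_comp: "theta_comp n \<tau> r holomorphic_on UNIV"
  unfolding theta_comp_def[abs_def] using n tau by (intro holomorphic_theta_char) simp

lemma theta_comp_not_identically_0: obtains u where "theta_comp n \<tau> r u \<noteq> 0"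
  unfolding theta_comp_def
  using theta_char_not_identically_0[of "of_nat n * \<tau>" "of_int r / of_nat n"] n tau by auto

lemma theta_comp_add_n: "theta_comp n \<tau> (r + int n) u = theta_comp n \<tau> r u"
  unfolding theta_comp_series
  by (rule infsum_reindex_bij_witness[of _ "\<lambda>m. m - 1" "\<lambda>m. m + 1"]) (auto simp: algebra_simps)

lemma theta_comp_add_1:
  "theta_comp n \<tau> r (u + 1) = exp (2 * \<i> * pi * of_int r / of_nat n) * theta_comp n \<tau> r u"
proof -
  have "exp (\<i> * pi * of_int (int n * m + r) * (of_int (int n * m + r) * \<tau> + 2 * (u + 1)) / of_nat n) =
     exp (2 * \<i> * pi * of_int r / of_nat n) *
     exp (\<i> * pi * of_int (int n * m + r) * (of_int (int n * m + r) * \<tau> + 2 * u) / of_nat n)" (is "?l = ?r") for m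
  proof -
    have "?l = exp (2 * \<i> * pi * of_int m) * ?r"
      unfolding exp_add[symmetric] using n by (intro arg_cong[of _ _ exp]) (simp add: field_simps)
    moreover have "exp (2 * \<i> * pi * of_int m) = 1" unfolding exp_eq_1 by auto
    ultimately show ?thesis by simp
  qed
  then show ?thesis unfolding theta_comp_series by (simp add: infsum_cmult_right')
qed

text \<open>For \<open>k = n * m + r\<close> one has \<open>k * (k * \<tau> + 2 * (u + \<tau>)) = (k
  + 1) * ((k + 1) * \<tau> + 2 * u) - \<tau> - 2 * u\<close>, so the translation moves to the next
  residue class.\<close>

lemma theta_comp_add_tau:
  "theta_comp n \<tau> r (u + \<tau>) = exp (- \<i> * pi * (\<tau> + 2 * u) / of_nat n) * theta_comp n \<tau> (r + 1) u"
proof -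
  have "exp (\<i> * pi * of_int (int n * m + r) * (of_int (int n * m + r) * \<tau> + 2 * (u + \<tau>)) / of_nat n) =
     exp (- \<i> * pi * (\<tau> + 2 * u) / of_nat n) *
     exp (\<i> * pi * of_int (int n * m + (r + 1)) * (of_int (int n * m + (r + 1)) * \<tau> + 2 * u) / of_nat n)" for m
    unfolding exp_add[symmetric] using n by (intro arg_cong[of _ _ exp]) (simp add: field_simps)
  then show ?thesis unfolding theta_comp_series by (simp add: infsum_cmult_right')
qed

lemma theta_comp_mod: "theta_comp n \<tau> (r mod int n) u = theta_comp n \<tau> r u"
proof -
  have "theta_comp n \<tau> (r + int n * k) u = theta_comp n \<tau> r u" for r k
  proof (induction k rule: int_induct[where k = 0])
    case (step1 i)
    have "theta_comp n \<tau> (r + int n * (i + 1)) u = theta_comp n \<tau> (r + int n * i + int n) u"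
      by (simp add: algebra_simps)
    then show ?case using step1(2) theta_comp_add_n by metis
  next
    case (step2 i)
    have "theta_comp n \<tau> (r + int n * i) u = theta_comp n \<tau> (r + int n * (i - 1) + int n) u"
      by (simp add: algebra_simps)
    then show ?case using step2(2) theta_comp_add_n by metis
  qed simp
  from this[of "r mod int n" "r div int n"] show ?thesis by simp
qed

text \<open>A translation by 1 multiplies each component by a nonzero scalar and one by \<tau> also
  permutes them, so the property that survives is vanishing of all of them together.\<close>

lemma theta_comp_common_zero_lattice:
  assumes "\<And>r. theta_comp n \<tau> r u0 = 0" and "p \<in> lattice \<tau>"
  shows "theta_comp n \<tau> r (u0 + p) = 0"
  using assms(2)
proof (induction arbitrary: r rule: lattice_induct)
  case 0
  then show ?case using assms(1) by simp
next
  case (add_1 p)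
  then show ?case using theta_comp_add_1[of r "u0 + p"] by (simp add: add.assoc)
next
  case (diff_1 p)
  have "u0 + p - 1 + 1 = u0 + p" by simp
  then show ?case using theta_comp_add_1[of r "u0 + p - 1"] diff_1 by (simp add: add_diff_eq)
next
  case (add_tau p)
  then show ?case using theta_comp_add_tau[of r "u0 + p"] by (simp add: add.assoc)
next
  case (diff_tau p)
  have "u0 + p - \<tau> + \<tau> = u0 + p" "r - 1 + 1 = r" by simp_all
  then show ?case using theta_comp_add_tau[of "r - 1" "u0 + p - \<tau>"] diff_tau by (simp add: add_diff_eq)
qed

text \<open>At a common zero the product of all components would vanish to order at least \<open>n \<ge> 2\<close>,
  but it has the quasi-periods of \<open>qtheta\<close>, which has simple zeros.\<close>

lemma theta_comp_no_common_zero: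
  assumes "n \<ge> 2"
  obtains r where "theta_comp n \<tau> r u0 \<noteq> 0"
proof (rule ccontr)
  assume "\<not> thesis"
  then have z0: "theta_comp n \<tau> r u0 = 0" for r using that by blast
  define s where "s u = qtheta \<tau> (u - u0)" for u
  define P where "P u = (\<Prod>r\<in>{..<n}. theta_comp n \<tau> (int r) u)" for u
  \<comment> \<open>One component is split off because the zero of \<open>s\<close> is to be paid
    for by \<open>f\<close> alone; as \<open>n \<ge> 2\<close>, the rest \<open>h\<close> still
    contains the component of index 1.\<close>
  define f where "f u = theta_comp n \<tau> 0 u" for u
  define h where "h u = (\<Prod>r\<in>{1..<n}. theta_comp n \<tau> (int r) u)" for u
  have P: "P u = f u * h u" for u
  proof -
    have "{..<n} = insert 0 {1..<n}" using n by auto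
    then show ?thesis unfolding P_def f_def h_def by simp
  qed
  have s_hol: "s holomorphic_on UNIV"
    unfolding s_def[abs_def]
    using holomorphic_on_compose_gen[of "\<lambda>u. u - u0" UNIV "qtheta \<tau>" UNIV] holomorphic_qtheta[OF tau]
    by (simp add: o_def holomorphic_intros)
  have zero: "theta_comp n \<tau> r p = 0 \<and> (\<exists>D. D \<noteq> 0 \<and> (s has_field_derivative D) (at p))" if "s p = 0" for p r
  proof -
    have l: "p - u0 \<in> lattice \<tau>" using that qtheta_zero_imp_lattice[OF tau] by (simp add: s_def)
    then obtain D where "D \<noteq> 0" "(qtheta \<tau> has_field_derivative D) (at (p + (- u0)))"
      using qtheta_simple_zero[OF tau] by auto
    then have "D \<noteq> 0 \<and> (s has_field_derivative D) (at p)"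
      unfolding DERIV_shift s_def[abs_def] by simp
    then show ?thesis using theta_comp_common_zero_lattice[OF z0 l, of r] by auto
  qed
  have hz: "h p = 0" if "s p = 0" for p
    unfolding h_def using assms zero[OF that, of 1] by (intro prod_zero) (auto intro!: bexI[of _ 1])
  have hol: "(\<lambda>u. f u * h u / s u) holomorphic_on UNIV"
    by (rule holomorphic_divide_simple_zeros)
       (use zero hz in \<open>auto simp: f_def h_def[abs_def] s_hol intro!: holomorphic_on_prod holomorphic_theta_comp\<close>)
  have P1: "P (u + 1) = (\<Prod>r\<in>{..<n}. exp (2 * \<i> * pi * of_int (int r) / of_nat n)) * P u" for u
    unfolding P_def theta_comp_add_1 prod.distrib by simp
  have P2: "P (u + \<tau>) = exp (- \<i> * pi * (\<tau> + 2 * u)) * P u" for u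
  proof -
    have "P (u + \<tau>) = (exp (- \<i> * pi * (\<tau> + 2 * u) / of_nat n)) ^ n * (\<Prod>r<n. theta_comp n \<tau> (int (Suc r)) u)"
      unfolding P_def theta_comp_add_tau prod.distrib by (simp add: add.commute)
    also have "(exp (- \<i> * pi * (\<tau> + 2 * u) / of_nat n)) ^ n = exp (- \<i> * pi * (\<tau> + 2 * u))"
      using n by (simp add: exp_of_nat_mult[symmetric])
    \<comment> \<open>The translation rotates the residues cyclically, and the index
      \<open>n\<close> that appears at the end is the index 0 that was lost.\<close>
    also have "(\<Prod>r<n. theta_comp n \<tau> (int (Suc r)) u) = P u"
    proof -
      obtain m where m: "n = Suc m" using n gr0_implies_Suc by blast
      have "theta_comp n \<tau> (int n) u = theta_comp n \<tau> 0 u" using theta_comp_add_n[of 0 u] by simp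
      then show ?thesis
        unfolding P_def m prod.lessThan_Suc_shift[of _ m] prod.lessThan_Suc[of "\<lambda>r. theta_comp _ \<tau> (int (Suc r)) u"]
        by (simp add: m mult.commute)
    qed
    finally show ?thesis .
  qed
  have "f u * h u / s u = 0" for u
  proof (rule entire_constant_multipliers_eq_0[OF tau hol])
    show "(\<Prod>r\<in>{..<n}. exp (2 * \<i> * pi * of_int (int r) / of_nat n)) \<noteq> 0" by simp
    show "f (u + 1) * h (u + 1) / s (u + 1) =
        (\<Prod>r\<in>{..<n}. exp (2 * \<i> * pi * of_int (int r) / of_nat n)) * (f u * h u / s u)" for u
    proof -
      have "s (u + 1) = s u" unfolding s_def using qtheta_add_1[of \<tau> "u - u0"] by (simp add: algebra_simps)
      then show ?thesis using P1[of u] unfolding P by simp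
    qed
    \<comment> \<open>The multipliers of \<open>P\<close> and of \<open>s\<close> depend on
      \<open>u\<close> through the same exponential, which cancels in the quotient and leaves this
      constant.\<close>
    show "- exp (- \<i> * pi * (\<tau> + 2 * u0)) \<noteq> 0" by simp
    show "f (u + \<tau>) * h (u + \<tau>) / s (u + \<tau>) = - exp (- \<i> * pi * (\<tau> + 2 * u0)) * (f u * h u / s u)" for u
    proof -
      have "s (u + \<tau>) = - exp (- 2 * \<i> * pi * (u - u0)) * s u"
        unfolding s_def using qtheta_add_tau[OF tau, of "u - u0"] by (simp add: algebra_simps)
      moreover have "exp (- \<i> * pi * (\<tau> + 2 * u)) =
          exp (- \<i> * pi * (\<tau> + 2 * u0)) * exp (- 2 * \<i> * pi * (u - u0))"
        unfolding exp_add[symmetric] by (simp add: algebra_simps)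
      ultimately show ?thesis using P2[of u] unfolding P by simp
    qed
    show "f u0 * h u0 / s u0 = 0" using z0 by (simp add: f_def)
  qed
  then have *: "P u = 0 \<or> s u = 0" for u unfolding P by simp
  have "P u = 0" for u
  proof (cases "s u = 0")
    case True
    then show ?thesis using hz by (simp add: P)
  next
    case False
    then show ?thesis using * by blast
  qed
  then obtain r where "\<And>u. theta_comp n \<tau> (int r) u = 0"
    using entire_prod_eq_0[of "{..<n}" "\<lambda>r. theta_comp n \<tau> (int r)"] holomorphic_theta_comp
    unfolding P_def by blast
  then show False using theta_comp_not_identically_0 by metis
qed

text \<open>The ratio \<open>c(u)\<close> of \<open>\<Phi>(u + d)\<close> and \<open>\<Phi>(u)\<close> is entire, has constant multipliers
  \<open>1\<close> and \<open>exp(-2\<pi>id/n)\<close>, and so is an exponential.\<close>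

lemma theta_comp_proportional_imp_lattice:
  assumes n2: "n \<ge> 2"
    and ratio: "\<And>r r' u. theta_comp n \<tau> r (u + d) * theta_comp n \<tau> r' u =
      theta_comp n \<tau> r' (u + d) * theta_comp n \<tau> r u"
  shows "d / of_nat n \<in> lattice \<tau>"
proof -
  have "\<exists>r. theta_comp n \<tau> r u \<noteq> 0" for u
    using theta_comp_no_common_zero[OF n2] by blast
  \<comment> \<open>For each \<open>u\<close> a component that is nonzero at \<open>u\<close>; this
    local \<open>idx\<close> hides the constant of that name. Near a given point the ratio can be
    computed with the index of that point, which makes it holomorphic there.\<close>
  then obtain idx where idx: "\<And>u. theta_comp n \<tau> (idx u) u \<noteq> 0"
    by metis
  define c where "c u = theta_comp n \<tau> (idx u) (u + d) / theta_comp n \<tau> (idx u) u" for u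
  have c: "theta_comp n \<tau> r (u + d) = c u * theta_comp n \<tau> r u" for r u
    using ratio[of r u "idx u"] idx[of u] by (simp add: c_def field_simps)
  have c_eq: "c u = theta_comp n \<tau> r (u + d) / theta_comp n \<tau> r u" if "theta_comp n \<tau> r u \<noteq> 0" for r u
    using c[of r u] that by simp
  have cont: "continuous_on UNIV (theta_comp n \<tau> r)" for r
    using holomorphic_theta_comp holomorphic_on_imp_continuous_on by blast
  have "c analytic_on {u}" for u
  proof -
    let ?U = "{v. theta_comp n \<tau> (idx u) v \<noteq> 0}"
    have "open ?U" using cont by (intro open_Collect_neq) auto
    moreover have "c holomorphic_on ?U"
    proof (rule holomorphic_transform)
      have "(\<lambda>v. theta_comp n \<tau> (idx u) (v + d)) holomorphic_on UNIV"
        using holomorphic_on_compose_gen[of "\<lambda>v. v + d" UNIV, OF _ holomorphic_theta_comp[of "idx u"]]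
        by (simp add: o_def holomorphic_intros)
      then show "(\<lambda>v. theta_comp n \<tau> (idx u) (v + d) / theta_comp n \<tau> (idx u) v) holomorphic_on ?U"
        using holomorphic_theta_comp[of "idx u"] holomorphic_on_subset
        by (intro holomorphic_on_divide) blast+
    qed (simp add: c_eq)
    ultimately show ?thesis using idx[of u] analytic_at by blast
  qed
  then have "c analytic_on UNIV" using analytic_on_analytic_at by blast
  then have hol: "c holomorphic_on UNIV" by (rule analytic_imp_holomorphic)
  have c1: "c (u + 1) = 1 * c u" for u
  proof -
    have "u + 1 + d = (u + d) + 1" by simp
    then have "theta_comp n \<tau> (idx u) (u + 1 + d) = 
      exp (2 * \<i> * pi * of_int (idx u) / of_nat n) * (c u * theta_comp n \<tau> (idx u) u)"
      by (simp only: theta_comp_add_1 c)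
    moreover have "theta_comp n \<tau> (idx u) (u + 1 + d) =
      c (u + 1) * (exp (2 * \<i> * pi * of_int (idx u) / of_nat n) * theta_comp n \<tau> (idx u) u)"
      by (simp only: theta_comp_add_1 c)
    ultimately show ?thesis using idx[of u] by simp
  qed
  have c2: "c (u + \<tau>) = exp (- 2 * \<i> * pi * d / of_nat n) * c u" for u
  proof -
    define r where "r = idx u - 1"
    have r: "theta_comp n \<tau> (r + 1) u \<noteq> 0" using idx[of u] by (simp add: r_def)
    have "u + \<tau> + d = (u + d) + \<tau>" by simp
    then have "theta_comp n \<tau> r (u + \<tau> + d) =
      exp (- \<i> * pi * (\<tau> + 2 * (u + d)) / of_nat n) * (c u * theta_comp n \<tau> (r + 1) u)"
      by (simp only: theta_comp_add_tau c)
    moreover have "theta_comp n \<tau> r (u + \<tau> + d) =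
      c (u + \<tau>) * (exp (- \<i> * pi * (\<tau> + 2 * u) / of_nat n) * theta_comp n \<tau> (r + 1) u)"
      by (simp only: theta_comp_add_tau c)
    moreover have "exp (- \<i> * pi * (\<tau> + 2 * (u + d)) / of_nat n) =
      exp (- \<i> * pi * (\<tau> + 2 * u) / of_nat n) * exp (- 2 * \<i> * pi * d / of_nat n)"
      unfolding exp_add[symmetric] using n by (intro arg_cong[of _ _ exp]) (simp add: field_simps)
    ultimately show ?thesis using r by simp
  qed
  obtain C \<kappa> where C: "\<And>u. c u = C * exp (\<kappa> * u)"
    using entire_constant_multipliers[OF tau hol _ c1 _ c2] by auto
  have "C \<noteq> 0"
  proof
    assume "C = 0"
    then have "theta_comp n \<tau> r (- d + d + d) = 0" for r using c[of r "- d + d"] C by simp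
    then show False using idx[of "- d + d + d"] by blast
  qed
  \<comment> \<open>The multiplier 1 makes \<kappa> an integer multiple of
    \<open>2 * \<i> * pi\<close>; comparing the multipliers along \<tau> then expresses
    \<open>d / n\<close> through 1 and \<tau> with integer coefficients.\<close>
  then have "exp \<kappa> = 1" "exp (\<kappa> * \<tau>) = exp (- 2 * \<i> * pi * d / of_nat n)"
    using c1[of 0] c2[of 0] unfolding C by auto
  then obtain k l :: int where "Re \<kappa> = 0" "Im \<kappa> = of_int (2 * k) * pi"
    and l: "\<kappa> * \<tau> = - 2 * \<i> * pi * d / of_nat n + (of_int (2 * l) * pi) * \<i>"
    unfolding exp_eq_1 exp_eq by blast
  then have k: "\<kappa> = 2 * \<i> * pi * of_int k" by (simp add: complex_eq_iff)
  have "2 * \<i> * pi * (of_int k * \<tau>) = 2 * \<i> * pi * (- d / of_nat n + of_int l)"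
    using l unfolding k by (simp add: algebra_simps)
  then have "of_int k * \<tau> = - d / of_nat n + of_int l" by simp
  then have "d / of_nat n = of_int l + of_int (- k) * \<tau>" by (simp add: algebra_simps)
  then show ?thesis unfolding lattice_def by blast
qed

text \<open>The components are eigenvectors of the translation by 1 for the distinct
  \<open>n\<close>-th roots of unity. Averaging over the translates \<open>u + k\<close> with the
  conjugate root projects onto the component \<open>s\<close>.\<close>

lemma theta_comp_linear_independent:
  assumes "\<And>u. (\<Sum>r<n. c r * theta_comp n \<tau> (int r) u) = 0" and "s < n"
  shows "c s = 0"
proof -
  obtain u where u: "theta_comp n \<tau> (int s) u \<noteq> 0" using theta_comp_not_identically_0 by blast
  have shift: "theta_comp n \<tau> r (u + of_nat k) =
    exp (2 * \<i> * pi * of_int r * of_nat k / of_nat n) * theta_comp n \<tau> r u" for r k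
  proof (induction k)
    case (Suc k)
    have "u + of_nat (Suc k) = (u + of_nat k) + 1" by simp
    then have "theta_comp n \<tau> r (u + of_nat (Suc k)) = exp (2 * \<i> * pi * of_int r / of_nat n) *
      (exp (2 * \<i> * pi * of_int r * of_nat k / of_nat n) * theta_comp n \<tau> r u)"
      by (simp only: theta_comp_add_1 Suc)
    also have "\<dots> = exp (2 * \<i> * pi * of_int r * of_nat (Suc k) / of_nat n) * theta_comp n \<tau> r u"
      unfolding mult.assoc[symmetric] exp_add[symmetric] by (simp add: algebra_simps add_divide_distrib)
    finally show ?case .
  qed simp
  have "0 = (\<Sum>k<n. exp (- (2 * \<i> * pi * of_int (int s) * of_nat k / of_nat n)) *
      (\<Sum>r<n. c r * theta_comp n \<tau> (int r) (u + of_nat k)))"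
    using assms(1) by simp
  also have "\<dots> = (\<Sum>k<n. \<Sum>r<n. c r * theta_comp n \<tau> (int r) u *
      exp (2 * \<i> * pi * of_int (int r - int s) * of_nat k / of_nat n))"
  proof (intro sum.cong refl)
    fix k
    have "exp (- (2 * \<i> * pi * of_int (int s) * of_nat k / of_nat n)) *
        exp (2 * \<i> * pi * of_int (int r) * of_nat k / of_nat n) =
        exp (2 * \<i> * pi * of_int (int r - int s) * of_nat k / of_nat n)" for r
      unfolding exp_add[symmetric] using n by (intro arg_cong[of _ _ exp]) (simp add: field_simps)
    then show "exp (- (2 * \<i> * pi * of_int (int s) * of_nat k / of_nat n)) *
        (\<Sum>r<n. c r * theta_comp n \<tau> (int r) (u + of_nat k)) =
      (\<Sum>r<n. c r * theta_comp n \<tau> (int r) u *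
        exp (2 * \<i> * pi * of_int (int r - int s) * of_nat k / of_nat n))"
      unfolding shift sum_distrib_left by (intro sum.cong refl) (simp add: mult_ac)
  qed
  also have "\<dots> = (\<Sum>r<n. c r * theta_comp n \<tau> (int r) u *
      (\<Sum>k<n. exp (2 * \<i> * pi * of_int (int r - int s) * of_nat k / of_nat n)))"
    by (subst sum.swap) (simp add: sum_distrib_left)
  also have "\<dots> = (\<Sum>r<n. if r = s then c r * theta_comp n \<tau> (int r) u * of_nat n else 0)"
  proof (intro sum.cong refl)
    fix r assume "r \<in> {..<n}"
    then have "int n dvd int r - int s \<longleftrightarrow> r = s"
      using assms(2) zdvd_imp_le[of "int n" "int r - int s"] zdvd_imp_le[of "int n" "int s - int r"]
      by (cases r s rule: linorder_cases) (auto simp: dvd_diff_commute)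
    then show "c r * theta_comp n \<tau> (int r) u *
        (\<Sum>k<n. exp (2 * \<i> * pi * of_int (int r - int s) * of_nat k / of_nat n)) =
      (if r = s then c r * theta_comp n \<tau> (int r) u * of_nat n else 0)"
      unfolding sum_roots_of_unity[OF n] by simp
  qed
  also have "\<dots> = c s * theta_comp n \<tau> (int s) u * of_nat n" using assms(2) by simp
  finally show ?thesis using u n by simp
qed

end

section \<open>Generic points\<close>

lemma closure_open_meets:
  assumes "x \<in> closure S" "open T" "x \<in> T"
  obtains y where "y \<in> S" "y \<in> T"
  using assms unfolding closure_iff_nhds_not_empty by blast

lemma generically_iff_open:
  "generically E P \<longleftrightarrow> (\<exists>W. open W \<and> E \<subseteq> closure (E \<inter> W) \<and> (\<forall>x\<in>E \<inter> W. P x))"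
  unfolding generically_def openin_open by blast

lemma generically_mono:
  assumes "generically E P" "\<And>x. x \<in> E \<Longrightarrow> P x \<Longrightarrow> Q x"
  shows "generically E Q"
  using assms unfolding generically_iff_open by blast

lemma generically_all:
  assumes "\<And>x. x \<in> E \<Longrightarrow> P x"
  shows "generically E P"
  unfolding generically_iff_open using assms closure_subset by (intro exI[of _ UNIV]) auto

lemma generically_conj:
  assumes "generically E P" "generically E Q"
  shows "generically E (\<lambda>x. P x \<and> Q x)"
proof -
  obtain U V where U: "open U" "E \<subseteq> closure (E \<inter> U)" "\<forall>x\<in>E \<inter> U. P x"
    and V: "open V" "E \<subseteq> closure (E \<inter> V)" "\<forall>x\<in>E \<inter> V. Q x"
    using assms unfolding generically_iff_open by blast
  have "x \<in> closure (E \<inter> (U \<inter> V))" if "x \<in> E" for x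
    unfolding closure_iff_nhds_not_empty
  proof (intro allI impI)
    fix A W assume W: "W \<subseteq> A" "x \<in> W" "open W"
    have "x \<in> closure (E \<inter> U)" using U(2) that by blast
    then obtain y where y: "y \<in> E \<inter> U" "y \<in> W"
      using W(3,2) by (rule closure_open_meets)
    then have "y \<in> closure (E \<inter> V)" "open (U \<inter> W)" "y \<in> U \<inter> W" using V(2) U(1) W by auto
    then obtain y' where "y' \<in> E \<inter> V" "y' \<in> U \<inter> W" by (rule closure_open_meets)
    then show "(E \<inter> (U \<inter> V)) \<inter> A \<noteq> {}" using W by blast
  qed
  then show ?thesis unfolding generically_iff_open
    using U V by (intro exI[of _ "U \<inter> V"]) auto
qed

lemma generically_ball_finite:
  assumes "finite A" "\<And>a. a \<in> A \<Longrightarrow> generically E (P a)"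
  shows "generically E (\<lambda>x. \<forall>a\<in>A. P a x)"
  using assms
proof (induction A rule: finite_induct)
  case empty
  then show ?case by (intro generically_all) auto
next
  case (insert a A)
  then have "generically E (\<lambda>x. P a x \<and> (\<forall>a\<in>A. P a x))" by (intro generically_conj) auto
  then show ?case by (rule generically_mono) auto
qed

lemma generically_all_finite:
  fixes P :: "'i::finite \<Rightarrow> _"
  assumes "\<And>a. generically E (P a)"
  shows "generically E (\<lambda>x. \<forall>a. P a x)"
  using generically_ball_finite[of UNIV E P] assms by simp

text \<open>Conditions on a morphism involve \<lambda> only, those on \<open>L\<close> involve
  \<lambda> and the spectral parameter; this moves between the two. For the descent,
  \<open>snd\<close> is an open map and the image of the dense set is dense.\<close>

lemma generically_snd_iff:
  fixes P :: "'b::topological_space \<Rightarrow> bool"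
  shows "generically ((UNIV :: 'a::topological_space set) \<times> E) (\<lambda>(z, x). P x) \<longleftrightarrow> generically E P"
proof
  assume "generically E P"
  then obtain W where W: "open W" "E \<subseteq> closure (E \<inter> W)" "\<forall>x\<in>E \<inter> W. P x"
    unfolding generically_iff_open by blast
  have "(UNIV :: 'a set) \<times> E \<inter> (UNIV \<times> W) = UNIV \<times> (E \<inter> W)" by auto
  then show "generically ((UNIV :: 'a set) \<times> E) (\<lambda>(z, x). P x)"
    unfolding generically_iff_open
    using W by (intro exI[of _ "UNIV \<times> W"]) (auto simp: closure_Times open_Times)
next
  assume "generically ((UNIV :: 'a set) \<times> E) (\<lambda>(z, x). P x)"
  then obtain W where W: "open W" "UNIV \<times> E \<subseteq> closure (UNIV \<times> E \<inter> W)"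
    "\<forall>p \<in> (UNIV :: 'a set) \<times> E \<inter> W. case p of (z, x) \<Rightarrow> P x"
    unfolding generically_iff_open by blast
  show "generically E P"
    unfolding generically_iff_open
  proof (intro exI[of _ "snd ` W"] conjI subsetI)
    show "open (snd ` W)" using W(1) by (rule open_image_snd)
    show "\<forall>x\<in>E \<inter> snd ` W. P x" using W(3) by force
    fix x assume "x \<in> E"
    \<comment> \<open>Any first coordinate would serve.\<close>
    then have c: "(undefined, x) \<in> closure (UNIV \<times> E \<inter> W)" using W(2) by blast
    show "x \<in> closure (E \<inter> snd ` W)"
      unfolding closure_iff_nhds_not_empty
    proof (intro allI impI)
      fix A T assume T: "T \<subseteq> A" "x \<in> T" "open T"
      then have "open ((UNIV :: 'a set) \<times> T)" "(undefined, x) \<in> (UNIV :: 'a set) \<times> T"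
        by (auto intro: open_Times)
      with c obtain y where "y \<in> UNIV \<times> E \<inter> W" "y \<in> UNIV \<times> T"
        by (rule closure_open_meets)
      then show "E \<inter> snd ` W \<inter> A \<noteq> {}" using T(1) by force
    qed
  qed
qed

lemma generically_translate:
  fixes E :: "'a::real_normed_vector set"
  assumes "generically E P" "\<And>x. x + v \<in> E \<longleftrightarrow> x \<in> E"
  shows "generically E (\<lambda>x. P (x + v))"
proof -
  obtain W where W: "open W" "E \<subseteq> closure (E \<inter> W)" "\<forall>x\<in>E \<inter> W. P x"
    using assms unfolding generically_iff_open by blast
  define W' where "W' = (\<lambda>x. - v + x) ` W"
  have W': "x \<in> W' \<longleftrightarrow> x + v \<in> W" for x
  proof
    assume "x + v \<in> W"
    moreover have "x = - v + (x + v)" by simp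
    ultimately show "x \<in> W'" unfolding W'_def by (rule rev_image_eqI)
  qed (auto simp: W'_def)
  have eq: "E \<inter> W' = (\<lambda>x. - v + x) ` (E \<inter> W)"
  proof (intro set_eqI iffI)
    fix x assume "x \<in> E \<inter> W'"
    then have "x + v \<in> E \<inter> W" using assms(2) W' by blast
    moreover have "x = - v + (x + v)" by simp
    ultimately show "x \<in> (\<lambda>x. - v + x) ` (E \<inter> W)" by (rule rev_image_eqI)
  next
    fix x assume "x \<in> (\<lambda>x. - v + x) ` (E \<inter> W)"
    then obtain y where "y \<in> E" "y \<in> W" "x = - v + y" by blast
    then show "x \<in> E \<inter> W'" using assms(2)[of "- v + y"] W' by simp
  qed
  have "E \<subseteq> closure (E \<inter> W')"
  proof
    fix x assume "x \<in> E"
    then have "x + v \<in> closure (E \<inter> W)" using assms(2) W(2) by blast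
    then have "- v + (x + v) \<in> (\<lambda>x. - v + x) ` closure (E \<inter> W)" by blast
    then show "x \<in> closure (E \<inter> W')" unfolding eq closure_translation by simp
  qed
  moreover have "open W'" unfolding W'_def using W(1) by (rule open_translation)
  ultimately show ?thesis
    unfolding generically_iff_open using W(3) W' assms(2) by (intro exI[of _ W']) auto
qed

text \<open>The sort of the domain in \<open>generically_nonzero\<close> relates the norm to real
  scaling only; this form makes \<open>t *\<^sub>C v\<close> visibly continuous in
  \<open>t\<close>.\<close>

lemma scaleC_conv_scaleR: "t *\<^sub>C v = Re t *\<^sub>R v + Im t *\<^sub>R (\<i> *\<^sub>C v)"
proof -
  have "t = of_real (Re t) + of_real (Im t) * \<i>" by (simp add: complex_eq_iff)
  from arg_cong[where f = "\<lambda>s. s *\<^sub>C v", OF this]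
  have "t *\<^sub>C v = (of_real (Re t) + of_real (Im t) * \<i>) *\<^sub>C v" .
  also have "\<dots> = of_real (Re t) *\<^sub>C v + of_real (Im t) *\<^sub>C (\<i> *\<^sub>C v)"
    by (simp only: scaleC_add_left scaleC_scaleC)
  finally show ?thesis by (simp only: scaleC_of_real)
qed

text \<open>A function that is holomorphic along complex lines and vanishes on a nonempty open subset
  vanishes along every line through a point of that subset.\<close>

lemma generically_nonzero:
  fixes F :: "'a::{complex_vector,real_normed_vector} \<Rightarrow> complex"
  assumes cont: "continuous_on UNIV F"
    and lines: "\<And>p v. (\<lambda>t. F (p + t *\<^sub>C v)) holomorphic_on UNIV"
    and sub: "\<And>p q t. p \<in> E \<Longrightarrow> q \<in> E \<Longrightarrow> p + t *\<^sub>C (q - p) \<in> E"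
    and q: "q \<in> E" "F q \<noteq> 0"
  shows "generically E (\<lambda>p. F p \<noteq> 0)"
proof -
  have op: "open {p. F p \<noteq> 0}" using cont by (intro open_Collect_neq) auto
  have "p \<in> closure (E \<inter> {p. F p \<noteq> 0})" if p: "p \<in> E" for p
    unfolding closure_iff_nhds_not_empty
  proof (intro allI impI notI)
    fix A T assume T: "T \<subseteq> A" "p \<in> T" "open T" and e: "E \<inter> {p. F p \<noteq> 0} \<inter> A = {}"
    \<comment> \<open>The complex line with \<open>p\<close> at parameter 0 and \<open>q\<close> at
      parameter 1.\<close>
    define g where "g t = p + t *\<^sub>C (q - p)" for t
    have "g = (\<lambda>t. p + (Re t *\<^sub>R (q - p) + Im t *\<^sub>R (\<i> *\<^sub>C (q - p))))"
      unfolding g_def by (intro ext arg_cong[OF scaleC_conv_scaleR])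
    moreover have "continuous_on UNIV (\<lambda>t. p + (Re t *\<^sub>R (q - p) + Im t *\<^sub>R (\<i> *\<^sub>C (q - p))))"
      by (intro continuous_intros)
    ultimately have "continuous_on UNIV g" by simp
    then have "open (g -` T)" using T(3) by (simp add: continuous_on_open_vimage)
    moreover have "0 \<in> g -` T" using T(2) by (simp add: g_def)
    moreover have "F (g t) = 0" if "t \<in> g -` T" for t
      using e T(1) that sub[OF p q(1), of t] by (auto simp: g_def)
    moreover have "(\<lambda>t. F (g t)) holomorphic_on UNIV" unfolding g_def by (rule lines)
    ultimately have "F (g 1) = 0"
      using analytic_continuation_open[of "g -` T" UNIV "\<lambda>t. F (g t)" "\<lambda>_. 0" 1] by auto
    then show False using q(2) by (simp add: g_def scaleC_one)
  qed
  then show ?thesis unfolding generically_iff_open using op by blast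
qed

section \<open>Determinants of the vectors \<open>\<Phi>\<close>\<close>

lemma idx_less_CARD: "idx (k :: 'n::{finite,linorder}) < CARD('n)"
  unfolding idx_def by (rule psubset_card_mono) auto

lemma idx_strict_mono: "j < k \<Longrightarrow> idx j < idx k"
  unfolding idx_def by (rule psubset_card_mono) auto

lemma bij_betw_idx: "bij_betw (idx :: 'n::{finite,linorder} \<Rightarrow> nat) UNIV {..<CARD('n)}"
proof -
  have inj: "inj (idx :: 'n \<Rightarrow> nat)"
    by (rule injI) (metis idx_strict_mono less_irrefl linorder_neqE)
  moreover have "range (idx :: 'n \<Rightarrow> nat) = {..<CARD('n)}"
    by (rule card_subset_eq) (auto simp: idx_less_CARD card_image[OF inj])
  ultimately show ?thesis by (simp add: bij_betw_def)
qed

lemma Phi_nth: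
  "(Phi \<tau> u :: 'n::{finite,linorder} cvec) $ l = theta_comp CARD('n) \<tau> (int (idx l)) u"
  by (simp add: Phi_def theta_comp_def)

lemma holomorphic_Phi_nth:
  assumes "Im \<tau> > 0"
  shows "(\<lambda>u. (Phi \<tau> u :: 'n::{finite,linorder} cvec) $ l) holomorphic_on UNIV"
  unfolding Phi_nth using holomorphic_theta_comp[OF _ assms, of "CARD('n)"] by simp

text \<open>In other words, the values of \<Phi> span the whole space, by independence of the
  components.\<close>

lemma Phi_functional_eq_0:
  fixes c :: "'n::{finite,linorder} \<Rightarrow> complex"
  assumes "Im \<tau> > 0" "\<And>u. (\<Sum>l\<in>UNIV. c l * Phi \<tau> u $ l) = 0"
  shows "c l = 0"
proof -
  define d where "d r = c (inv_into UNIV idx r)" for r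
  have d: "d (idx l) = c l" for l
    using bij_betw_idx[where 'n = 'n] by (simp add: d_def bij_betw_def)
  have "(\<Sum>r<CARD('n). d r * theta_comp CARD('n) \<tau> (int r) u) = 0" for u
    using assms(2)[of u] unfolding sum.reindex_bij_betw[OF bij_betw_idx, symmetric] d Phi_nth .
  then have "d (idx l) = 0"
    using theta_comp_linear_independent[OF _ assms(1), of "CARD('n)" d "idx l"] idx_less_CARD[of l] by simp
  then show ?thesis by (simp add: d)
qed

lemma Phi_proportional_imp_lattice:
  assumes "Im \<tau> > 0" "CARD('n) \<ge> 2"
    and ratio: "\<And>u l l'. (Phi \<tau> (u + d) :: 'n::{finite,linorder} cvec) $ l * (Phi \<tau> u :: 'n cvec) $ l' =
      (Phi \<tau> (u + d) :: 'n cvec) $ l' * (Phi \<tau> u :: 'n cvec) $ l"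
  shows "d / of_nat CARD('n) \<in> lattice \<tau>"
proof (rule theta_comp_proportional_imp_lattice[OF _ assms(1,2)])
  have mod: "\<exists>l :: 'n. theta_comp CARD('n) \<tau> r = theta_comp CARD('n) \<tau> (int (idx l))" for r
  proof -
    have "nat (r mod int CARD('n)) \<in> {..<CARD('n)}" by (simp add: nat_less_iff)
    then obtain l :: 'n where "idx l = nat (r mod int CARD('n))"
      using bij_betw_idx[where 'n = 'n] unfolding bij_betw_def by (metis imageE)
    then have "int (idx l) = r mod int CARD('n)" by simp
    then have "theta_comp CARD('n) \<tau> r u = theta_comp CARD('n) \<tau> (int (idx l)) u" for u
      using theta_comp_mod[OF _ assms(1), of "CARD('n)" r u] by simp
    then show ?thesis by blast
  qed
  show "theta_comp CARD('n) \<tau> r (u + d) * theta_comp CARD('n) \<tau> r' u =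
      theta_comp CARD('n) \<tau> r' (u + d) * theta_comp CARD('n) \<tau> r u" for r r' u
    using mod[of r] mod[of r'] ratio[of u] unfolding Phi_nth by metis
qed simp

text \<open>Expands the determinant as a linear functional of row \<open>k\<close>, the form to
  which \<open>Phi_functional_eq_0\<close> applies.\<close>

lemma det_rows_update:
  fixes c :: "'n::finite \<Rightarrow> 'n cvec"
  shows "det (\<chi> m. (c(k := x)) m) = (\<Sum>l\<in>UNIV. det (\<chi> m. (c(k := axis l 1)) m) * x $ l)"
proof -
  have e: "(c(k := y)) m = (if m = k then y else c m)" for y m by simp
  have "det (\<chi> m. (c(k := x)) m) = det (\<chi> m. if m = k then \<Sum>l\<in>UNIV. x $ l *s axis l 1 else c m)"
    by (simp only: e basis_expansion)
  also have "\<dots> = (\<Sum>l\<in>UNIV. det (\<chi> m. if m = k then x $ l *s axis l 1 else c m))"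
    by (rule det_linear_row_sum) simp
  also have "\<dots> = (\<Sum>l\<in>UNIV. x $ l * det (\<chi> m. if m = k then axis l 1 else c m))"
    by (simp only: det_row_mul)
  finally show ?thesis by (simp only: e mult.commute)
qed

text \<open>The rows are freed one at a time: with the others fixed, the determinant is a linear
  functional that vanishes on all values of \<Phi>, so it vanishes on every vector.\<close>

lemma det_Phi_eq_0_imp_det_eq_0:
  fixes c x :: "'n::{finite,linorder} \<Rightarrow> 'n cvec"
  assumes "Im \<tau> > 0"
    and "\<And>u. det (\<chi> m. if m \<in> K then Phi \<tau> (u m) else c m) = 0"
  shows "det (\<chi> m. if m \<in> K then x m else c m) = 0"
proof -
  have "finite K" by simp
  then show ?thesis using assms(2)
  proof (induction K arbitrary: c rule: finite_induct)
    case (insert k K)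
    define d where "d m = (if m \<in> K then x m else c m)" for m
    have "(\<Sum>l\<in>UNIV. det (\<chi> m. (d(k := axis l 1)) m) * Phi \<tau> v $ l) = 0" for v
    proof -
      have "det (\<chi> m. if m \<in> K then x m else (c(k := Phi \<tau> v)) m) = 0"
      proof (rule insert.IH)
        fix u
        have "(\<chi> m. if m \<in> K then Phi \<tau> (u m) else (c(k := Phi \<tau> v)) m) =
            (\<chi> m. if m \<in> insert k K then Phi \<tau> ((u(k := v)) m) else c m)"
          using insert.hyps by (auto simp: vec_eq_iff)
        then show "det (\<chi> m. if m \<in> K then Phi \<tau> (u m) else (c(k := Phi \<tau> v)) m) = 0"
          using insert.prems[of "u(k := v)"] by simp
      qed
      moreover have "(\<chi> m. if m \<in> K then x m else (c(k := Phi \<tau> v)) m) = (\<chi> m. (d(k := Phi \<tau> v)) m)"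
        using insert.hyps by (auto simp: vec_eq_iff d_def)
      ultimately show ?thesis using det_rows_update[of d k "Phi \<tau> v"] by simp
    qed
    then have "det (\<chi> m. (d(k := axis l 1)) m) = 0" for l
      by (rule Phi_functional_eq_0[OF assms(1)])
    then have "det (\<chi> m. (d(k := x k)) m) = 0" by (subst det_rows_update) (simp only: mult_zero_left sum.neutral_const)
    moreover have "(\<chi> m. (d(k := x k)) m) = (\<chi> m. if m \<in> insert k K then x m else c m)"
      by (auto simp: vec_eq_iff d_def)
    ultimately show ?case by simp
  qed simp
qed

text \<open>If a minor of \<open>a\<close> and \<open>b\<close> in the columns \<open>l\<close>,
  \<open>l'\<close> were nonzero, filling the remaining rows with the unit vectors of the remaining
  columns would give an invertible matrix.\<close>

lemma det_eq_0_imp_proportional: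
  fixes a b :: "'n::finite cvec"
  assumes "j \<noteq> k"
    and "\<And>x. det (\<chi> m. if m = j then a else if m = k then b else x m) = 0"
  shows "a $ l * b $ l' = a $ l' * b $ l"
proof (rule ccontr)
  assume ne: "a $ l * b $ l' \<noteq> a $ l' * b $ l"
  then have "l \<noteq> l'" by auto
  with assms(1) have "card (UNIV - {j, k}) = card (UNIV - {l, l'})"
    by (simp add: card_Diff_subset)
  then obtain p where p: "bij_betw p (UNIV - {j, k}) (UNIV - {l, l'})"
    using finite_same_card_bij[of "UNIV - {j, k}" "UNIV - {l, l'}"] by auto
  define M :: "'n cmat" where "M = (\<chi> m. if m = j then a else if m = k then b else axis (p m) 1)"
  have "y = 0" if y: "M *v y = 0" for y
  proof -
    have row: "(\<Sum>i\<in>UNIV. M $ m $ i * y $ i) = 0" for m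
      using y by (simp add: matrix_vector_mult_def vec_eq_iff)
    have other: "y $ i = 0" if "i \<notin> {l, l'}" for i
    proof -
      have "i \<in> p ` (UNIV - {j, k})" using that bij_betw_imp_surj_on[OF p] by blast
      then obtain m where m: "m \<notin> {j, k}" "p m = i" by blast
      then have "M $ m = axis i 1" by (simp add: M_def)
      moreover have "axis i 1 $ i' * y $ i' = (if i' = i then y $ i' else 0)" for i'
        by (simp add: axis_def)
      ultimately show ?thesis using row[of m] by simp
    qed
    have two: "(\<Sum>i\<in>UNIV. f i * y $ i) = f l * y $ l + f l' * y $ l'" for f :: "'n \<Rightarrow> complex"
    proof -
      have "(\<Sum>i\<in>UNIV. f i * y $ i) = (\<Sum>i\<in>{l, l'}. f i * y $ i)"
        by (rule sum.mono_neutral_right) (auto simp: other)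
      then show ?thesis using \<open>l \<noteq> l'\<close> by simp
    qed
    have ra: "a $ l * y $ l + a $ l' * y $ l' = 0" and rb: "b $ l * y $ l + b $ l' * y $ l' = 0"
      using row[of j] row[of k] assms(1) unfolding two by (simp_all add: M_def)
    have "(a $ l * b $ l' - a $ l' * b $ l) * y $ l =
        b $ l' * (a $ l * y $ l + a $ l' * y $ l') - a $ l' * (b $ l * y $ l + b $ l' * y $ l')"
      by (simp add: algebra_simps)
    moreover have "(a $ l * b $ l' - a $ l' * b $ l) * y $ l' =
        a $ l * (b $ l * y $ l + b $ l' * y $ l') - b $ l * (a $ l * y $ l + a $ l' * y $ l')"
      by (simp add: algebra_simps)
    ultimately have "y $ l = 0" "y $ l' = 0" using ne unfolding ra rb by simp_all
    then have "y $ i = 0" for i using other[of i] by blast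
    then show ?thesis by (simp add: vec_eq_iff)
  qed
  then have "\<exists>B. B ** M = mat 1" using matrix_left_invertible_ker by blast
  then have "invertible M" using invertible_left_inverse by blast
  then have "det M \<noteq> 0" using invertible_det_nz by blast
  then show False using assms(2)[of "\<lambda>m. axis (p m) 1"] unfolding M_def by simp
qed

text \<open>The map \<open>s\<close> tells which coordinate of \<lambda> each row uses. It is
  \<open>id\<close> for the determinant of S, and \<open>id(k := j)\<close> when the rows
  \<open>j\<close> and \<open>k\<close> share the coordinate \<open>j\<close>.\<close>

definition Phi_det :: "complex \<Rightarrow> ('n::{finite,linorder} \<Rightarrow> 'n) \<Rightarrow> ('n \<Rightarrow> complex) \<Rightarrow> complex \<times> 'n cvec \<Rightarrow> complex" where
  "Phi_det \<tau> s a = (\<lambda>(z, lam). det (\<chi> m. (Phi \<tau> (a m + z - of_nat CARD('n) * lam $ s m) :: 'n cvec)))"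

lemma Phi_det_generically_nonzero:
  fixes s :: "'n::{finite,linorder} \<Rightarrow> 'n" and a :: "'n \<Rightarrow> complex"
  assumes tau: "Im \<tau> > 0" and ex: "\<exists>z. \<exists>lam\<in>hstar. Phi_det \<tau> s a (z, lam) \<noteq> 0"
  shows "generically (UNIV \<times> hstar) (\<lambda>(z, lam). Phi_det \<tau> s a (z, lam) \<noteq> 0)"
proof -
  obtain z lam where "(lam :: 'n cvec) \<in> hstar" "Phi_det \<tau> s a (z, lam) \<noteq> 0" using ex by blast
  have "generically (UNIV \<times> hstar) (\<lambda>p. Phi_det \<tau> s a p \<noteq> 0)"
  proof (rule generically_nonzero)
    have "continuous_on UNIV (\<lambda>u. (Phi \<tau> u :: 'n cvec) $ l)" for l
      using holomorphic_Phi_nth[OF tau] holomorphic_on_imp_continuous_on by blast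
    then have c: "continuous_on UNIV (\<lambda>p. (Phi \<tau> (f p) :: 'n cvec) $ l)"
      if "continuous_on UNIV f" for f :: "complex \<times> 'n cvec \<Rightarrow> complex" and l
      using that continuous_on_compose2 by blast
    show "continuous_on UNIV (Phi_det \<tau> s a)"
      unfolding Phi_det_def split_def det_def vec_lambda_beta
      by (intro continuous_intros c)
    have h: "(\<lambda>t. (Phi \<tau> (f t) :: 'n cvec) $ l) holomorphic_on UNIV"
      if "f holomorphic_on UNIV" for f l
      using holomorphic_on_compose_gen[OF that holomorphic_Phi_nth[OF tau]] by (simp add: o_def)
    show "(\<lambda>t. Phi_det \<tau> s a (p + t *\<^sub>C v)) holomorphic_on UNIV" for p v
      unfolding Phi_det_def split_def det_def vec_lambda_beta
      by (intro holomorphic_intros h) (auto simp: scaleC_prod_def scaleC_vec_def scaleC_complex_def intro!: holomorphic_intros)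
    show "p + t *\<^sub>C (q - p) \<in> UNIV \<times> hstar"
      if "p \<in> UNIV \<times> hstar" "q \<in> UNIV \<times> hstar" for p q :: "complex \<times> 'n cvec" and t
      using that by (auto simp: traceless_def scaleC_prod_def scaleC_vec_def scaleC_complex_def
          sum.distrib sum_subtractf sum_distrib_left[symmetric])
  qed (use \<open>lam \<in> hstar\<close> \<open>Phi_det \<tau> s a (z, lam) \<noteq> 0\<close> in auto)
  then show ?thesis by (simp add: case_prod_unfold)
qed

text \<open>Since \<lambda> sums to 0, summing the equations makes \<open>z\<close> the mean of
  \<open>u\<close>. Thus \<open>z\<close> and \<lambda> together amount to \<open>n\<close>
  independent complex parameters.\<close>

lemma obtain_spectral_coordinates:
  fixes u :: "'n::finite \<Rightarrow> complex"
  obtains z lam where "lam \<in> hstar" "\<And>m. z - of_nat CARD('n) * lam $ m = u m"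
proof
  let ?z = "(\<Sum>m\<in>UNIV. u m) / of_nat CARD('n)"
  let ?lam = "\<chi> m. (?z - u m) / of_nat CARD('n)"
  show "?lam \<in> hstar"
    by (simp add: traceless_def sum_divide_distrib[symmetric] sum_subtractf)
  show "?z - of_nat CARD('n) * ?lam $ m = u m" for m by simp
qed

lemma S_mat_eq_transpose:
  "S_mat \<tau> z lam = transpose (\<chi> m. Phi \<tau> (z - of_nat CARD('n) * lam $ m) :: 'n::{finite,linorder} cmat)"
  by (simp add: S_mat_def transpose_def vec_eq_iff)

text \<open>If the determinant vanished identically, the rows could be replaced by arbitrary
  vectors, for instance by those of the identity matrix.\<close>

lemma S_mat_generically_invertible:
  fixes w :: "'n::{finite,linorder} cvec"
  assumes tau: "Im \<tau> > 0"
  shows "generically (UNIV \<times> hstar) (\<lambda>(z, lam). invertible (S_mat \<tau> (z - d) (lam + w)))"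
proof -
  define a where "a m = - d - of_nat CARD('n) * w $ m" for m
  have e: "det (S_mat \<tau> (z - d) (lam + w)) = Phi_det \<tau> id a (z, lam)" for z lam
    unfolding S_mat_eq_transpose det_transpose Phi_det_def
    by (simp add: a_def algebra_simps)
  have "\<exists>z. \<exists>lam\<in>hstar. Phi_det \<tau> id a (z, lam) \<noteq> 0"
  proof (rule ccontr)
    assume "\<not> ?thesis"
    then have z: "lam \<in> hstar \<Longrightarrow> Phi_det \<tau> id a (z, lam) = 0" for z lam by blast
    have "det (\<chi> m. if m \<in> UNIV then Phi \<tau> (u m) else (0 :: 'n cvec)) = 0" for u
    proof -
      obtain z lam where "lam \<in> hstar" "\<And>m. z - of_nat CARD('n) * lam $ m = u m - a m"
        using obtain_spectral_coordinates[of "\<lambda>m. u m - a m"] by blast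
      then show ?thesis using z[of lam z] by (simp add: Phi_det_def add_diff_eq[symmetric])
    qed
    then have "det (\<chi> m. if m \<in> UNIV then axis m 1 else (0 :: 'n cvec)) = 0"
      by (rule det_Phi_eq_0_imp_det_eq_0[OF tau])
    moreover have "(\<chi> m. if m \<in> UNIV then axis m 1 else (0 :: 'n cvec)) = mat 1"
      by (simp add: vec_eq_iff mat_def axis_def)
    ultimately show False by simp
  qed
  from Phi_det_generically_nonzero[OF tau this] show ?thesis
    by (rule generically_mono) (auto simp: invertible_det_nz e)
qed

text \<open>Here \<open>b k\<close> is attached to the coordinate \<open>j\<close>, so the rows \<open>j\<close> and \<open>k\<close> are
  \<open>\<Phi>(u\<^sub>j + b j)\<close> and \<open>\<Phi>(u\<^sub>j + b k)\<close>, while the other rows are in general position.\<close>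

lemma Phi_det_eq_0_imp_lattice:
  fixes b :: "'n::{finite,linorder} \<Rightarrow> complex"
  assumes tau: "Im \<tau> > 0" and n: "CARD('n) \<ge> 2" and "j \<noteq> k"
    and zero: "\<And>z lam. lam \<in> hstar \<Longrightarrow> Phi_det \<tau> (id(k := j)) b (z, lam) = 0"
  shows "(b k - b j) / of_nat CARD('n) \<in> lattice \<tau>"
proof (rule Phi_proportional_imp_lattice[where 'n = 'n, OF tau n])
  fix v and l l' :: 'n
  let ?c = "\<lambda>m. if m = j then Phi \<tau> v else Phi \<tau> (v + (b k - b j)) :: 'n cvec"
  have z: "det (\<chi> m. if m \<in> - {j, k} then x m else ?c m) = 0" for x
  proof (rule det_Phi_eq_0_imp_det_eq_0[OF tau])
    fix u :: "'n \<Rightarrow> complex"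
    \<comment> \<open>The coordinate \<open>j\<close> is tuned so that row \<open>j\<close> becomes
      \<open>Phi \<tau> v\<close>, which also determines row \<open>k\<close>; the coordinates of
      the other rows realise the given \<open>u m\<close>.\<close>
    obtain z lam where *: "lam \<in> hstar" 
      "\<And>m. z - of_nat CARD('n) * lam $ m = (if m = j then v - b j else u m - b m)"
      using obtain_spectral_coordinates[of "\<lambda>m. if m = j then v - b j else u m - b m"] by blast
    have "Phi_det \<tau> (id(k := j)) b (z, lam) = det (\<chi> m. if m \<in> - {j, k} then Phi \<tau> (u m) else ?c m)"
    proof -
      have "b m + z - of_nat CARD('n) * lam $ (id(k := j)) m =
          (if m \<in> - {j, k} then u m else if m = j then v else v + (b k - b j))" for m
      proof -
        have "b m + z - of_nat CARD('n) * lam $ (id(k := j)) m =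
          b m + (z - of_nat CARD('n) * lam $ (id(k := j)) m)" by simp
        also have "\<dots> = b m + (if (id(k := j)) m = j then v - b j
            else u ((id(k := j)) m) - b ((id(k := j)) m))"
          by (simp only: *(2))
        also have "\<dots> = (if m \<in> - {j, k} then u m else if m = j then v else v + (b k - b j))"
          using assms(3) by auto
        finally show ?thesis .
      qed
      then show ?thesis
        unfolding Phi_det_def split_def fst_conv snd_conv
        by (intro arg_cong[of _ _ det] Cart_lambda_cong) (simp only: if_distrib[of "Phi \<tau>"])
    qed
    then show "det (\<chi> m. if m \<in> - {j, k} then Phi \<tau> (u m) else ?c m) = 0" using zero[OF *(1)] by (simp only:)
  qed
  have "det (\<chi> m. if m = j then Phi \<tau> v else if m = k then Phi \<tau> (v + (b k - b j)) else x m) = 0"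
    for x :: "'n \<Rightarrow> 'n cvec"
  proof -
    have "(\<chi> m. if m = j then Phi \<tau> v else if m = k then Phi \<tau> (v + (b k - b j)) else x m) =
      (\<chi> m. if m \<in> - {j, k} then x m else ?c m)"
      using assms(3) by (auto simp: vec_eq_iff)
    then show ?thesis using z[of x] by (simp only:)
  qed
  from det_eq_0_imp_proportional[OF assms(3) this, of l' l]
  show "Phi \<tau> (v + (b k - b j)) $ l * Phi \<tau> v $ l' = Phi \<tau> (v + (b k - b j)) $ l' * Phi \<tau> v $ l"
    by (simp only: mult.commute)
qed

section \<open>Weight decompositions\<close>

lemma clinear_iff:
  "clinear f \<longleftrightarrow> (\<forall>x y. f (x + y) = f x + f y) \<and> (\<forall>c x. f (c *\<^sub>C x) = c *\<^sub>C f x)"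
  by (simp add: linear_iff_module_hom module_hom_iff complex_vector.module_axioms)

lemma clinear_add: "clinear f \<Longrightarrow> f (x + y) = f x + f y"
  and clinear_scaleC: "clinear f \<Longrightarrow> f (c *\<^sub>C x) = c *\<^sub>C f x"
  by (simp_all add: clinear_iff)

lemma clinear_0: "clinear f \<Longrightarrow> f 0 = 0"
  using clinear_scaleC[of f 0 0] by simp

lemma clinear_sum: "clinear f \<Longrightarrow> f (\<Sum>i\<in>A. g i) = (\<Sum>i\<in>A. f (g i))"
  by (induction A rule: infinite_finite_induct) (simp_all add: clinear_0 clinear_add)

lemma omega_in_cartan: "omega i \<in> cartan"
  by (simp add: traceless_def omega_def sum_subtractf)

text \<open>As an element of the Cartan algebra, \<open>omega i\<close> reads off the coordinate
  \<open>i\<close> of a weight, because weights sum to 0.\<close>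

lemma pairing_omega:
  assumes "\<mu> \<in> hstar"
  shows "pairing \<mu> (omega i) = \<mu> $ i"
proof -
  have "pairing \<mu> (omega i) = (\<Sum>k\<in>UNIV. (if k = i then \<mu> $ k else 0) - \<mu> $ k / of_nat CARD('a))"
    unfolding pairing_def omega_def by (intro sum.cong) (auto simp: algebra_simps)
  then show ?thesis
    using assms by (simp add: sum_subtractf sum_divide_distrib[symmetric] traceless_def)
qed

lemma hstar_eqI:
  assumes "\<mu> \<in> hstar" "\<nu> \<in> hstar" "\<And>h. h \<in> cartan \<Longrightarrow> pairing \<mu> h = pairing \<nu> h"
  shows "\<mu> = \<nu>"
  using assms pairing_omega omega_in_cartan by (metis vec_eq_iff)

lemma weight_space_iff: "v \<in> weight_space act \<mu> \<longleftrightarrow> (\<forall>h\<in>cartan. act h v = pairing \<mu> h *\<^sub>C v)"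
  by (simp add: weight_space_def)

locale weight_module =
  fixes act :: "'n::finite cvec \<Rightarrow> 'v::complex_vector \<Rightarrow> 'v"
  assumes diagonalizable: "diagonalizable act" and finite_dim: "finite_dim TYPE('v)"
begin

lemma clinear_act: "h \<in> cartan \<Longrightarrow> clinear (act h)"
  using diagonalizable by (simp add: diagonalizable_def h_module_def)

lemma weight_space_0: "0 \<in> weight_space act \<mu>"
  by (simp add: weight_space_iff clinear_0[OF clinear_act])

lemma weight_space_add:
  "v \<in> weight_space act \<mu> \<Longrightarrow> w \<in> weight_space act \<mu> \<Longrightarrow> v + w \<in> weight_space act \<mu>"
  by (simp add: weight_space_iff clinear_add[OF clinear_act] scaleC_add_right)

lemma weight_space_scaleC: "v \<in> weight_space act \<mu> \<Longrightarrow> c *\<^sub>C v \<in> weight_space act \<mu>"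
  by (simp add: weight_space_iff clinear_scaleC[OF clinear_act] scaleC_scaleC mult.commute)

lemma weight_space_diff:
  "v \<in> weight_space act \<mu> \<Longrightarrow> w \<in> weight_space act \<mu> \<Longrightarrow> v - w \<in> weight_space act \<mu>"
  using weight_space_add[of v \<mu> "- w"] weight_space_scaleC[of w \<mu> "- 1"] by simp

text \<open>Applying \<open>h\<close> and subtracting \<open>pairing \<nu> h\<close> times the
  relation removes the term of weight \<nu>; some \<open>h\<close> tells each other weight from
  \<nu>.\<close>

lemma weight_vectors_independent:
  assumes "finite F" "F \<subseteq> hstar" "\<And>\<mu>. \<mu> \<in> F \<Longrightarrow> d \<mu> \<in> weight_space act \<mu>" "(\<Sum>\<mu>\<in>F. d \<mu>) = 0"
  shows "\<forall>\<mu>\<in>F. d \<mu> = 0"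
  using assms
proof (induction F arbitrary: d rule: finite_induct)
  case (insert \<nu> F)
  have s: "d \<nu> + (\<Sum>\<mu>\<in>F. d \<mu>) = 0" using insert.hyps insert.prems(3) by simp
  have F0: "d \<mu> = 0" if "\<mu> \<in> F" for \<mu>
  proof -
    have "(pairing \<mu> h - pairing \<nu> h) *\<^sub>C d \<mu> = 0" if h: "h \<in> cartan" for h
    proof -
      have dh: "act h (d \<mu>) = pairing \<mu> h *\<^sub>C d \<mu>" if "\<mu> \<in> insert \<nu> F" for \<mu>
        using insert.prems(2) that h by (simp add: weight_space_iff)
      have "act h (d \<nu> + (\<Sum>\<mu>\<in>F. d \<mu>)) = pairing \<nu> h *\<^sub>C d \<nu> + (\<Sum>\<mu>\<in>F. pairing \<mu> h *\<^sub>C d \<mu>)"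
        using dh by (simp add: clinear_add[OF clinear_act[OF h]] clinear_sum[OF clinear_act[OF h]])
      then have "pairing \<nu> h *\<^sub>C d \<nu> + (\<Sum>\<mu>\<in>F. pairing \<mu> h *\<^sub>C d \<mu>) = 0"
        unfolding s by (simp add: clinear_0[OF clinear_act[OF h]])
      moreover have "pairing \<nu> h *\<^sub>C d \<nu> + (\<Sum>\<mu>\<in>F. pairing \<nu> h *\<^sub>C d \<mu>) = 0"
        using arg_cong[OF s, of "scaleC (pairing \<nu> h)"]
        by (simp add: scaleC_add_right complex_vector.scale_sum_right)
      ultimately have "(\<Sum>\<mu>\<in>F. (pairing \<mu> h - pairing \<nu> h) *\<^sub>C d \<mu>) = 0"
        by (simp add: complex_vector.scale_left_diff_distrib sum_subtractf add_eq_0_iff)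
      then show ?thesis
        using insert.IH[of "\<lambda>\<mu>. (pairing \<mu> h - pairing \<nu> h) *\<^sub>C d \<mu>"] insert.prems \<open>\<mu> \<in> F\<close>
        by (auto intro: weight_space_scaleC)
    qed
    moreover have "\<mu> \<noteq> \<nu>" "\<mu> \<in> hstar" "\<nu> \<in> hstar" using insert.hyps insert.prems(1) that by auto
    ultimately show ?thesis using hstar_eqI[of \<mu> \<nu>] by fastforce
  qed
  then show ?case using s by simp
qed simp

text \<open>Nonzero vectors of distinct weights are independent in a finite-dimensional space.
  Finiteness makes the sums over \<open>weights act\<close> genuine, as a sum over an infinite set
  is 0 by convention.\<close>

lemma finite_weights: "finite (weights act)"
proof -
  obtain B :: "'v set" where B: "finite B" "complex_vector.span B = UNIV"
    using finite_dim unfolding finite_dim_def by blast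
  have "\<forall>\<mu>\<in>weights act. \<exists>v\<in>weight_space act \<mu>. v \<noteq> 0" by (simp add: weights_def)
  then obtain v where v: "\<And>\<mu>. \<mu> \<in> weights act \<Longrightarrow> v \<mu> \<in> weight_space act \<mu> \<and> v \<mu> \<noteq> 0"
    by (metis (no_types))
  have sub: "weights act \<subseteq> hstar" by (auto simp: weights_def)
  have inj: "inj_on v (weights act)"
  proof (rule inj_onI, rule ccontr)
    fix \<mu> \<nu> assume *: "\<mu> \<in> weights act" "\<nu> \<in> weights act" "v \<mu> = v \<nu>" "\<mu> \<noteq> \<nu>"
    have "v \<mu> \<in> weight_space act \<mu>" "- v \<mu> \<in> weight_space act \<nu>"
      using v[OF *(1)] v[OF *(2)] *(3) weight_space_diff[OF weight_space_0, of "v \<nu>" \<nu>] by simp_all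
    then have "\<forall>\<kappa>\<in>{\<mu>, \<nu>}. (if \<kappa> = \<mu> then v \<mu> else - v \<mu>) = 0"
      using * sub by (intro weight_vectors_independent) auto
    then show False using v[OF *(1)] by auto
  qed
  have "complex_vector.independent (v ` weights act)"
    unfolding complex_vector.dependent_explicit
  proof (intro notI, elim exE conjE bexE)
    fix t u w assume t: "finite t" "t \<subseteq> v ` weights act" "(\<Sum>w\<in>t. u w *\<^sub>C w) = 0" "w \<in> t" "u w \<noteq> 0"
    obtain F where F: "F \<subseteq> weights act" "t = v ` F" using t(2) subset_imageE by metis
    have injF: "inj_on v F" using inj F(1) inj_on_subset by blast
    then have fin: "finite F" using t(1) F(2) finite_image_iff by blast
    have "(\<Sum>\<mu>\<in>F. u (v \<mu>) *\<^sub>C v \<mu>) = 0" using t(3) unfolding F(2) sum.reindex[OF injF] by simp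
    then have "\<forall>\<mu>\<in>F. u (v \<mu>) *\<^sub>C v \<mu> = 0"
      using fin F(1) sub v
      by (intro weight_vectors_independent[of F "\<lambda>\<mu>. u (v \<mu>) *\<^sub>C v \<mu>"]) (auto intro: weight_space_scaleC)
    moreover obtain \<mu> where "\<mu> \<in> F" "w = v \<mu>" using t(4) F(2) by blast
    ultimately show False using t(5) v F(1) by auto
  qed
  then have "finite (v ` weights act)"
    using complex_vector.independent_span_bound[OF B(1)] B(2) by blast
  then show ?thesis using inj finite_image_iff by blast
qed

abbreviation is_decomposition :: "('n cvec \<Rightarrow> 'v) \<Rightarrow> 'v \<Rightarrow> bool" where
  "is_decomposition d v \<equiv> (\<forall>\<mu>. d \<mu> \<in> weight_space act \<mu>) \<and> (\<forall>\<mu>. \<mu> \<notin> weights act \<longrightarrow> d \<mu> = 0) \<and>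
     v = (\<Sum>\<mu>\<in>weights act. d \<mu>)"

lemma decomposition_exists: "\<exists>d. is_decomposition d v"
proof -
  have "complex_vector.span (\<Union>\<mu>\<in>weights act. weight_space act \<mu>) \<subseteq> {v. \<exists>d. is_decomposition d v}"
  proof (rule complex_vector.span_minimal)
    show "(\<Union>\<mu>\<in>weights act. weight_space act \<mu>) \<subseteq> {v. \<exists>d. is_decomposition d v}"
    proof safe
      fix v \<mu> assume "\<mu> \<in> weights act" "v \<in> weight_space act \<mu>"
      then show "\<exists>d. is_decomposition d v"
        using finite_weights weight_space_0 by (intro exI[of _ "\<lambda>\<nu>. if \<nu> = \<mu> then v else 0"]) auto
    qed
    show "complex_vector.subspace {v. \<exists>d. is_decomposition d v}"
    proof (rule complex_vector.subspaceI)
      show "0 \<in> {v. \<exists>d. is_decomposition d v}"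
        using weight_space_0 by (auto intro!: exI[of _ "\<lambda>_. 0"])
    next
      fix x y assume "x \<in> {v. \<exists>d. is_decomposition d v}" "y \<in> {v. \<exists>d. is_decomposition d v}"
      then obtain d e where "is_decomposition d x" "is_decomposition e y" by blast
      then show "x + y \<in> {v. \<exists>d. is_decomposition d v}"
        by (auto simp: sum.distrib intro!: exI[of _ "\<lambda>\<mu>. d \<mu> + e \<mu>"] weight_space_add)
    next
      fix c x assume "x \<in> {v. \<exists>d. is_decomposition d v}"
      then obtain d where "is_decomposition d x" by blast
      then show "c *\<^sub>C x \<in> {v. \<exists>d. is_decomposition d v}"
        by (auto simp: complex_vector.scale_sum_right intro!: exI[of _ "\<lambda>\<mu>. c *\<^sub>C d \<mu>"] weight_space_scaleC)
    qed
  qed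
  then show ?thesis using diagonalizable unfolding diagonalizable_def by blast
qed

lemma decomposition_unique:
  assumes "is_decomposition d v" "is_decomposition e v"
  shows "d = e"
proof
  fix \<mu>
  have "\<forall>\<mu>\<in>weights act. d \<mu> - e \<mu> = 0"
    using assms finite_weights
    by (intro weight_vectors_independent[of _ "\<lambda>\<mu>. d \<mu> - e \<mu>"])
       (auto simp: weights_def weight_space_diff sum_subtractf)
  then show "d \<mu> = e \<mu>" using assms by (cases "\<mu> \<in> weights act") auto
qed

lemma weight_comp_eqI: "is_decomposition d v \<Longrightarrow> weight_comp act v = d"
  unfolding weight_comp_def using decomposition_unique by (intro the_equality) blast+

lemma is_decomposition_weight_comp: "is_decomposition (weight_comp act v) v"
  using decomposition_exists weight_comp_eqI by metis

lemma weight_comp_in_weight_space: "weight_comp act v \<mu> \<in> weight_space act \<mu>"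
  and weight_comp_eq_0: "\<mu> \<notin> weights act \<Longrightarrow> weight_comp act v \<mu> = 0"
  and sum_weight_comp: "(\<Sum>\<mu>\<in>weights act. weight_comp act v \<mu>) = v"
  using is_decomposition_weight_comp by simp_all

lemma clinear_weight_comp: "clinear (\<lambda>v. weight_comp act v \<mu>)"
proof -
  have "weight_comp act (x + y) = (\<lambda>\<mu>. weight_comp act x \<mu> + weight_comp act y \<mu>)" for x y
    by (rule weight_comp_eqI)
       (simp add: weight_comp_in_weight_space weight_space_add weight_comp_eq_0 sum.distrib sum_weight_comp)
  moreover have "weight_comp act (c *\<^sub>C x) = (\<lambda>\<mu>. c *\<^sub>C weight_comp act x \<mu>)" for c x
    by (rule weight_comp_eqI)
       (simp add: weight_comp_in_weight_space weight_space_scaleC weight_comp_eq_0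
         complex_vector.scale_sum_right[symmetric] sum_weight_comp)
  ultimately show ?thesis by (simp add: clinear_iff)
qed

lemma weight_comp_weight_vector:
  assumes "v \<in> weight_space act \<mu>" "\<mu> \<in> hstar"
  shows "weight_comp act v \<nu> = (if \<nu> = \<mu> then v else 0)"
proof -
  have "\<mu> \<in> weights act \<or> v = 0" using assms by (auto simp: weights_def)
  then have "is_decomposition (\<lambda>\<nu>. if \<nu> = \<mu> then v else 0) v"
    using assms finite_weights weight_space_0 by auto
  then show ?thesis by (simp only: weight_comp_eqI)
qed

lemma weights_in_hstar: "\<mu> \<in> weights act \<Longrightarrow> \<mu> \<in> hstar"
  by (simp add: weights_def)

lemma act_weight_comp: "h \<in> cartan \<Longrightarrow> act h (weight_comp act v \<mu>) = pairing \<mu> h *\<^sub>C weight_comp act v \<mu>"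
  using weight_comp_in_weight_space by (simp add: weight_space_iff)

lemma weight_comp_act:
  assumes "h \<in> cartan"
  shows "weight_comp act (act h v) \<mu> = pairing \<mu> h *\<^sub>C weight_comp act v \<mu>"
proof -
  have "act h v = (\<Sum>\<mu>\<in>weights act. pairing \<mu> h *\<^sub>C weight_comp act v \<mu>)"
    using clinear_sum[OF clinear_act[OF assms], of "weight_comp act v" "weights act"]
    by (simp add: sum_weight_comp act_weight_comp[OF assms])
  then have "weight_comp act (act h v) = (\<lambda>\<mu>. pairing \<mu> h *\<^sub>C weight_comp act v \<mu>)"
    by (intro weight_comp_eqI)
       (simp add: weight_comp_in_weight_space weight_space_scaleC weight_comp_eq_0)
  then show ?thesis by simp
qed

text \<open>Lets weights be compared in a single coordinate, which is all that the choice of an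
  extremal component controls.\<close>

lemma weight_comp_omega_eigenvector:
  assumes "act (omega i) v = c *\<^sub>C v" "\<mu> $ i \<noteq> c"
  shows "weight_comp act v \<mu> = 0"
proof (cases "\<mu> \<in> weights act")
  case True
  have "c *\<^sub>C weight_comp act v \<mu> = \<mu> $ i *\<^sub>C weight_comp act v \<mu>"
    using weight_comp_act[OF omega_in_cartan, of i v \<mu>] assms(1) clinear_scaleC[OF clinear_weight_comp]
    by (simp add: pairing_omega[OF weights_in_hstar[OF True]])
  then have "(c - \<mu> $ i) *\<^sub>C weight_comp act v \<mu> = 0"
    by (simp add: complex_vector.scale_left_diff_distrib)
  then show ?thesis using assms(2) by auto
qed (rule weight_comp_eq_0)

lemma clinear_dyn_shift: "clinear (dyn_shift \<gamma> act a lam)"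
  unfolding clinear_iff dyn_shift_def
  by (simp add: clinear_add[OF clinear_weight_comp] clinear_scaleC[OF clinear_weight_comp]
      scaleC_add_right sum.distrib complex_vector.scale_sum_right scaleC_scaleC mult.commute)

lemma weight_comp_dyn_shift:
  "weight_comp act (dyn_shift \<gamma> act a lam v) \<mu> = a (lam - \<gamma> *\<^sub>R \<mu>) *\<^sub>C weight_comp act v \<mu>"
proof -
  have "weight_comp act (dyn_shift \<gamma> act a lam v) = (\<lambda>\<mu>. a (lam - \<gamma> *\<^sub>R \<mu>) *\<^sub>C weight_comp act v \<mu>)"
    by (rule weight_comp_eqI)
       (simp add: weight_comp_in_weight_space weight_space_scaleC weight_comp_eq_0 dyn_shift_def)
  then show ?thesis by simp
qed

lemma dyn_shift_weight_vector:
  assumes "v \<in> weight_space act \<mu>" "\<mu> \<in> hstar"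
  shows "dyn_shift \<gamma> act a lam v = a (lam - \<gamma> *\<^sub>R \<mu>) *\<^sub>C v"
proof -
  have "\<mu> \<in> weights act \<or> v = 0" using assms by (auto simp: weights_def)
  then show ?thesis
    unfolding dyn_shift_def weight_comp_weight_vector[OF assms]
    using finite_weights by (auto simp: if_distrib cong: if_cong)
qed

end

text \<open>A map of weight zero sends each weight space to the one of the same weight, so both
  sides evaluate \<open>a\<close> at the same point.\<close>

lemma weight_zero_map_dyn_shift:
  assumes "weight_module aX" "weight_module aY" "clinear \<phi>"
    and comm: "\<And>h v. h \<in> cartan \<Longrightarrow> \<phi> (aX h v) = aY h (\<phi> v)"
  shows "\<phi> (dyn_shift \<gamma> aX a lam v) = dyn_shift \<gamma> aY a lam (\<phi> v)"
proof -
  interpret X: weight_module aX by fact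
  interpret Y: weight_module aY by fact
  have w: "\<phi> (weight_comp aX v \<mu>) \<in> weight_space aY \<mu>" for \<mu>
    unfolding weight_space_iff
    by (simp add: comm[symmetric] X.act_weight_comp clinear_scaleC[OF assms(3)])
  have "dyn_shift \<gamma> aY a lam (\<phi> v) = dyn_shift \<gamma> aY a lam (\<phi> (\<Sum>\<mu>\<in>weights aX. weight_comp aX v \<mu>))"
    by (simp add: X.sum_weight_comp)
  also have "\<dots> = (\<Sum>\<mu>\<in>weights aX. dyn_shift \<gamma> aY a lam (\<phi> (weight_comp aX v \<mu>)))"
    by (simp add: clinear_sum[OF assms(3)] clinear_sum[OF Y.clinear_dyn_shift])
  also have "\<dots> = (\<Sum>\<mu>\<in>weights aX. a (lam - \<gamma> *\<^sub>R \<mu>) *\<^sub>C \<phi> (weight_comp aX v \<mu>))"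
    by (intro sum.cong refl Y.dyn_shift_weight_vector w X.weights_in_hstar)
  also have "\<dots> = \<phi> (dyn_shift \<gamma> aX a lam v)"
    by (simp add: dyn_shift_def clinear_sum[OF assms(3)] clinear_scaleC[OF assms(3)])
  finally show ?thesis by simp
qed

lemma commutes_if_weight_components:
  assumes "weight_module aX" "weight_module aY" "clinear \<phi>"
    and off: "\<And>\<mu> \<nu> v. \<mu> \<in> weights aX \<Longrightarrow> \<nu> \<in> weights aY \<Longrightarrow> \<mu> \<noteq> \<nu> \<Longrightarrow>
      weight_comp aY (\<phi> (weight_comp aX v \<mu>)) \<nu> = 0"
    and h: "h \<in> cartan"
  shows "\<phi> (aX h v) = aY h (\<phi> v)"
proof -
  interpret X: weight_module aX by fact
  interpret Y: weight_module aY by fact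
  have *: "aY h (\<phi> (weight_comp aX v \<mu>)) = pairing \<mu> h *\<^sub>C \<phi> (weight_comp aX v \<mu>)" if \<mu>: "\<mu> \<in> weights aX" for \<mu>
  proof -
    let ?w = "\<phi> (weight_comp aX v \<mu>)"
    have "aY h ?w = (\<Sum>\<nu>\<in>weights aY. pairing \<nu> h *\<^sub>C weight_comp aY ?w \<nu>)"
      using clinear_sum[OF Y.clinear_act[OF h], of "weight_comp aY ?w" "weights aY"]
      by (simp add: Y.sum_weight_comp Y.act_weight_comp[OF h])
    also have "\<dots> = (\<Sum>\<nu>\<in>weights aY. pairing \<mu> h *\<^sub>C weight_comp aY ?w \<nu>)"
    proof (intro sum.cong refl)
      fix \<nu> assume "\<nu> \<in> weights aY"
      then show "pairing \<nu> h *\<^sub>C weight_comp aY ?w \<nu> = pairing \<mu> h *\<^sub>C weight_comp aY ?w \<nu>"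
        using off[OF \<mu>, of \<nu> v] by (cases "\<mu> = \<nu>") auto
    qed
    also have "\<dots> = pairing \<mu> h *\<^sub>C ?w"
      by (simp add: complex_vector.scale_sum_right[symmetric] Y.sum_weight_comp)
    finally show ?thesis .
  qed
  have e: "v = (\<Sum>\<mu>\<in>weights aX. weight_comp aX v \<mu>)" by (simp add: X.sum_weight_comp)
  have "aY h (\<phi> v) = (\<Sum>\<mu>\<in>weights aX. aY h (\<phi> (weight_comp aX v \<mu>)))"
    by (subst e) (simp only: clinear_sum[OF assms(3)] clinear_sum[OF Y.clinear_act[OF h]])
  also have "\<dots> = (\<Sum>\<mu>\<in>weights aX. \<phi> (aX h (weight_comp aX v \<mu>)))"
    by (intro sum.cong refl) (simp add: * X.act_weight_comp[OF h] clinear_scaleC[OF assms(3)])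
  also have "\<dots> = \<phi> (aX h (\<Sum>\<mu>\<in>weights aX. weight_comp aX v \<mu>))"
    by (simp only: clinear_sum[OF assms(3)] clinear_sum[OF X.clinear_act[OF h]])
  finally show ?thesis by (simp add: X.sum_weight_comp)
qed

section \<open>The pointwise linear algebra\<close>

text \<open>A scalar matrix acts on tuples of vectors, and a left inverse cancels it. Used also in
  contrapositive form, where a nonzero tuple in the kernel shows that the matrix is
  singular.\<close>

lemma invertible_matrix_module_kernel:
  fixes C :: "'n::finite cmat" and t :: "'n \<Rightarrow> 'v::complex_vector"
  assumes "invertible C" "\<And>i. (\<Sum>m\<in>UNIV. C $ i $ m *\<^sub>C t m) = 0"
  shows "t k = 0"
proof -
  obtain D where D: "D ** C = mat 1" using assms(1) unfolding invertible_def by blast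
  have "0 = (\<Sum>i\<in>UNIV. D $ k $ i *\<^sub>C (\<Sum>m\<in>UNIV. C $ i $ m *\<^sub>C t m))" using assms(2) by simp
  also have "\<dots> = (\<Sum>m\<in>UNIV. (\<Sum>i\<in>UNIV. D $ k $ i * C $ i $ m) *\<^sub>C t m)"
    unfolding complex_vector.scale_sum_right complex_vector.scale_sum_left
    by (subst sum.swap) (simp add: scaleC_scaleC)
  also have "\<dots> = (\<Sum>m\<in>UNIV. (if k = m then t m else 0))"
  proof (intro sum.cong refl)
    fix m
    have "(\<Sum>i\<in>UNIV. D $ k $ i * C $ i $ m) = (D ** C) $ k $ m"
      by (simp add: matrix_matrix_mult_def)
    then show "(\<Sum>i\<in>UNIV. D $ k $ i * C $ i $ m) *\<^sub>C t m = (if k = m then t m else 0)"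
      by (simp add: D mat_def scaleC_one)
  qed
  finally show ?thesis by simp
qed

text \<open>On the component of weight \<nu> the operator S(\<lambda> - \<gamma>h) is the ordinary
  matrix S(\<lambda> - \<gamma>\<nu>), which can be inverted there.\<close>

lemma (in weight_module) dyn_shift_matrix_cancel:
  fixes S :: "'n cvec \<Rightarrow> 'n cmat" and p q :: "'n \<Rightarrow> 'v"
  assumes inv: "\<And>\<nu>. \<nu> \<in> weights act \<Longrightarrow> invertible (S (lam - \<gamma> *\<^sub>R \<nu>))"
    and eq: "\<And>i. (\<Sum>j\<in>UNIV. dyn_shift \<gamma> act (\<lambda>lam'. S lam' $ i $ j) lam (p j)) =
      (\<Sum>j\<in>UNIV. dyn_shift \<gamma> act (\<lambda>lam'. S lam' $ i $ j) lam (q j))"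
  shows "p j = q j"
proof -
  have comp: "weight_comp act (\<Sum>j\<in>UNIV. dyn_shift \<gamma> act (\<lambda>lam'. S lam' $ i $ j) lam (r j)) \<nu> =
      (\<Sum>j\<in>UNIV. S (lam - \<gamma> *\<^sub>R \<nu>) $ i $ j *\<^sub>C weight_comp act (r j) \<nu>)" for i r \<nu>
    by (simp add: clinear_sum[OF clinear_weight_comp] weight_comp_dyn_shift)
  have "weight_comp act (p j) \<nu> = weight_comp act (q j) \<nu>" for \<nu>
  proof (cases "\<nu> \<in> weights act")
    case True
    have "(\<Sum>m\<in>UNIV. S (lam - \<gamma> *\<^sub>R \<nu>) $ i $ m *\<^sub>C (weight_comp act (p m) \<nu> - weight_comp act (q m) \<nu>)) = 0" for i
      using arg_cong[OF eq[of i], of "\<lambda>w. weight_comp act w \<nu>"]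
      unfolding comp by (simp add: complex_vector.scale_right_diff_distrib sum_subtractf)
    then have "weight_comp act (p j) \<nu> - weight_comp act (q j) \<nu> = 0"
      by (rule invertible_matrix_module_kernel[OF inv[OF True]])
    then show ?thesis by simp
  qed (simp add: weight_comp_eq_0)
  then have "(\<Sum>\<nu>\<in>weights act. weight_comp act (p j) \<nu>) = (\<Sum>\<nu>\<in>weights act. weight_comp act (q j) \<nu>)"
    by (intro sum.cong refl)
  then show ?thesis unfolding sum_weight_comp .
qed

definition commutes_with_total_action ::
    "('n::finite cvec \<Rightarrow> 'v::complex_vector \<Rightarrow> 'v) \<Rightarrow> ('n, 'v) blocks \<Rightarrow> bool" where
  "commutes_with_total_action act M \<longleftrightarrow> (\<forall>h\<in>cartan. \<forall>x i.
     blocks_apply M (\<lambda>j. h $ j *\<^sub>C x j + act h (x j)) i =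
     h $ i *\<^sub>C blocks_apply M x i + act h (blocks_apply M x i))"

lemma blocks_apply_single:
  assumes "\<And>i j. clinear (M i j)"
  shows "blocks_apply M (\<lambda>i. if i = j then v else 0) i = M i j v"
proof -
  have "M i m (if m = j then v else 0) = (if m = j then M i j v else 0)" for m
    by (simp add: clinear_0[OF assms])
  then show ?thesis by (simp add: blocks_apply_def)
qed

lemma blocks_apply_scaleC:
  assumes "\<And>i j. clinear (M i j)"
  shows "blocks_apply M (\<lambda>i. c *\<^sub>C x i) i = c *\<^sub>C blocks_apply M x i"
  by (simp add: blocks_apply_def clinear_scaleC[OF assms] complex_vector.scale_sum_right)

text \<open>The vector with entry \<open>q\<close> at index \<open>m\<close> has total weight
  \<open>omega m + \<nu>\<close>, which the operator preserves, so its entry at index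
  \<open>i\<close> has weight \<open>omega m + \<nu> - omega i\<close>. Only the coordinate
  \<open>k\<close> is tested, by acting with \<open>omega k\<close>.\<close>

lemma (in weight_module) block_shifts_weight:
  assumes lin: "\<And>i j. clinear (M i j)" and comm: "commutes_with_total_action act M"
    and q: "q \<in> weight_space act \<nu>" "\<nu> \<in> hstar"
    and ne: "\<rho> $ k \<noteq> omega k $ m + \<nu> $ k - omega k $ i"
  shows "weight_comp act (M i m q) \<rho> = 0"
proof (rule weight_comp_omega_eigenvector[OF _ ne])
  let ?h = "omega k" and ?x = "\<lambda>i. if i = m then q else 0"
  have eq: "act ?h q = \<nu> $ k *\<^sub>C q"
    using q omega_in_cartan[of k] by (simp add: weight_space_iff pairing_omega)
  have x: "(\<lambda>j. ?h $ j *\<^sub>C ?x j + act ?h (?x j)) = (\<lambda>j. (?h $ m + \<nu> $ k) *\<^sub>C ?x j)"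
    by (auto simp: eq scaleC_add_left clinear_0[OF clinear_act[OF omega_in_cartan]])
  have "blocks_apply M (\<lambda>j. ?h $ j *\<^sub>C ?x j + act ?h (?x j)) i =
      ?h $ i *\<^sub>C blocks_apply M ?x i + act ?h (blocks_apply M ?x i)"
    by (rule comm[unfolded commutes_with_total_action_def, rule_format, OF omega_in_cartan])
  then have "(?h $ m + \<nu> $ k) *\<^sub>C M i m q = ?h $ i *\<^sub>C M i m q + act ?h (M i m q)"
    unfolding x blocks_apply_scaleC[OF lin] blocks_apply_single[OF lin] .
  then show "act ?h (M i m q) = (?h $ m + \<nu> $ k - ?h $ i) *\<^sub>C M i m q"
    by (simp add: complex_vector.scale_left_diff_distrib)
qed

text \<open>The total weight of the source vector \<open>e\<^sub>j \<otimes> v\<^sub>\<mu>\<close> and that of the target component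
  \<open>e\<^sub>k \<otimes> w\<^sub>\<nu>\<close> differ in the coordinate \<open>k\<close> by \<open>(\<nu> - \<mu>)\<^sub>k + 1\<close>. Since \<open>L\<close> preserves the total weight,
  that component vanishes if \<open>\<phi>\<close> has no component with this weight shift.\<close>

lemma pivot_determinant_eq_0:
  fixes S :: "'n::finite cvec \<Rightarrow> 'n cmat"
  assumes "weight_module aX" "weight_module aY"
    and linX: "\<And>i j. clinear (MX i j)" and commX: "commutes_with_total_action aX MX"
    and bijX: "bij (blocks_apply MX)"
    and linY: "\<And>i j. clinear (MY i j)" and commY: "commutes_with_total_action aY MY"
    and lin0: "clinear \<phi>0" and lin1: "\<And>m. clinear (\<phi>1 m)"
    and no_shift: "\<And>m \<mu>' \<nu>' v. \<mu>' \<in> weights aX \<Longrightarrow> \<nu>' \<in> weights aY \<Longrightarrow>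
      (\<nu>' - \<mu>') $ k = (\<nu> - \<mu>) $ k + 1 \<Longrightarrow> weight_comp aY (\<phi>1 m (weight_comp aX v \<mu>')) \<nu>' = 0"
    and star: "\<And>y i. \<phi>0 (\<Sum>j\<in>UNIV. dyn_shift \<gamma> aX (\<lambda>lam'. S lam' $ i $ j) lam (blocks_apply MX y j)) =
      (\<Sum>j\<in>UNIV. dyn_shift \<gamma> aY (\<lambda>lam'. S lam' $ i $ j) lam (blocks_apply MY (\<lambda>m. \<phi>1 m (y m)) j))"
    and \<mu>: "\<mu> \<in> weights aX"
    and w: "weight_comp aY (\<phi>0 (weight_comp aX v \<mu>)) \<nu> \<noteq> 0"
    and jk: "j \<noteq> k"
  shows "det (\<chi> i m. if m = k then S (lam - \<gamma> *\<^sub>R \<mu>) $ i $ j else S (lam - \<gamma> *\<^sub>R \<nu>) $ i $ m) = 0"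
proof -
  interpret X: weight_module aX by fact
  interpret Y: weight_module aY by fact
  define h :: "'n cvec" where "h = omega k"
  have h: "h \<in> cartan" "h $ k - h $ j = 1"
    using jk by (simp_all add: h_def omega_in_cartan) (simp add: omega_def)
  define v' where "v' = weight_comp aX v \<mu>"
  define u where "u = (\<lambda>i. if i = j then v' else 0)"
  define y where "y = inv (blocks_apply MX) u"
  have y: "blocks_apply MX y = u" using bijX by (simp add: y_def bij_is_surj surj_f_inv_f)
  \<comment> \<open>The eigenvalue of \<open>omega k\<close> on \<open>u\<close> for the total
    action, and on its preimage \<open>y\<close> because the blocks commute with that action and are
    injective.\<close>
  define a where "a = h $ j + \<mu> $ k"
  have v': "v' \<in> weight_space aX \<mu>" "\<mu> \<in> hstar"
    using X.weight_comp_in_weight_space X.weights_in_hstar \<mu> by (simp_all add: v'_def)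
  have "aX h v' = \<mu> $ k *\<^sub>C v'" using v' h(1) by (simp add: weight_space_iff h_def pairing_omega)
  then have "blocks_apply MX (\<lambda>m. h $ m *\<^sub>C y m + aX h (y m)) i = blocks_apply MX (\<lambda>m. a *\<^sub>C y m) i" for i
    using commX h(1) unfolding commutes_with_total_action_def blocks_apply_scaleC[OF linX]
    by (simp add: y u_def a_def scaleC_add_left clinear_0[OF X.clinear_act[OF h(1)]])
  then have "blocks_apply MX (\<lambda>m. h $ m *\<^sub>C y m + aX h (y m)) = blocks_apply MX (\<lambda>m. a *\<^sub>C y m)"
    by (rule ext)
  then have "(\<lambda>m. h $ m *\<^sub>C y m + aX h (y m)) = (\<lambda>m. a *\<^sub>C y m)"
    by (rule injD[OF bij_is_inj[OF bijX]])
  then have "h $ m *\<^sub>C y m + aX h (y m) = a *\<^sub>C y m" for m by (rule fun_cong)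
  then have "aX h (y m) = (a - h $ m) *\<^sub>C y m" for m
    by (simp add: complex_vector.scale_left_diff_distrib eq_diff_eq add.commute)
  then have yw: "weight_comp aX (y m) \<mu>' = 0" if "\<mu>' $ k \<noteq> a - h $ m" for m \<mu>'
    using X.weight_comp_omega_eigenvector that unfolding h_def by blast
  define r where "r = blocks_apply MY (\<lambda>m. \<phi>1 m (y m))"
  have "weight_comp aY (MY k m (\<phi>1 m (y m))) \<nu> = 0" for m
  proof -
    let ?p = "\<phi>1 m (y m)"
    have "weight_comp aY (MY k m (weight_comp aY ?p \<nu>')) \<nu> = 0" if \<nu>': "\<nu>' \<in> weights aY" for \<nu>'
    proof (cases "\<nu> $ k = h $ m + \<nu>' $ k - h $ k")
      case False
      then show ?thesis
        using Y.weight_comp_in_weight_space Y.weights_in_hstar[OF \<nu>'] unfolding h_def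
        by (intro Y.block_shifts_weight[OF linY commY])
    next
      case True
      have "weight_comp aY (\<phi>1 m (weight_comp aX (y m) \<mu>')) \<nu>' = 0" if \<mu>': "\<mu>' \<in> weights aX" for \<mu>'
      proof (cases "\<mu>' $ k = a - h $ m")
        case False
        then show ?thesis
          by (simp add: yw clinear_0[OF lin1] clinear_0[OF Y.clinear_weight_comp])
      next
        case eq: True
        \<comment> \<open>The contribution of \<open>m\<close> cancels, and
          \<open>h $ k - h $ j = 1\<close> leaves exactly the excluded shift.\<close>
        have "\<nu>' $ k - \<mu>' $ k = \<nu> $ k - \<mu> $ k + (h $ k - h $ j)"
          unfolding eq True a_def by (simp add: algebra_simps)
        then show ?thesis using no_shift[OF \<mu>' \<nu>'] h(2) by simp
      qed
      then have "weight_comp aY (\<phi>1 m (\<Sum>\<mu>'\<in>weights aX. weight_comp aX (y m) \<mu>')) \<nu>' = 0"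
        by (simp add: clinear_sum[OF lin1] clinear_sum[OF Y.clinear_weight_comp])
      then show ?thesis
        by (simp add: X.sum_weight_comp clinear_0[OF linY] clinear_0[OF Y.clinear_weight_comp])
    qed
    then have "weight_comp aY (MY k m (\<Sum>\<nu>'\<in>weights aY. weight_comp aY ?p \<nu>')) \<nu> = 0"
      by (simp add: clinear_sum[OF linY] clinear_sum[OF Y.clinear_weight_comp])
    then show ?thesis by (simp add: Y.sum_weight_comp)
  qed
  then have rk: "weight_comp aY (r k) \<nu> = 0"
    by (simp add: r_def blocks_apply_def clinear_sum[OF Y.clinear_weight_comp])
  let ?C = "\<chi> i m. if m = k then S (lam - \<gamma> *\<^sub>R \<mu>) $ i $ j else S (lam - \<gamma> *\<^sub>R \<nu>) $ i $ m"
  \<comment> \<open>A vector in the kernel of \<open>?C\<close>. As the component of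
    \<open>r k\<close> of weight \<nu> is 0, the slot \<open>k\<close> is free to carry the column
    coming from \<mu>.\<close>
  define t where "t m = (if m = k then weight_comp aY (\<phi>0 v') \<nu> else - weight_comp aY (r m) \<nu>)" for m
  have "(\<Sum>m\<in>UNIV. ?C $ i $ m *\<^sub>C t m) = 0" for i
  proof -
    have "dyn_shift \<gamma> aX (\<lambda>lam'. S lam' $ i $ m) lam (u m) =
        (if m = j then S (lam - \<gamma> *\<^sub>R \<mu>) $ i $ j *\<^sub>C v' else 0)" for m
      using X.dyn_shift_weight_vector[OF v'] by (simp add: u_def clinear_0[OF X.clinear_dyn_shift])
    then have "\<phi>0 (S (lam - \<gamma> *\<^sub>R \<mu>) $ i $ j *\<^sub>C v') =
        (\<Sum>m\<in>UNIV. dyn_shift \<gamma> aY (\<lambda>lam'. S lam' $ i $ m) lam (r m))"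
      using star[of i y] unfolding y r_def by simp
    from arg_cong[OF this, of "\<lambda>w. weight_comp aY w \<nu>"]
    have "S (lam - \<gamma> *\<^sub>R \<mu>) $ i $ j *\<^sub>C weight_comp aY (\<phi>0 v') \<nu> =
        (\<Sum>m\<in>UNIV. S (lam - \<gamma> *\<^sub>R \<nu>) $ i $ m *\<^sub>C weight_comp aY (r m) \<nu>)"
      by (simp add: clinear_scaleC[OF lin0] clinear_scaleC[OF Y.clinear_weight_comp]
          clinear_sum[OF Y.clinear_weight_comp] Y.weight_comp_dyn_shift)
    also have "\<dots> = (\<Sum>m\<in>UNIV - {k}. S (lam - \<gamma> *\<^sub>R \<nu>) $ i $ m *\<^sub>C weight_comp aY (r m) \<nu>)"
      by (intro sum.mono_neutral_right) (auto simp: rk)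
    finally have *: "S (lam - \<gamma> *\<^sub>R \<mu>) $ i $ j *\<^sub>C weight_comp aY (\<phi>0 v') \<nu> = \<dots>" .
    have "(\<Sum>m\<in>UNIV. ?C $ i $ m *\<^sub>C t m) = ?C $ i $ k *\<^sub>C t k + (\<Sum>m\<in>UNIV - {k}. ?C $ i $ m *\<^sub>C t m)"
      by (rule sum.remove) simp_all
    also have "(\<Sum>m\<in>UNIV - {k}. ?C $ i $ m *\<^sub>C t m) =
        - (\<Sum>m\<in>UNIV - {k}. S (lam - \<gamma> *\<^sub>R \<nu>) $ i $ m *\<^sub>C weight_comp aY (r m) \<nu>)"
      unfolding sum_negf[symmetric] by (intro sum.cong) (auto simp: t_def)
    also have "?C $ i $ k *\<^sub>C t k = S (lam - \<gamma> *\<^sub>R \<mu>) $ i $ j *\<^sub>C weight_comp aY (\<phi>0 v') \<nu>"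
      by (simp add: t_def)
    finally show ?thesis unfolding * by simp
  qed
  moreover have "t k \<noteq> 0" using w by (simp add: t_def v'_def)
  ultimately have "\<not> invertible ?C" using invertible_matrix_module_kernel by blast
  then show ?thesis by (simp add: invertible_det_nz)
qed

section \<open>Test functions\<close>

text \<open>Indexing by \<open>option\<close> gives a finite type, so the exceptional sets of all
  these test functions can be removed together.\<close>

fun character :: "'n::finite option \<Rightarrow> 'n cvec \<Rightarrow> complex" where
  "character None lam = 1"
| "character (Some j) lam = exp (2 * \<i> * pi * lam $ j)"

definition test_section :: "'n::finite option \<Rightarrow> 'n \<Rightarrow> 'v::complex_vector \<Rightarrow> 'n cvec \<Rightarrow> 'n \<Rightarrow> 'v" where
  "test_section s l v lam i = (if i = l then character s lam *\<^sub>C v else 0)"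

text \<open>The vector \<open>n *\<^sub>C omega i\<close> has the integer coordinates
  \<open>n - 1\<close> and \<open>- 1\<close>.\<close>

lemma character_periodic:
  "character s (lam + of_nat CARD('n) *\<^sub>C omega i) = character s (lam :: 'n::finite cvec)"
proof (cases s)
  case (Some j)
  have "2 * \<i> * pi * (lam + of_nat CARD('n) *\<^sub>C omega i) $ j =
      2 * \<i> * pi * lam $ j + 2 * \<i> * pi * of_int (of_nat CARD('n) * (if j = i then 1 else 0) - 1)"
    by (simp add: scaleC_vec_def scaleC_complex_def omega_def algebra_simps)
  moreover have "exp (2 * \<i> * pi * of_int k) = 1" for k unfolding exp_eq_1 by auto
  ultimately show ?thesis unfolding Some by (simp only: character.simps exp_add mult_1_right)
qed simp

lemma holo_on_character: "holo_on hstar hstar (\<lambda>lam. character s lam * b)"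
proof -
  have "\<exists>D. ((\<lambda>lam. character s lam * b) has_derivative D) (at lam within hstar) \<and>
      (\<forall>c. \<forall>v\<in>hstar. D (c *\<^sub>C v) = c * D v)" for lam :: "'a cvec"
  proof (cases s)
    case None
    show ?thesis unfolding None by (rule exI[of _ "\<lambda>_. 0"]) simp
  next
    case (Some j)
    have lin: "((\<lambda>lam. 2 * \<i> * pi * lam $ j) has_derivative (\<lambda>v. 2 * \<i> * pi * v $ j)) (at lam within hstar)"
      by (intro bounded_linear.has_derivative[OF bounded_linear_mult_right]
          bounded_linear_imp_has_derivative bounded_linear_vec_nth)
    have "(exp has_field_derivative exp (2 * \<i> * pi * lam $ j)) (at (2 * \<i> * pi * lam $ j))"
      by (rule DERIV_exp)
    then have "((\<lambda>lam. exp (2 * \<i> * pi * lam $ j)) has_derivative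
        (\<lambda>v. exp (2 * \<i> * pi * lam $ j) * (2 * \<i> * pi * v $ j))) (at lam within hstar)"
      using has_derivative_compose[OF lin] unfolding has_field_derivative_def by blast
    then have "((\<lambda>lam. exp (2 * \<i> * pi * lam $ j) * b) has_derivative
        (\<lambda>v. exp (2 * \<i> * pi * lam $ j) * (2 * \<i> * pi * v $ j) * b)) (at lam within hstar)"
      by (rule has_derivative_mult_left)
    then show ?thesis unfolding Some character.simps
      by (intro exI conjI) (auto simp: scaleC_vec_def scaleC_complex_def)
  qed
  then show ?thesis unfolding holo_on_def by blast
qed

lemma holo_on_imp_mero_on:
  assumes "holo_on E E f"
  shows "mero_on E f"
  unfolding mero_on_def
proof
  fix x assume "x \<in> E"
  moreover have "holo_on E E (\<lambda>_. 1)"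
    unfolding holo_on_def by (intro ballI exI[of _ "\<lambda>_. 0"]) simp
  ultimately show "\<exists>U p q. openin (top_of_set E) U \<and> x \<in> U \<and> holo_on E U p \<and> holo_on E U q \<and>
       U \<subseteq> closure {y\<in>U. q y \<noteq> 0} \<and> (\<forall>y\<in>U. q y \<noteq> 0 \<longrightarrow> f y = p y / q y)"
    using assms by (intro exI[of _ E] exI[of _ f] exI[of _ "\<lambda>_. 1"]) (simp add: closure_subset)
qed

lemma test_section_in_lam_sections: "test_section s l v \<in> lam_sections"
proof -
  have "mero_on hstar (\<lambda>lam. f (test_section s l v lam i))" if f: "clinear f" for f and i
  proof -
    have "(\<lambda>lam. f (test_section s l v lam i)) = (\<lambda>lam. character s lam * (if i = l then f v else 0))"
      by (auto simp: test_section_def clinear_scaleC[OF f] clinear_0[OF f] scaleC_complex_def)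
    then show ?thesis using holo_on_imp_mero_on[OF holo_on_character] by metis
  qed
  moreover have "lam_periodic (test_section s l v)"
    unfolding lam_periodic_def
    by (intro allI generically_all) (auto simp: test_section_def character_periodic fun_eq_iff)
  ultimately show ?thesis by (simp add: lam_sections_def mero_vec_def)
qed

lemma exp_gamma_neq_1:
  assumes "\<gamma> \<notin> \<rat>"
  shows "exp (- (2 * \<i> * pi * of_real \<gamma>)) \<noteq> 1"
proof
  assume "exp (- (2 * \<i> * pi * of_real \<gamma>)) = 1"
  then obtain k :: int where "- (2 * pi * \<gamma>) = of_int (2 * k) * pi" unfolding exp_eq_1 by auto
  then have "pi * (2 * \<gamma>) = pi * (2 * of_int (- k))" by (simp add: algebra_simps)
  then have "\<gamma> = of_int (- k)" by (simp only: mult_cancel_left) simp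
  then show False using assms Rats_of_int by metis
qed

text \<open>The coordinate \<open>omega k $ j\<close> is the same for all
  \<open>k \<noteq> j\<close>, so this exponential singles out the point with
  \<open>k = j\<close>.\<close>

lemma character_shift:
  "character (Some j) (lam - \<gamma> *\<^sub>R omega k) =
     exp (2 * \<i> * pi * (lam $ j + of_real \<gamma> / of_nat CARD('n))) *
     (if k = j then exp (- (2 * \<i> * pi * of_real \<gamma>)) else 1)"
  for lam :: "'n::finite cvec"
proof -
  have "2 * \<i> * pi * (lam - \<gamma> *\<^sub>R omega k) $ j =
      2 * \<i> * pi * (lam $ j + of_real \<gamma> / of_nat CARD('n)) +
      (if k = j then - (2 * \<i> * pi * of_real \<gamma>) else 0)"
    by (simp add: omega_def scaleR_conv_of_real[where 'a = complex] algebra_simps)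
  then show ?thesis unfolding character.simps by (simp only: exp_add) simp
qed

lemma invertible_matrix_inv:
  assumes "invertible A"
  shows "invertible (matrix_inv A)"
proof -
  have "A ** matrix_inv A = mat 1 \<and> matrix_inv A ** A = mat 1"
    unfolding matrix_inv_def using assms[unfolded invertible_def] by (rule someI_ex)
  then show ?thesis unfolding invertible_def by blast
qed

lemma clinear_eq_0_if_spanning:
  assumes "clinear f" "complex_vector.span B = UNIV" "\<And>v. v \<in> B \<Longrightarrow> f v = 0"
  shows "f v = 0"
proof -
  have "v \<in> complex_vector.span B" using assms(2) by simp
  then show ?thesis
    by (induction rule: complex_vector.span_induct_alt)
       (simp_all add: clinear_0[OF assms(1)] clinear_add[OF assms(1)] clinear_scaleC[OF assms(1)] assms(3))
qed

text \<open>The combinations of a constant and an exponential separate the points \<open>\<lambda> - \<gamma>\<omega>\<^sub>k\<close>,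
  because \<open>\<gamma>\<close> is irrational.\<close>

lemma test_sections_separate:
  fixes T :: "'n::{finite,linorder} \<Rightarrow> 'v::complex_vector \<Rightarrow> 'w::complex_vector"
    and M :: "'n \<Rightarrow> 'n cmat"
  assumes gamma: "\<gamma> \<notin> \<rat>" and lin: "\<And>k. clinear (T k)" and inv: "\<And>k. invertible (M k)"
    and span: "complex_vector.span B = UNIV"
    and zero: "\<And>s l v. v \<in> B \<Longrightarrow>
      (\<Sum>k\<in>UNIV. T k (\<Sum>i\<in>UNIV. M k $ k $ i *\<^sub>C test_section s l v (lam - \<gamma> *\<^sub>R omega k) i)) = 0"
  shows "T j v = 0"
proof (rule clinear_eq_0_if_spanning[OF lin span])
  fix v assume v: "v \<in> B"
  define q where "q = exp (- (2 * \<i> * pi * of_real \<gamma>))"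
  define e where "e = exp (2 * \<i> * pi * (lam $ j + of_real \<gamma> / of_nat CARD('n)))"
  have s: "(\<Sum>k\<in>UNIV. (M k $ k $ l * character s (lam - \<gamma> *\<^sub>R omega k)) *\<^sub>C T k v) = 0" for s l
  proof -
    have "(\<Sum>i\<in>UNIV. M k $ k $ i *\<^sub>C test_section s l v (lam - \<gamma> *\<^sub>R omega k) i) =
        (M k $ k $ l * character s (lam - \<gamma> *\<^sub>R omega k)) *\<^sub>C v" for k
      unfolding test_section_def by (simp add: if_distrib scaleC_scaleC cong: if_cong)
    then show ?thesis using zero[OF v, of s l] by (simp add: clinear_scaleC[OF lin])
  qed
  have "M j $ j $ l *\<^sub>C T j v = 0" for l
  proof -
    \<comment> \<open>Subtracting \<open>e\<close> times the relation for the constant function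
      cancels every term with \<open>k \<noteq> j\<close>.\<close>
    have "0 = (\<Sum>k\<in>UNIV. (M k $ k $ l * character (Some j) (lam - \<gamma> *\<^sub>R omega k)) *\<^sub>C T k v) -
        e *\<^sub>C (\<Sum>k\<in>UNIV. (M k $ k $ l * character None (lam - \<gamma> *\<^sub>R omega k)) *\<^sub>C T k v)"
      unfolding s by simp
    also have "\<dots> = (\<Sum>k\<in>UNIV. if k = j then (M j $ j $ l * e * (q - 1)) *\<^sub>C T j v else 0)"
      unfolding complex_vector.scale_sum_right sum_subtractf[symmetric] character_shift
        e_def[symmetric] q_def[symmetric]
    proof (intro sum.cong refl)
      fix k
      have "(M k $ k $ l * (e * p)) *\<^sub>C T k v - e *\<^sub>C (M k $ k $ l * character None lam') *\<^sub>C T k v =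
          (M k $ k $ l * e * (p - 1)) *\<^sub>C T k v" for p lam'
        unfolding scaleC_scaleC complex_vector.scale_left_diff_distrib[symmetric]
        by (rule arg_cong[where f = "\<lambda>a. a *\<^sub>C T k v"]) (simp add: algebra_simps)
      then show "(M k $ k $ l * (e * (if k = j then q else 1))) *\<^sub>C T k v -
          e *\<^sub>C (M k $ k $ l * character None (lam - \<gamma> *\<^sub>R omega k)) *\<^sub>C T k v =
          (if k = j then (M j $ j $ l * e * (q - 1)) *\<^sub>C T j v else 0)"
        by auto
    qed
    finally have "(M j $ j $ l * e * (q - 1)) *\<^sub>C T j v = 0" by simp
    then show ?thesis using exp_gamma_neq_1[OF gamma] by (simp add: e_def q_def)
  qed
  moreover have "\<exists>l. M j $ j $ l \<noteq> 0"
  proof (rule ccontr)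
    assume "\<nexists>l. M j $ j $ l \<noteq> 0"
    then have "row j (M j) = 0" by (simp add: row_def vec_eq_iff)
    then have "det (M j) = 0" by (rule det_zero_row)
    then show False using inv[of j] by (simp add: invertible_det_nz)
  qed
  ultimately show "T j v = 0" by auto
qed

section \<open>Morphisms\<close>

lemma functor_obj_apply:
  "functor_obj \<tau> \<gamma> c x X z f lam i =
    (\<Sum>j\<in>UNIV. dyn_shift \<gamma> (action X) (\<lambda>lam'. S_mat \<tau> (z - x) lam' $ i $ j) lam
      (blocks_apply (L_op X z lam) (\<lambda>k. S1_inv \<tau> (z - x - c) f (lam - \<gamma> *\<^sub>R omega k) k) j))"
  by (simp add: functor_obj_def S1_dyn_def shift_D1_def)

lemma hstar_shift: "lam \<in> hstar \<Longrightarrow> lam - \<gamma> *\<^sub>R omega k \<in> hstar"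
  and hstar_shift_iff: "lam + - (\<gamma> *\<^sub>R omega k) \<in> hstar \<longleftrightarrow> lam \<in> hstar"
  using omega_in_cartan[of k]
  by (simp_all add: traceless_def sum_subtractf scaleR_sum_right[symmetric])

lemma S1_inv_mor:
  assumes "clinear (\<phi> lam)"
  shows "S1_inv \<tau> z (\<lambda>lam' j. \<phi> lam' (f lam' j)) lam k = \<phi> lam (S1_inv \<tau> z f lam k)"
  by (simp add: S1_inv_def clinear_sum[OF assms] clinear_scaleC[OF assms])

text \<open>Here \<phi> is not assumed to be a morphism in either category, so both implications can
  be proved in this context.\<close>

locale CF_pair =
  fixes \<tau> c x :: complex and \<gamma> :: real
    and X :: "('n::{finite,linorder}, 'v::complex_vector) CF_object"
    and Y :: "('n, 'w::complex_vector) CF_object"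
    and \<phi> :: "'n cvec \<Rightarrow> 'v \<Rightarrow> 'w"
  assumes tau: "Im \<tau> > 0" and gamma: "\<gamma> \<notin> \<rat>" and n: "CARD('n) \<ge> 2"
    and X: "X \<in> CF_objects \<tau> \<gamma>" and Y: "Y \<in> CF_objects \<tau> \<gamma>"
    and mero: "mero_lin hstar \<phi>"
begin

abbreviation E :: "(complex \<times> 'n cvec) set" where "E \<equiv> UNIV \<times> hstar"

sublocale WX: weight_module "action X"
  using X by unfold_locales (auto simp: CF_objects_def Let_def)

sublocale WY: weight_module "action Y"
  using Y by unfold_locales (auto simp: CF_objects_def Let_def)

lemma clinear_mor: "lam \<in> hstar \<Longrightarrow> clinear (\<phi> lam)"
  using mero by (simp add: mero_lin_def)

lemma clinear_LX: "lam \<in> hstar \<Longrightarrow> clinear (L_op X z lam i j)"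
  and clinear_LY: "lam \<in> hstar \<Longrightarrow> clinear (L_op Y z lam i j)"
  using X Y by (force simp: CF_objects_def Let_def mero_blocks_def mero_lin_def)+

lemma bij_LX: "generically E (\<lambda>(z, lam). bij (blocks_apply (L_op X z lam)))"
  and comm_LX: "generically E (\<lambda>(z, lam). commutes_with_total_action (action X) (L_op X z lam))"
  and comm_LY: "generically E (\<lambda>(z, lam). commutes_with_total_action (action Y) (L_op Y z lam))"
  using X Y by (simp_all add: CF_objects_def Let_def commutes_with_total_action_def)

definition weight_zero :: bool where
  "weight_zero \<longleftrightarrow> generically hstar (\<lambda>lam. \<forall>h\<in>cartan. \<forall>v. \<phi> lam (action X h v) = action Y h (\<phi> lam v))"

definition intertwines_L :: bool where
  "intertwines_L \<longleftrightarrow> generically E (\<lambda>(z, lam). \<forall>y i.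
     blocks_apply (L_op Y z lam) (\<lambda>j. \<phi> (lam - \<gamma> *\<^sub>R omega j) (y j)) i =
     \<phi> lam (blocks_apply (L_op X z lam) y i))"

definition intertwines_images :: bool where
  "intertwines_images \<longleftrightarrow> (\<forall>f\<in>lam_sections. generically E (\<lambda>(z, lam). \<forall>i.
     \<phi> lam (functor_obj \<tau> \<gamma> c x X z f lam i) =
     functor_obj \<tau> \<gamma> c x Y z (\<lambda>lam' j. \<phi> lam' (f lam' j)) lam i))"

text \<open>The intertwining identity after removal of the shift and of the inverse of S(z - x - c,
  \<lambda>), tested on one vector.\<close>

definition star_at :: "complex \<Rightarrow> 'n cvec \<Rightarrow> ('n \<Rightarrow> 'v) \<Rightarrow> 'n \<Rightarrow> bool" where
  "star_at z lam y i \<longleftrightarrow>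
    \<phi> lam (\<Sum>j\<in>UNIV. dyn_shift \<gamma> (action X) (\<lambda>lam'. S_mat \<tau> (z - x) lam' $ i $ j) lam
      (blocks_apply (L_op X z lam) y j)) =
    (\<Sum>j\<in>UNIV. dyn_shift \<gamma> (action Y) (\<lambda>lam'. S_mat \<tau> (z - x) lam' $ i $ j) lam
      (blocks_apply (L_op Y z lam) (\<lambda>m. \<phi> (lam - \<gamma> *\<^sub>R omega m) (y m)) j))"

lemma star_at_iff:
  assumes "lam \<in> hstar"
  shows "star_at z lam (\<lambda>k. S1_inv \<tau> (z - x - c) f (lam - \<gamma> *\<^sub>R omega k) k) i \<longleftrightarrow>
    \<phi> lam (functor_obj \<tau> \<gamma> c x X z f lam i) =
     functor_obj \<tau> \<gamma> c x Y z (\<lambda>lam' j. \<phi> lam' (f lam' j)) lam i"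
  by (simp add: star_at_def functor_obj_apply S1_inv_mor clinear_mor hstar_shift assms)

text \<open>Weight zero lets \<phi> pass through S(z - x, \<lambda> - \<gamma>h), the condition on
  \<open>L\<close> lets it pass through \<open>L\<close>, and linearity lets it pass through the
  inverse of S.\<close>

lemma intertwines_L_imp_images:
  assumes "weight_zero" "intertwines_L"
  shows "intertwines_images"
  unfolding intertwines_images_def
proof
  fix f assume "f \<in> (lam_sections :: ('n cvec \<Rightarrow> 'n \<Rightarrow> 'v) set)"
  have "generically E (\<lambda>(z, lam). \<forall>h\<in>cartan. \<forall>v. \<phi> lam (action X h v) = action Y h (\<phi> lam v))"
    using assms(1) unfolding weight_zero_def by (rule generically_snd_iff[THEN iffD2])
  from generically_conj[OF this assms(2)[unfolded intertwines_L_def]]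
  show "generically E (\<lambda>(z, lam). \<forall>i. \<phi> lam (functor_obj \<tau> \<gamma> c x X z f lam i) =
     functor_obj \<tau> \<gamma> c x Y z (\<lambda>lam' j. \<phi> lam' (f lam' j)) lam i)"
  proof (rule generically_mono, clarsimp)
    fix z lam i
    assume lam: "lam \<in> hstar"
      and wz: "\<forall>h\<in>cartan. \<forall>v. \<phi> lam (action X h v) = action Y h (\<phi> lam v)"
      and L: "\<forall>y i. blocks_apply (L_op Y z lam) (\<lambda>j. \<phi> (lam - \<gamma> *\<^sub>R omega j) (y j)) i =
        \<phi> lam (blocks_apply (L_op X z lam) y i)"
    have "\<phi> lam (dyn_shift \<gamma> (action X) a lam v) = dyn_shift \<gamma> (action Y) a lam (\<phi> lam v)" for a v
      using wz WX.weight_module_axioms WY.weight_module_axioms clinear_mor[OF lam]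
      by (intro weight_zero_map_dyn_shift) auto
    then have "star_at z lam y i" for y
      unfolding star_at_def using L by (simp add: clinear_sum[OF clinear_mor[OF lam]])
    then show "\<phi> lam (functor_obj \<tau> \<gamma> c x X z f lam i) =
        functor_obj \<tau> \<gamma> c x Y z (\<lambda>lam' j. \<phi> lam' (f lam' j)) lam i"
      using star_at_iff[OF lam] by blast
  qed
qed

text \<open>Both sides of \<open>star_at\<close> are linear in each entry of \<open>y\<close>; this
  is the coefficient of the entry \<open>k\<close> in their difference.\<close>

definition star_block :: "complex \<Rightarrow> 'n cvec \<Rightarrow> 'n \<Rightarrow> 'n \<Rightarrow> 'v \<Rightarrow> 'w" where
  "star_block z lam i k v =
    \<phi> lam (\<Sum>j\<in>UNIV. dyn_shift \<gamma> (action X) (\<lambda>lam'. S_mat \<tau> (z - x) lam' $ i $ j) lam (L_op X z lam j k v)) -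
    (\<Sum>j\<in>UNIV. dyn_shift \<gamma> (action Y) (\<lambda>lam'. S_mat \<tau> (z - x) lam' $ i $ j) lam
      (L_op Y z lam j k (\<phi> (lam - \<gamma> *\<^sub>R omega k) v)))"

lemma clinear_star_block:
  assumes "lam \<in> hstar"
  shows "clinear (star_block z lam i k)"
  unfolding clinear_iff star_block_def
  by (simp add: clinear_add[OF clinear_LX[OF assms]] clinear_add[OF clinear_LY[OF assms]]
      clinear_add[OF WX.clinear_dyn_shift] clinear_add[OF WY.clinear_dyn_shift]
      clinear_add[OF clinear_mor[OF assms]] clinear_add[OF clinear_mor[OF hstar_shift[OF assms]]]
      clinear_scaleC[OF clinear_LX[OF assms]] clinear_scaleC[OF clinear_LY[OF assms]]
      clinear_scaleC[OF WX.clinear_dyn_shift] clinear_scaleC[OF WY.clinear_dyn_shift]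
      clinear_scaleC[OF clinear_mor[OF assms]] clinear_scaleC[OF clinear_mor[OF hstar_shift[OF assms]]]
      sum.distrib complex_vector.scale_sum_right[symmetric] complex_vector.scale_right_diff_distrib)

lemma star_at_iff_blocks:
  assumes "lam \<in> hstar"
  shows "star_at z lam y i \<longleftrightarrow> (\<Sum>k\<in>UNIV. star_block z lam i k (y k)) = 0"
proof -
  have "(\<Sum>k\<in>UNIV. star_block z lam i k (y k)) =
      \<phi> lam (\<Sum>k\<in>UNIV. \<Sum>j\<in>UNIV. dyn_shift \<gamma> (action X) (\<lambda>lam'. S_mat \<tau> (z - x) lam' $ i $ j) lam
        (L_op X z lam j k (y k))) -
      (\<Sum>k\<in>UNIV. \<Sum>j\<in>UNIV. dyn_shift \<gamma> (action Y) (\<lambda>lam'. S_mat \<tau> (z - x) lam' $ i $ j) lam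
        (L_op Y z lam j k (\<phi> (lam - \<gamma> *\<^sub>R omega k) (y k))))"
    by (simp add: star_block_def sum_subtractf clinear_sum[OF clinear_mor[OF assms]])
  also have "\<dots> = \<phi> lam (\<Sum>j\<in>UNIV. dyn_shift \<gamma> (action X) (\<lambda>lam'. S_mat \<tau> (z - x) lam' $ i $ j) lam
      (blocks_apply (L_op X z lam) y j)) -
    (\<Sum>j\<in>UNIV. dyn_shift \<gamma> (action Y) (\<lambda>lam'. S_mat \<tau> (z - x) lam' $ i $ j) lam
      (blocks_apply (L_op Y z lam) (\<lambda>m. \<phi> (lam - \<gamma> *\<^sub>R omega m) (y m)) j))"
    unfolding blocks_apply_def clinear_sum[OF WX.clinear_dyn_shift] clinear_sum[OF WY.clinear_dyn_shift]
    by (subst (1 2) sum.swap) (rule refl)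
  finally show ?thesis by (simp add: star_at_def)
qed

lemma invertible_S_generically:
  "generically E (\<lambda>(z, lam). invertible (S_mat \<tau> (z - d) (lam - w)))"
  using S_mat_generically_invertible[OF tau, of d "- w"] by simp

text \<open>The hypothesis supplies a separate dense open set for each section. A finite spanning
  set and finitely many characters suffice, so one common set serves all vectors.\<close>

lemma images_imp_star:
  assumes "intertwines_images"
  shows "generically E (\<lambda>(z, lam). \<forall>y i. star_at z lam y i)"
proof -
  obtain B :: "'v set" where B: "finite B" "complex_vector.span B = UNIV"
    using WX.finite_dim unfolding finite_dim_def by blast
  have t: "generically E (\<lambda>p. \<forall>s l. \<forall>v\<in>B. case p of (z, lam) \<Rightarrow> \<forall>i.
      \<phi> lam (functor_obj \<tau> \<gamma> c x X z (test_section s l v) lam i) =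
      functor_obj \<tau> \<gamma> c x Y z (\<lambda>lam' j. \<phi> lam' (test_section s l v lam' j)) lam i)"
    using assms test_section_in_lam_sections unfolding intertwines_images_def
    by (intro generically_all_finite generically_ball_finite B) blast
  have "generically E (\<lambda>p. \<forall>k. case p of (z, lam) \<Rightarrow> invertible (S_mat \<tau> (z - (x + c)) (lam - \<gamma> *\<^sub>R omega k)))"
    by (intro generically_all_finite invertible_S_generically)
  from generically_conj[OF t this] show ?thesis
  proof (rule generically_mono, clarsimp)
    fix z lam y i
    assume lam: "lam \<in> hstar"
      and t: "\<forall>s l. \<forall>v\<in>B. \<forall>i. \<phi> lam (functor_obj \<tau> \<gamma> c x X z (test_section s l v) lam i) =
        functor_obj \<tau> \<gamma> c x Y z (\<lambda>lam' j. \<phi> lam' (test_section s l v lam' j)) lam i"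
      and inv: "\<forall>k. invertible (S_mat \<tau> (z - (x + c)) (lam - \<gamma> *\<^sub>R omega k))"
    define M where "M k = matrix_inv (S_mat \<tau> (z - x - c) (lam - \<gamma> *\<^sub>R omega k))" for k
    have "invertible (M k)" for k
      using inv unfolding M_def diff_diff_eq by (blast intro: invertible_matrix_inv)
    moreover have "(\<Sum>k\<in>UNIV. star_block z lam i k
        (\<Sum>m\<in>UNIV. M k $ k $ m *\<^sub>C test_section s l v (lam - \<gamma> *\<^sub>R omega k) m)) = 0" if "v \<in> B" for s l v
      using t that star_at_iff[OF lam, of z "test_section s l v" i]
      unfolding star_at_iff_blocks[OF lam] S1_inv_def M_def by blast
    ultimately have "star_block z lam i k v = 0" for k v
      by (rule test_sections_separate[OF gamma clinear_star_block[OF lam] _ B(2)])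
    then show "star_at z lam y i" by (simp add: star_at_iff_blocks[OF lam])
  qed
qed

section \<open>Components of a morphism between different weights\<close>

definition has_component :: "'n cvec \<Rightarrow> 'n cvec \<Rightarrow> 'n cvec \<Rightarrow> bool" where
  "has_component \<mu> \<nu> lam \<longleftrightarrow> (\<exists>v. weight_comp (action Y) (\<phi> lam (weight_comp (action X) v \<mu>)) \<nu> \<noteq> 0)"

text \<open>Outside the support a component vanishes on a dense open set; the finitely many such
  sets and their translates by each \<open>\<gamma> *\<^sub>R omega m\<close> can be
  intersected.\<close>

definition support :: "('n cvec \<times> 'n cvec) set" where
  "support = {(\<mu>, \<nu>). \<mu> \<in> weights (action X) \<and> \<nu> \<in> weights (action Y) \<and>
     \<not> generically hstar (\<lambda>lam. \<not> has_component \<mu> \<nu> lam)}"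

lemma S_mat_column: "S_mat \<tau> z lam $ i $ j = Phi \<tau> (z - of_nat CARD('n) * lam $ j) $ i" for i j :: 'n
  by (simp add: S_mat_def)

text \<open>If the determinant were nonzero at a single point, it would be nonzero generically, and
  \<open>pivot_determinant_eq_0\<close> would make the component vanish generically, against
  membership in the support. So the determinant is identically 0.\<close>

lemma support_extremal_imp_lattice:
  assumes star: "generically E (\<lambda>(z, lam). \<forall>y i. star_at z lam y i)"
    and supp: "(\<mu>, \<nu>) \<in> support"
    and ext: "\<And>\<mu>' \<nu>'. (\<mu>', \<nu>') \<in> support \<Longrightarrow> (\<nu>' - \<mu>') $ k \<noteq> (\<nu> - \<mu>) $ k + 1"
    and jk: "j \<noteq> k"
  shows "of_real \<gamma> * (\<mu> $ j - \<nu> $ j) \<in> lattice \<tau>"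
proof -
  \<comment> \<open>Row \<open>k\<close> of the \<open>Phi_det\<close> stands for column
    \<open>j\<close> of S at \<open>lam - \<gamma> *\<^sub>R \<mu>\<close>, hence the entry
    \<open>\<mu> $ j\<close> and the shared coordinate.\<close>
  define b where "b m = (if m = k then of_nat CARD('n) * (of_real \<gamma> * \<mu> $ j) - x
    else of_nat CARD('n) * (of_real \<gamma> * \<nu> $ m) - x)" for m
  have zero: "Phi_det \<tau> (id(k := j)) b (z, lam) = 0" if "lam \<in> hstar" for z lam
  proof (rule ccontr)
    assume "Phi_det \<tau> (id(k := j)) b (z, lam) \<noteq> 0"
    then have nz: "generically E (\<lambda>(z, lam). Phi_det \<tau> (id(k := j)) b (z, lam) \<noteq> 0)"
      using that by (intro Phi_det_generically_nonzero[OF tau]) blast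
    have "generically E (\<lambda>p. \<forall>m. \<forall>q \<in> weights (action X) \<times> weights (action Y). case p of (z, lam) \<Rightarrow>
        q \<notin> support \<longrightarrow> \<not> has_component (fst q) (snd q) (lam - \<gamma> *\<^sub>R omega m))"
    proof (intro generically_all_finite generically_ball_finite)
      fix m :: 'n and q assume q: "q \<in> weights (action X) \<times> weights (action Y)"
      have "generically hstar (\<lambda>lam. q \<notin> support \<longrightarrow> \<not> has_component (fst q) (snd q) (lam - \<gamma> *\<^sub>R omega m))"
      proof (cases "q \<in> support")
        case False
        then have "generically hstar (\<lambda>lam. \<not> has_component (fst q) (snd q) lam)"
          using q by (auto simp: support_def)
        from generically_translate[OF this, of "- (\<gamma> *\<^sub>R omega m)"] show ?thesis
          using hstar_shift_iff[of _ \<gamma> m] False by simp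
      qed (simp add: generically_all)
      then show "generically E (\<lambda>p. case p of (z, lam) \<Rightarrow>
          q \<notin> support \<longrightarrow> \<not> has_component (fst q) (snd q) (lam - \<gamma> *\<^sub>R omega m))"
        by (rule generically_snd_iff[THEN iffD2])
    qed (simp add: WX.finite_weights WY.finite_weights)
    from generically_conj[OF generically_conj[OF star nz]
        generically_conj[OF this generically_conj[OF bij_LX generically_conj[OF comm_LX comm_LY]]]]
    have "generically E (\<lambda>(z, lam). \<not> has_component \<mu> \<nu> lam)"
    proof (rule generically_mono, clarsimp)
      fix z lam
      assume lam: "lam \<in> hstar" and hc: "has_component \<mu> \<nu> lam"
        and star: "\<forall>y i. star_at z lam y i"
        and nz: "Phi_det \<tau> (id(k := j)) b (z, lam) \<noteq> 0"
        and nc: "\<forall>m. \<forall>\<mu>'\<in>weights (action X). \<forall>\<nu>'\<in>weights (action Y).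
          (\<mu>', \<nu>') \<notin> support \<longrightarrow> \<not> has_component \<mu>' \<nu>' (lam - \<gamma> *\<^sub>R omega m)"
        and L: "bij (blocks_apply (L_op X z lam))" "commutes_with_total_action (action X) (L_op X z lam)"
          "commutes_with_total_action (action Y) (L_op Y z lam)"
      obtain v where v: "weight_comp (action Y) (\<phi> lam (weight_comp (action X) v \<mu>)) \<nu> \<noteq> 0"
        using hc unfolding has_component_def by blast
      have "\<mu> \<in> weights (action X)" using supp by (simp add: support_def)
      from pivot_determinant_eq_0[where S = "S_mat \<tau> (z - x)" and \<gamma> = \<gamma> and lam = lam and k = k,
          OF WX.weight_module_axioms WY.weight_module_axioms
          clinear_LX[OF lam] L(2) L(1) clinear_LY[OF lam] L(3) clinear_mor[OF lam]
          clinear_mor[OF hstar_shift[OF lam]] _ star[unfolded star_at_def, rule_format] this v jk]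
      have "det (\<chi> i m. if m = k then S_mat \<tau> (z - x) (lam - \<gamma> *\<^sub>R \<mu>) $ i $ j
          else S_mat \<tau> (z - x) (lam - \<gamma> *\<^sub>R \<nu>) $ i $ m) = 0"
        using nc ext unfolding has_component_def by blast
      also have "(\<chi> i m. if m = k then S_mat \<tau> (z - x) (lam - \<gamma> *\<^sub>R \<mu>) $ i $ j
          else S_mat \<tau> (z - x) (lam - \<gamma> *\<^sub>R \<nu>) $ i $ m) =
        transpose (\<chi> m. Phi \<tau> (b m + z - of_nat CARD('n) * lam $ (id(k := j)) m))"
        unfolding S_mat_column transpose_def vec_eq_iff vec_lambda_beta
        by (auto simp: b_def scaleR_conv_of_real[where 'a = complex] algebra_simps)
      finally have "Phi_det \<tau> (id(k := j)) b (z, lam) = 0"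
        unfolding det_transpose Phi_det_def by simp
      then show False using nz by blast
    qed
    then have "generically hstar (\<lambda>lam. \<not> has_component \<mu> \<nu> lam)"
      by (rule generically_snd_iff[THEN iffD1])
    then show False using supp by (simp add: support_def)
  qed
  have "(b k - b j) / of_nat CARD('n) \<in> lattice \<tau>"
    using Phi_det_eq_0_imp_lattice[OF tau n jk zero] .
  moreover have "(b k - b j) / of_nat CARD('n) = of_real \<gamma> * (\<mu> $ j - \<nu> $ j)"
    using jk by (simp add: b_def field_simps)
  ultimately show ?thesis by simp
qed

lemma support_diagonal:
  assumes star: "generically E (\<lambda>(z, lam). \<forall>y i. star_at z lam y i)"
    and nonres: "nonresonant \<tau> \<gamma> X Y"
    and "(\<mu>0, \<nu>0) \<in> support"
  shows "\<mu>0 = \<nu>0"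
proof (rule ccontr)
  assume ne: "\<mu>0 \<noteq> \<nu>0"
  have traceless: "(\<Sum>i\<in>UNIV. (\<nu> - \<mu>) $ i) = 0" if "(\<mu>, \<nu>) \<in> support" for \<mu> \<nu>
    using that WX.weights_in_hstar[of \<mu>] WY.weights_in_hstar[of \<nu>]
    by (simp add: support_def sum_subtractf traceless_def)
  \<comment> \<open>If every nonzero coordinate had negative real part, the coordinates could not
    sum to 0.\<close>
  obtain k where k: "(\<nu>0 - \<mu>0) $ k \<noteq> 0" "Re ((\<nu>0 - \<mu>0) $ k) \<ge> 0"
  proof (rule ccontr)
    assume "\<not> thesis"
    then have neg: "(\<nu>0 - \<mu>0) $ i \<noteq> 0 \<Longrightarrow> Re ((\<nu>0 - \<mu>0) $ i) < 0" for i
      using that by (meson not_le)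
    obtain i where "(\<nu>0 - \<mu>0) $ i \<noteq> 0" using ne by (metis right_minus_eq vec_eq_iff vector_minus_component)
    then have "(\<Sum>i\<in>UNIV. Re ((\<nu>0 - \<mu>0) $ i)) < (\<Sum>i\<in>(UNIV :: 'n set). 0)"
    proof (intro sum_strict_mono_ex1 ballI bexI[of _ i])
      show "Re ((\<nu>0 - \<mu>0) $ i) \<le> 0" for i
        using neg[of i] by (cases "(\<nu>0 - \<mu>0) $ i = 0") auto
    qed (use neg in auto)
    moreover have "(\<Sum>i\<in>UNIV. Re ((\<nu>0 - \<mu>0) $ i)) = 0"
      using traceless[OF assms(3)] by (simp only: Re_sum[symmetric]) simp
    ultimately show False by simp
  qed
  \<comment> \<open>Here \<open>k\<close> comes from the given pair, but the maximum runs over the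
    whole support; the contradiction arises for the maximising pair, which may be a different
    one.\<close>
  define A where "A = {(\<mu>, \<nu>) \<in> support. (\<nu> - \<mu>) $ k \<noteq> 0 \<and> Re ((\<nu> - \<mu>) $ k) \<ge> 0}"
  have "A \<subseteq> weights (action X) \<times> weights (action Y)" by (auto simp: A_def support_def)
  then have "finite A" using WX.finite_weights WY.finite_weights by (meson finite_SigmaI finite_subset)
  moreover have "(\<mu>0, \<nu>0) \<in> A" using assms(3) k by (simp add: A_def)
  ultimately have "Max ((\<lambda>q. Re ((snd q - fst q) $ k)) ` A) \<in> (\<lambda>q. Re ((snd q - fst q) $ k)) ` A"
    by (intro Max_in) auto
  then obtain p where p: "p \<in> A" "Max ((\<lambda>q. Re ((snd q - fst q) $ k)) ` A) = Re ((snd p - fst p) $ k)"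
    by blast
  have max: "Re ((snd q - fst q) $ k) \<le> Re ((snd p - fst p) $ k)" if "q \<in> A" for q
    unfolding p(2)[symmetric] using \<open>finite A\<close> that by (intro Max_ge) auto
  obtain \<mu> \<nu> where \<mu>\<nu>: "p = (\<mu>, \<nu>)" by (cases p)
  then have supp: "(\<mu>, \<nu>) \<in> support" and pk: "(\<nu> - \<mu>) $ k \<noteq> 0" "Re ((\<nu> - \<mu>) $ k) \<ge> 0"
    using p(1) by (auto simp: A_def)
  have ext: "(\<nu>' - \<mu>') $ k \<noteq> (\<nu> - \<mu>) $ k + 1" if "(\<mu>', \<nu>') \<in> support" for \<mu>' \<nu>'
  proof
    assume eq: "(\<nu>' - \<mu>') $ k = (\<nu> - \<mu>) $ k + 1"
    then have re: "Re ((\<nu>' - \<mu>') $ k) = Re ((\<nu> - \<mu>) $ k) + 1" by simp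
    then have "(\<nu>' - \<mu>') $ k \<noteq> 0" using pk(2) by (metis add_nonneg_pos less_irrefl zero_complex.sel(1) zero_less_one)
    then have "(\<mu>', \<nu>') \<in> A" using that re pk(2) by (simp add: A_def)
    then show False using max[of "(\<mu>', \<nu>')"] re \<mu>\<nu> by simp
  qed
  have lat: "of_real \<gamma> * (\<mu> $ j - \<nu> $ j) \<in> lattice \<tau>" if "j \<noteq> k" for j
    using support_extremal_imp_lattice[OF star supp ext that] .
  have add: "s + t \<in> lattice \<tau>" and neg: "- s \<in> lattice \<tau>" if "s \<in> lattice \<tau>" "t \<in> lattice \<tau>" for s t
  proof -
    obtain a b a' b' where "s = of_int a + of_int b * \<tau>" "t = of_int a' + of_int b' * \<tau>"
      using \<open>s \<in> lattice \<tau>\<close> \<open>t \<in> lattice \<tau>\<close> by (auto simp: lattice_def)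
    then have "s + t = of_int (a + a') + of_int (b + b') * \<tau>" "- s = of_int (- a) + of_int (- b) * \<tau>"
      by (simp_all add: algebra_simps)
    then show "s + t \<in> lattice \<tau>" "- s \<in> lattice \<tau>" unfolding lattice_def by blast+
  qed
  have zero: "0 \<in> lattice \<tau>" unfolding lattice_def by (auto intro!: exI[of _ 0])
  have "(\<Sum>j\<in>UNIV - {k}. of_real \<gamma> * (\<mu> $ j - \<nu> $ j)) \<in> lattice \<tau>"
  proof -
    have "(\<Sum>j\<in>J. of_real \<gamma> * (\<mu> $ j - \<nu> $ j)) \<in> lattice \<tau>" if "finite J" "k \<notin> J" for J
      using that by (induction J rule: finite_induct) (auto simp: zero intro!: add lat)
    then show ?thesis by simp
  qed
  moreover have "of_real \<gamma> * (\<mu> $ k - \<nu> $ k) = - (\<Sum>j\<in>UNIV - {k}. of_real \<gamma> * (\<mu> $ j - \<nu> $ j))"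
  proof -
    have "(\<mu> $ k - \<nu> $ k) + (\<Sum>j\<in>UNIV - {k}. \<mu> $ j - \<nu> $ j) = (\<Sum>j\<in>UNIV. \<mu> $ j - \<nu> $ j)"
      by (rule sum.remove[symmetric]) simp_all
    also have "\<dots> = 0" using traceless[OF supp] by (simp add: sum_subtractf)
    finally have "\<mu> $ k - \<nu> $ k = - (\<Sum>j\<in>UNIV - {k}. \<mu> $ j - \<nu> $ j)" by (simp add: eq_neg_iff_add_eq_0)
    then show ?thesis by (simp add: sum_distrib_left[symmetric])
  qed
  ultimately have "of_real \<gamma> * (\<mu> $ k - \<nu> $ k) \<in> lattice \<tau>" using neg by metis
  then have "\<forall>i. of_real \<gamma> * (\<mu> $ i - \<nu> $ i) \<in> lattice \<tau>" using lat by metis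
  then have "\<mu> = \<nu>" using nonres supp unfolding nonresonant_def support_def by blast
  then show False using pk(1) by simp
qed

lemma images_imp_intertwines_L:
  assumes "intertwines_images" and nonres: "nonresonant \<tau> \<gamma> X Y"
  shows "weight_zero \<and> intertwines_L"
proof -
  note star = images_imp_star[OF assms(1)]
  have "generically hstar (\<lambda>lam. \<forall>p \<in> {(\<mu>, \<nu>) \<in> weights (action X) \<times> weights (action Y). \<mu> \<noteq> \<nu>}.
      \<not> has_component (fst p) (snd p) lam)"
  proof (rule generically_ball_finite)
    show "finite {(\<mu>, \<nu>) \<in> weights (action X) \<times> weights (action Y). \<mu> \<noteq> \<nu>}"
      by (rule finite_subset[OF _ finite_cartesian_product[OF WX.finite_weights WY.finite_weights]]) auto
    fix p assume p: "p \<in> {(\<mu>, \<nu>) \<in> weights (action X) \<times> weights (action Y). \<mu> \<noteq> \<nu>}"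
    then have "(fst p, snd p) \<notin> support" using support_diagonal[OF star nonres] by auto
    then show "generically hstar (\<lambda>lam. \<not> has_component (fst p) (snd p) lam)"
      using p unfolding support_def by auto
  qed
  then have wz: weight_zero
    unfolding weight_zero_def
  proof (rule generically_mono, intro ballI allI)
    fix lam h :: "'n cvec" and v
    assume lam: "lam \<in> hstar" and h: "h \<in> cartan"
      and nc: "\<forall>p \<in> {(\<mu>, \<nu>) \<in> weights (action X) \<times> weights (action Y). \<mu> \<noteq> \<nu>}.
        \<not> has_component (fst p) (snd p) lam"
    show "\<phi> lam (action X h v) = action Y h (\<phi> lam v)"
    proof (rule commutes_if_weight_components[OF WX.weight_module_axioms WY.weight_module_axioms
          clinear_mor[OF lam] _ h])
      show "weight_comp (action Y) (\<phi> lam (weight_comp (action X) v \<mu>)) \<nu> = 0"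
        if "\<mu> \<in> weights (action X)" "\<nu> \<in> weights (action Y)" "\<mu> \<noteq> \<nu>" for \<mu> \<nu> v
        using bspec[OF nc, of "(\<mu>, \<nu>)"] that by (auto simp: has_component_def)
    qed
  qed
  have inv: "generically E (\<lambda>p. \<forall>\<nu>\<in>weights (action Y). case p of (z, lam) \<Rightarrow>
      invertible (S_mat \<tau> (z - x) (lam - \<gamma> *\<^sub>R \<nu>)))"
    by (intro generically_ball_finite WY.finite_weights invertible_S_generically)
  have "generically E (\<lambda>(z, lam). \<forall>h\<in>cartan. \<forall>v. \<phi> lam (action X h v) = action Y h (\<phi> lam v))"
    using wz unfolding weight_zero_def by (rule generically_snd_iff[THEN iffD2])
  from generically_conj[OF this generically_conj[OF star inv]]
  have intertwines_L
    unfolding intertwines_L_def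
  proof (rule generically_mono, clarsimp)
    fix z lam y i
    assume lam: "lam \<in> hstar"
      and wz: "\<forall>h\<in>cartan. \<forall>v. \<phi> lam (action X h v) = action Y h (\<phi> lam v)"
      and star: "\<forall>y i. star_at z lam y i"
      and inv: "\<forall>\<nu>\<in>weights (action Y). invertible (S_mat \<tau> (z - x) (lam - \<gamma> *\<^sub>R \<nu>))"
    have comm: "\<phi> lam (dyn_shift \<gamma> (action X) a lam v) = dyn_shift \<gamma> (action Y) a lam (\<phi> lam v)" for a v
      using wz WX.weight_module_axioms WY.weight_module_axioms clinear_mor[OF lam]
      by (intro weight_zero_map_dyn_shift) auto
    show "blocks_apply (L_op Y z lam) (\<lambda>j. \<phi> (lam - \<gamma> *\<^sub>R omega j) (y j)) i =
        \<phi> lam (blocks_apply (L_op X z lam) y i)"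
    proof (rule WY.dyn_shift_matrix_cancel[where S = "S_mat \<tau> (z - x)" and \<gamma> = \<gamma> and lam = lam])
      show "invertible (S_mat \<tau> (z - x) (lam - \<gamma> *\<^sub>R \<nu>))" if "\<nu> \<in> weights (action Y)" for \<nu>
        using inv that by blast
      show "(\<Sum>j\<in>UNIV. dyn_shift \<gamma> (action Y) (\<lambda>lam'. S_mat \<tau> (z - x) lam' $ i $ j) lam
          (blocks_apply (L_op Y z lam) (\<lambda>j. \<phi> (lam - \<gamma> *\<^sub>R omega j) (y j)) j)) =
        (\<Sum>j\<in>UNIV. dyn_shift \<gamma> (action Y) (\<lambda>lam'. S_mat \<tau> (z - x) lam' $ i $ j) lam
          (\<phi> lam (blocks_apply (L_op X z lam) y j)))" for i
        using star unfolding star_at_def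
        by (simp add: clinear_sum[OF clinear_mor[OF lam]] comm)
    qed
  qed
  with wz show ?thesis by blast
qed

end

theorem proposition3:
  fixes \<tau> c x :: complex and \<gamma> :: real
    and X :: "('n::{finite,linorder}, 'v::complex_vector) CF_object"
    and Y :: "('n, 'w::complex_vector) CF_object"
  assumes "Im \<tau> > 0" and "\<gamma> \<notin> \<rat>" and "CARD('n) \<ge> 2"
    and "X \<in> CF_objects \<tau> \<gamma>" and "Y \<in> CF_objects \<tau> \<gamma>"
    and "nonresonant \<tau> \<gamma> X Y"
  shows "bij_betw functor_mor (CF_hom \<gamma> X Y)
           (DB_hom (functor_obj \<tau> \<gamma> c x X) (functor_obj \<tau> \<gamma> c x Y))"
proof -
  \<comment> \<open>Both hom-sets consist of classes of representatives, so it is enough that the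
    two conditions on a representative agree.\<close>
  have "CF_hom \<gamma> X Y = DB_hom (functor_obj \<tau> \<gamma> c x X) (functor_obj \<tau> \<gamma> c x Y)"
    unfolding CF_hom_def DB_hom_def
  proof (intro arg_cong[where f = "image mero_class"] Collect_cong conj_cong refl)
    fix \<phi> :: "'n cvec \<Rightarrow> 'v \<Rightarrow> 'w"
    assume "mero_lin hstar \<phi>" "lam_periodic \<phi>"
    then interpret CF_pair \<tau> c x \<gamma> X Y \<phi>
      using assms by unfold_locales
    show "generically hstar (\<lambda>lam. \<forall>h\<in>cartan. \<forall>v. \<phi> lam (action X h v) = action Y h (\<phi> lam v)) \<and>
        generically (UNIV \<times> hstar) (\<lambda>(z, lam). \<forall>x i.
          blocks_apply (L_op Y z lam) (\<lambda>j. \<phi> (lam - \<gamma> *\<^sub>R omega j) (x j)) i =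
          \<phi> lam (blocks_apply (L_op X z lam) x i)) \<longleftrightarrow>
      (\<forall>f\<in>lam_sections. generically (UNIV \<times> hstar) (\<lambda>(z, lam). \<forall>i.
         \<phi> lam (functor_obj \<tau> \<gamma> c x X z f lam i) =
         functor_obj \<tau> \<gamma> c x Y z (\<lambda>lam' j. \<phi> lam' (f lam' j)) lam i))"
      using intertwines_L_imp_images images_imp_intertwines_L assms(6)
      unfolding weight_zero_def intertwines_L_def intertwines_images_def by blast
  qed
  then show ?thesis by (auto simp: bij_betw_def inj_on_def functor_mor_def)
qed

end
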